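(* Let $\epsilon>0$, $E_1,E_2\in[-2+\epsilon,2-\epsilon]$, $0\le a_1\neq a_2<1$, let $g_1,g_2\in H_0^2(\mathbb R)$ be real valued compactly supported functions and set $f_i(x):=g_i(N^{a_i}(x-E_i))$. Then the limiting Gaussian processes $\xi_{\mathrm{tr}}(f_1),\xi_{\mathrm{tr}}(f_2)$ (defined in the context) are asymptotically independent in the sense that $$|\operatorname{Cov}(\xi_{\mathrm{tr}}(f_1),\xi_{\mathrm{tr}}(f_2))|\lesssim N^{-|a_1-a_2|}.$$ Similarly, for bounded deterministic $N\times N$ matrices $A_1,A_2$ the processes $\xi_{\mathrm d},\xi_{\mathrm{od}}$ are asymptotically independent in the sense that $$\big|\operatorname{Cov}\big(\xi_{\mathrm d}(f_1,(\mathring{A_1})_{\mathrm d}),\xi_{\mathrm d}(f_2,(\mathring{A_2})_{\mathrm d})\big)\big|+\big|\operatorname{Cov}\big(\xi_{\mathrm{od}}(f_1,(A_1)_{\mathrm{od}}),\xi_{\mathrm{od}}(f_2,(A_2)_{\mathrm{od}})\big)\big|\lesssim N^{-|a_1-a_2|/2}.$$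
   Context: The processes are the (jointly) Gaussian centred limits of the linear eigenvalue/eigenvector statistics of a Wigner matrix $W$, an $N\times N$ Hermitian matrix with entries independent up to symmetry, $w_{ab}\overset d=N^{-1/2}\chi_{\mathrm{od}}$ ($a<b$, $\chi_{\mathrm{od}}$ real or complex), $w_{aa}\overset d=N^{-1/2}\chi_{\mathrm d}$ ($\chi_{\mathrm d}$ real), $\mathbf E\chi_{\mathrm{od}}=\mathbf E\chi_{\mathrm d}=0$, $\mathbf E|\chi_{\mathrm{od}}|^2=1$, $\sigma:=\mathbf E\chi_{\mathrm{od}}^2\in[-1,1]$ real, $\mathbf E|\chi_{\mathrm d}|^p+\mathbf E|\chi_{\mathrm{od}}|^p\le C_p$ for all $p\in\mathbb N$; $\kappa_4:=\mathbf E|\chi_{\mathrm{od}}|^4-2-\sigma^2$, $w_2:=\mathbf E\chi_{\mathrm d}^2$, $\widetilde{w_2}:=w_2-1-\sigma$. Notation: $\langle R\rangle:=N^{-1}\operatorname{Tr}R$; $A=\langle A\rangle I+\mathring A_{\mathrm d}+A_{\mathrm{od}}$ with $A_{\mathrm d}$ the diagonal part, $\mathring A_{\mathrm d}=A_{\mathrm d}-\langle A_{\mathrm d}\rangle I$, $A_{\mathrm{od}}=A-A_{\mathrm d}$; $\overline R$ is the entrywise conjugate. $\langle h\rangle_{\mathrm{sc}}:=\int_{-2}^2h(x)\frac{\sqrt{4-x^2}}{2\pi}dx$, $\langle h\rangle_{1/\mathrm{sc}}:=\int_{-2}^2\frac{h(x)}{\pi\sqrt{4-x^2}}dx$. $m(z)=\int_{-2}^2\frac{\sqrt{4-x^2}}{2\pi(x-z)}dx$,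 $\rho(z):=\frac1\pi|\operatorname{Im}m(z)|$, $C_N^{a,E}:=N^a/\rho(E+\mathrm iN^{-a})$ for $a>0$, $C_N^{0,E}:=1$; write $C_i:=C_N^{a_i,E_i}$. The covariances $\operatorname{Cov}(X,Y)=\mathbf EX\overline Y$ of the centred Gaussians are (the polarisation of the variance formulas of the CLT): $\operatorname{Cov}(\xi_{\mathrm{tr}}(f_1),\xi_{\mathrm{tr}}(f_2))=V_{\mathrm{tr}}^1(f_1,f_2)+V_{\mathrm{tr}}^2(f_1,f_2,\sigma)+\frac{\kappa_4}2\langle(2-x^2)f_1\rangle_{1/\mathrm{sc}}\langle(2-x^2)f_2\rangle_{1/\mathrm{sc}}+\frac{\widetilde{w_2}}4\langle xf_1\rangle_{1/\mathrm{sc}}\langle xf_2\rangle_{1/\mathrm{sc}}$, $\operatorname{Cov}(\xi_{\mathrm d}(f_1,B_1),\xi_{\mathrm d}(f_2,B_2))=\sqrt{C_1C_2}\langle B_1B_2^*\rangle\big(V_{\mathrm d}^1(f_1,f_2)+V_{\mathrm d}^2(f_1,f_2,\sigma)+\widetilde{w_2}\langle xf_1\rangle_{\mathrm{sc}}\langle xf_2\rangle_{\mathrm{sc}}+\kappa_4\langle(x^2-1)f_1\rangle_{\mathrm{sc}}\langle(x^2-1)f_2\rangle_{\mathrm{sc}}\big)$ for diagonal traceless $B_i$, $\operatorname{Cov}(\xi_{\mathrm{od}}(f_1,B_1),\xi_{\mathrm{od}}(f_2,B_2))=\sqrt{C_1C_2}\big(\langle B_1B_2^*\rangle V_{\mathrm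 d}^1(f_1,f_2)+\langle B_1\overline{B_2}\rangle V_{\mathrm d}^2(f_1,f_2,\sigma)\big)$ for off-diagonal $B_i$, where for $|\sigma|<1$ $V_{\mathrm{tr}}^1(f,h):=\frac1{4\pi^2}\iint_{-2}^2\frac{(f(x)-f(y))(h(x)-h(y))}{(x-y)^2}\frac{4-xy}{\sqrt{(4-x^2)(4-y^2)}}dxdy$, $V_{\mathrm{tr}}^2(f,h,\sigma):=\frac1{4\pi^2}\iint_{-2}^2f(x)h(y)\partial_x\partial_y\log\Big[\frac{(x-\sigma y)^2+(\sqrt{4-x^2}+\sigma\sqrt{4-y^2})^2}{(x-\sigma y)^2+(\sqrt{4-x^2}-\sigma\sqrt{4-y^2})^2}\Big]dxdy$, $V_{\mathrm d}^1(f,h):=\langle fh\rangle_{\mathrm{sc}}-\langle f\rangle_{\mathrm{sc}}\langle h\rangle_{\mathrm{sc}}$, $V_{\mathrm d}^2(f,h,\sigma):=\frac1{4\pi^2}\iint_{-2}^2f(x)h(y)\frac{(1-\sigma^2)\sqrt{(4-x^2)(4-y^2)}}{\sigma^2(x^2+y^2)+(1-\sigma^2)^2-xy\sigma(1+\sigma^2)}dxdy-\langle f\rangle_{\mathrm{sc}}\langle h\rangle_{\mathrm{sc}}$, and $V_{\mathrm{tr}}^2,V_{\mathrm d}^2$ are extended to $\sigma=\pm1$ as limits $\sigma\to\pm1$. The symbol $\lesssim$ means bounded up to an $N$-independent constant. *)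

theory Defs
  imports "HOL-Probability.Probability" "Jordan_Normal_Form.Schur_Decomposition"
begin

text \<open>Weak derivatives are taken, as in Brezis' textbook, against compactly supported
  \<open>C\<^sup>1\<close> functions; by mollification this is the same as testing against smooth ones.
  On the whole line \<open>H\<^sup>2\<^sub>0 = H\<^sup>2\<close>, the space of functions having two weak
  derivatives in \<open>L\<^sup>2\<close>.  Elements of \<open>H\<^sup>2\<close> are given by Borel representatives.\<close>

definition compactly_supported :: "(real \<Rightarrow> real) \<Rightarrow> bool" where
  "compactly_supported f \<longleftrightarrow> compact (closure {x. f x \<noteq> 0})"

definition has_weak_derivative :: "(real \<Rightarrow> real) \<Rightarrow> (real \<Rightarrow> real) \<Rightarrow> bool" where
  "has_weak_derivative f f' \<longleftrightarrow>
     (\<forall>\<phi>. \<phi> C1_differentiable_on UNIV \<longrightarrow> compactly_supported \<phi> \<longrightarrow>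
        (LINT x|lborel. f x * deriv \<phi> x) = - (LINT x|lborel. f' x * \<phi> x))"

definition L2_fun :: "(real \<Rightarrow> real) \<Rightarrow> bool" where
  "L2_fun f \<longleftrightarrow> f \<in> borel_measurable borel \<and> integrable lborel (\<lambda>x. (f x)\<^sup>2)"

definition H2_fun :: "(real \<Rightarrow> real) \<Rightarrow> bool" where
  "H2_fun f \<longleftrightarrow> L2_fun f \<and>
     (\<exists>f' f''. L2_fun f' \<and> L2_fun f'' \<and> has_weak_derivative f f' \<and> has_weak_derivative f' f'')"

definition H2c_fun :: "(real \<Rightarrow> real) \<Rightarrow> bool" where
  "H2c_fun f \<longleftrightarrow> H2_fun f \<and> compactly_supported f"

definition rescaled :: "nat \<Rightarrow> real \<Rightarrow> real \<Rightarrow> (real \<Rightarrow> real) \<Rightarrow> real \<Rightarrow> real" where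
  "rescaled N a E g = (\<lambda>x. g (real N powr a * (x - E)))"

definition sc_mean :: "(real \<Rightarrow> real) \<Rightarrow> real" where
  "sc_mean h = (LINT x:{-2..2}|lborel. h x * (sqrt (4 - x\<^sup>2) / (2 * pi)))"

definition inv_sc_mean :: "(real \<Rightarrow> real) \<Rightarrow> real" where
  "inv_sc_mean h = (LINT x:{-2..2}|lborel. h x / (pi * sqrt (4 - x\<^sup>2)))"

definition m_sc :: "complex \<Rightarrow> complex" where
  "m_sc z = (LINT x:{-2..2}|lborel.
               of_real (sqrt (4 - x\<^sup>2)) / (2 * of_real pi * (of_real x - z)))"

definition rho_sc :: "complex \<Rightarrow> real" where
  "rho_sc z = \<bar>Im (m_sc z)\<bar> / pi"

definition C_scale :: "nat \<Rightarrow> real \<Rightarrow> real \<Rightarrow> real" where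
  "C_scale N a E =
     (if a = 0 then 1 else real N powr a / rho_sc (Complex E (real N powr (- a))))"

definition mat_trace :: "complex mat \<Rightarrow> complex" where
  "mat_trace R = (\<Sum>i<dim_row R. R $$ (i, i))"

definition ntr :: "complex mat \<Rightarrow> complex" where
  "ntr R = mat_trace R / of_nat (dim_row R)"

definition diag_part :: "complex mat \<Rightarrow> complex mat" where
  "diag_part A = mat_diag (dim_row A) (\<lambda>i. A $$ (i, i))"

definition offdiag_part :: "complex mat \<Rightarrow> complex mat" where
  "offdiag_part A = A - diag_part A"

definition traceless_part :: "complex mat \<Rightarrow> complex mat" where
  "traceless_part A = A - ntr A \<cdot>\<^sub>m 1\<^sub>m (dim_row A)"

text \<open>The Euclidean operator norm of \<open>A\<close> is at most \<open>K\<close>.\<close>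

definition op_norm_le :: "complex mat \<Rightarrow> real \<Rightarrow> bool" where
  "op_norm_le A K \<longleftrightarrow> 0 \<le> K \<and>
     (\<forall>v \<in> carrier_vec (dim_col A).
        sqrt (\<Sum>i<dim_row A. (cmod (vec_index (A *\<^sub>v v) i))\<^sup>2)
          \<le> K * sqrt (\<Sum>i<dim_col A. (cmod (vec_index v i))\<^sup>2))"

text \<open>A real \<open>\<chi>\<^sub>o\<^sub>d\<close> is the case in which the complex variable has vanishing imaginary
  part.  The laws of the entries do not depend on the dimension, so the moment bounds are
  finiteness of all moments.\<close>

definition wigner_entries ::
  "'p measure \<Rightarrow> ('p \<Rightarrow> complex) \<Rightarrow> ('p \<Rightarrow> real) \<Rightarrow> bool" where
  "wigner_entries P \<chi>od \<chi>d \<longleftrightarrow>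
     prob_space P \<and> \<chi>od \<in> borel_measurable P \<and> \<chi>d \<in> borel_measurable P \<and>
     (\<forall>p::nat. integrable P (\<lambda>w. cmod (\<chi>od w) ^ p) \<and> integrable P (\<lambda>w. \<bar>\<chi>d w\<bar> ^ p)) \<and>
     (LINT w|P. \<chi>od w) = 0 \<and> (LINT w|P. \<chi>d w) = 0 \<and>
     (LINT w|P. (cmod (\<chi>od w))\<^sup>2) = 1 \<and>
     (LINT w|P. (\<chi>od w)\<^sup>2) \<in> complex_of_real ` {-1..1}"

definition entry_sigma :: "'p measure \<Rightarrow> ('p \<Rightarrow> complex) \<Rightarrow> real" where
  "entry_sigma P \<chi>od = Re (LINT w|P. (\<chi>od w)\<^sup>2)"

definition entry_kappa4 :: "'p measure \<Rightarrow> ('p \<Rightarrow> complex) \<Rightarrow> real" where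
  "entry_kappa4 P \<chi>od = (LINT w|P. (cmod (\<chi>od w)) ^ 4) - 2 - (entry_sigma P \<chi>od)\<^sup>2"

definition entry_w2 :: "'p measure \<Rightarrow> ('p \<Rightarrow> real) \<Rightarrow> real" where
  "entry_w2 P \<chi>d = (LINT w|P. (\<chi>d w)\<^sup>2)"

definition entry_w2_tilde ::
  "'p measure \<Rightarrow> ('p \<Rightarrow> complex) \<Rightarrow> ('p \<Rightarrow> real) \<Rightarrow> real" where
  "entry_w2_tilde P \<chi>od \<chi>d = entry_w2 P \<chi>d - 1 - entry_sigma P \<chi>od"

definition Vtr1 :: "(real \<Rightarrow> real) \<Rightarrow> (real \<Rightarrow> real) \<Rightarrow> real" where
  "Vtr1 f h = 1 / (4 * pi\<^sup>2) *
     (LINT (x, y):{-2..2} \<times> {-2..2}|lborel.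
        (f x - f y) * (h x - h y) / (x - y)\<^sup>2
          * ((4 - x * y) / sqrt ((4 - x\<^sup>2) * (4 - y\<^sup>2))))"

definition log_ratio :: "real \<Rightarrow> real \<Rightarrow> real \<Rightarrow> real" where
  "log_ratio s x y =
     ln (((x - s * y)\<^sup>2 + (sqrt (4 - x\<^sup>2) + s * sqrt (4 - y\<^sup>2))\<^sup>2) /
         ((x - s * y)\<^sup>2 + (sqrt (4 - x\<^sup>2) - s * sqrt (4 - y\<^sup>2))\<^sup>2))"

definition Vtr2_interior :: "(real \<Rightarrow> real) \<Rightarrow> (real \<Rightarrow> real) \<Rightarrow> real \<Rightarrow> real" where
  "Vtr2_interior f h s = 1 / (4 * pi\<^sup>2) *
     (LINT (x, y):{-2..2} \<times> {-2..2}|lborel.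
        f x * h y * deriv (\<lambda>u. deriv (\<lambda>v. log_ratio s u v) y) x)"

definition Vd1 :: "(real \<Rightarrow> real) \<Rightarrow> (real \<Rightarrow> real) \<Rightarrow> real" where
  "Vd1 f h = sc_mean (\<lambda>x. f x * h x) - sc_mean f * sc_mean h"

definition Vd2_interior :: "(real \<Rightarrow> real) \<Rightarrow> (real \<Rightarrow> real) \<Rightarrow> real \<Rightarrow> real" where
  "Vd2_interior f h s = 1 / (4 * pi\<^sup>2) *
     (LINT (x, y):{-2..2} \<times> {-2..2}|lborel.
        f x * h y * ((1 - s\<^sup>2) * sqrt ((4 - x\<^sup>2) * (4 - y\<^sup>2)) /
          (s\<^sup>2 * (x\<^sup>2 + y\<^sup>2) + (1 - s\<^sup>2)\<^sup>2 - x * y * s * (1 + s\<^sup>2))))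
     - sc_mean f * sc_mean h"

definition extend_to_endpoints :: "(real \<Rightarrow> real) \<Rightarrow> real \<Rightarrow> real" where
  "extend_to_endpoints V s =
     (if s = 1 then Lim (at_left 1) V else if s = -1 then Lim (at_right (-1)) V else V s)"

definition Vtr2 :: "(real \<Rightarrow> real) \<Rightarrow> (real \<Rightarrow> real) \<Rightarrow> real \<Rightarrow> real" where
  "Vtr2 f h = extend_to_endpoints (Vtr2_interior f h)"

definition Vd2 :: "(real \<Rightarrow> real) \<Rightarrow> (real \<Rightarrow> real) \<Rightarrow> real \<Rightarrow> real" where
  "Vd2 f h = extend_to_endpoints (Vd2_interior f h)"

definition cov_tr ::
  "real \<Rightarrow> real \<Rightarrow> real \<Rightarrow> (real \<Rightarrow> real) \<Rightarrow> (real \<Rightarrow> real) \<Rightarrow> real" where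
  "cov_tr \<sigma> \<kappa>4 w2t f h =
     Vtr1 f h + Vtr2 f h \<sigma>
     + \<kappa>4 / 2 * inv_sc_mean (\<lambda>x. (2 - x\<^sup>2) * f x) * inv_sc_mean (\<lambda>x. (2 - x\<^sup>2) * h x)
     + w2t / 4 * inv_sc_mean (\<lambda>x. x * f x) * inv_sc_mean (\<lambda>x. x * h x)"

text \<open>The next two functionals omit the factor \<open>sqrt (C\<^sub>1 C\<^sub>2)\<close>.\<close>

definition cov_d ::
  "real \<Rightarrow> real \<Rightarrow> real \<Rightarrow> (real \<Rightarrow> real) \<Rightarrow> complex mat \<Rightarrow> (real \<Rightarrow> real) \<Rightarrow> complex mat \<Rightarrow> complex"
where
  "cov_d \<sigma> \<kappa>4 w2t f B1 h B2 =
     ntr (B1 * mat_adjoint B2) *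
     of_real (Vd1 f h + Vd2 f h \<sigma>
       + w2t * sc_mean (\<lambda>x. x * f x) * sc_mean (\<lambda>x. x * h x)
       + \<kappa>4 * sc_mean (\<lambda>x. (x\<^sup>2 - 1) * f x) * sc_mean (\<lambda>x. (x\<^sup>2 - 1) * h x))"

definition cov_od ::
  "real \<Rightarrow> (real \<Rightarrow> real) \<Rightarrow> complex mat \<Rightarrow> (real \<Rightarrow> real) \<Rightarrow> complex mat \<Rightarrow> complex"
where
  "cov_od \<sigma> f B1 h B2 =
     ntr (B1 * mat_adjoint B2) * of_real (Vd1 f h)
     + ntr (B1 * map_mat cnj B2) * of_real (Vd2 f h \<sigma>)"

text \<open>The normalisation of \<open>\<xi>\<^sub>d\<close> and \<open>\<xi>\<^sub>o\<^sub>d\<close> involves \<open>C\<^sub>i\<close>, that is the scale \<open>a\<close> and the energy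
  \<open>E\<close> through which the test function is written as \<open>g (N\<^sup>a (x - E))\<close>.  These are not
  determined by the test function itself and are therefore part of the index:
  \<open>Xi_d a E f B\<close> and \<open>Xi_od a E f B\<close>, where \<open>f\<close> is the already rescaled function.\<close>

datatype xi_index =
    Xi_tr "real \<Rightarrow> real"
  | Xi_d real real "real \<Rightarrow> real" "complex mat"
  | Xi_od real real "real \<Rightarrow> real" "complex mat"

definition d_args :: "nat \<Rightarrow> (real \<times> real \<times> (real \<Rightarrow> real) \<times> complex mat) set" where
  "d_args N = {(a, E, f, B). 0 \<le> a \<and> a < 1 \<and> -2 < E \<and> E < 2 \<and> H2c_fun f \<and>
     B \<in> carrier_mat N N \<and> diagonal_mat B \<and> mat_trace B = 0}"

definition od_args :: "nat \<Rightarrow> (real \<times> real \<times> (real \<Rightarrow> real) \<times> complex mat) set" where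
  "od_args N = {(a, E, f, B). 0 \<le> a \<and> a < 1 \<and> -2 < E \<and> E < 2 \<and> H2c_fun f \<and>
     B \<in> carrier_mat N N \<and> (\<forall>i<N. B $$ (i, i) = 0)}"

definition xi_indices :: "nat \<Rightarrow> xi_index set" where
  "xi_indices N = {Xi_tr f |f. H2c_fun f}
     \<union> {Xi_d a E f B |a E f B. (a, E, f, B) \<in> d_args N}
     \<union> {Xi_od a E f B |a E f B. (a, E, f, B) \<in> od_args N}"

definition centred_gaussian :: "'w measure \<Rightarrow> ('w \<Rightarrow> real) \<Rightarrow> bool" where
  "centred_gaussian M Y \<longleftrightarrow> Y \<in> borel_measurable M \<and>
     ((\<exists>s>0. distributed M lborel Y (normal_density 0 s)) \<or> (AE w in M. Y w = 0))"

text \<open>Real parts of complex linear combinations are exactly the real linear combinations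
  of the real and imaginary parts.\<close>

definition centred_gaussian_process ::
  "'w measure \<Rightarrow> 'i set \<Rightarrow> ('i \<Rightarrow> 'w \<Rightarrow> complex) \<Rightarrow> bool" where
  "centred_gaussian_process M I X \<longleftrightarrow>
     (\<forall>F c. finite F \<longrightarrow> F \<subseteq> I \<longrightarrow> centred_gaussian M (\<lambda>w. Re (\<Sum>t\<in>F. c t * X t w)))"

definition Cov :: "'w measure \<Rightarrow> ('w \<Rightarrow> complex) \<Rightarrow> ('w \<Rightarrow> complex) \<Rightarrow> complex" where
  "Cov M X Y = (LINT w|M. X w * cnj (Y w))"

text \<open>Only what is stated about the covariances is required: pseudo-covariances
  \<open>E X Y\<close> and covariances between processes of different kinds are left free.\<close>

definition limit_process ::
  "nat \<Rightarrow> real \<Rightarrow> real \<Rightarrow> real \<Rightarrow> 'w measure \<Rightarrow> (xi_index \<Rightarrow> 'w \<Rightarrow> complex) \<Rightarrow> bool" where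
  "limit_process N \<sigma> \<kappa>4 w2t M \<xi> \<longleftrightarrow>
     prob_space M \<and> centred_gaussian_process M (xi_indices N) \<xi> \<and>
     (\<forall>f h. H2c_fun f \<longrightarrow> H2c_fun h \<longrightarrow>
        Cov M (\<xi> (Xi_tr f)) (\<xi> (Xi_tr h)) = of_real (cov_tr \<sigma> \<kappa>4 w2t f h)) \<and>
     (\<forall>(a1, E1, f, B1) \<in> d_args N. \<forall>(a2, E2, h, B2) \<in> d_args N.
        Cov M (\<xi> (Xi_d a1 E1 f B1)) (\<xi> (Xi_d a2 E2 h B2)) =
          of_real (sqrt (C_scale N a1 E1 * C_scale N a2 E2)) * cov_d \<sigma> \<kappa>4 w2t f B1 h B2) \<and>
     (\<forall>(a1, E1, f, B1) \<in> od_args N. \<forall>(a2, E2, h, B2) \<in> od_args N.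
        Cov M (\<xi> (Xi_od a1 E1 f B1)) (\<xi> (Xi_od a2 E2 h B2)) =
          of_real (sqrt (C_scale N a1 E1 * C_scale N a2 E2)) * cov_od \<sigma> f B1 h B2)"

end

theory Submission
  imports Defs
begin

text \<open>
  Substituting \<open>x = - 2 cos \<theta>\<close> turns every covariance into an integral over \<open>[0, \<pi>]\<^sup>2\<close> of
  \<open>F(\<theta>) H(\<phi>)\<close>, where \<open>F, H\<close> are the two test functions in the angle, against a kernel
  \<open>k(\<theta> - \<phi>) + k(\<theta> + \<phi>)\<close>.  For \<open>V\<^sub>t\<^sub>r\<^sup>1\<close> one has \<open>k = 1 / (1 - cos)\<close>, and for \<open>V\<^sub>t\<^sub>r\<^sup>2\<close> the kernel \<open>k\<close> is
  the second derivative of \<open>log \<bar>1 - \<sigma> exp(i t)\<bar>\<^sup>2\<close>; for \<open>\<sigma> \<ge> 0\<close>, uniformly in \<open>\<sigma>\<close>, both satisfy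
  \<open>\<bar>k(t)\<bar> (1 - cos t) \<le> 1\<close>, and \<open>\<sigma> < 0\<close> reduces to \<open>- \<sigma>\<close> by reflecting the second function.  As \<open>H\<close> is even
  and periodic, unfolding the kernel leaves
  \<open>\<integral> F(\<theta>) \<integral> (H(\<theta> + t) + H(\<theta> - t) - 2 H(\<theta>)) k(t) dt d\<theta>\<close>.

  By symmetry let \<open>a\<^sub>1 > a\<^sub>2\<close>.  An \<open>H\<^sup>2\<close> function has a Hoelder continuous derivative of exponent \<open>1/2\<close>, so the
  inner integral is \<open>O(N\<^sup>a\<^sup>2)\<close> without a logarithmic loss, while \<open>\<integral> \<bar>F\<bar> = O(N\<^sup>-\<^sup>a\<^sup>1)\<close> in the bulk.  The other terms
  are \<open>O(N\<^sup>-\<^sup>a\<^sup>1)\<close>: their kernels are bounded or, for \<open>\<sigma> \<rightarrow> \<plusminus>1\<close>, Poisson kernels.  For the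
  eigenvector processes the normalisation costs \<open>\<surd>(C\<^sub>1 C\<^sub>2) = O(N\<^bsup>(a1 + a2)/2\<^esup>)\<close>.
\<close>

section \<open>The arcsine substitution\<close>

text \<open>The two functions are treated asymmetrically: the one on the finer scale enters only
  through its \<open>L1\<close> norm in the angle, and all regularity is asked of the coarser one.
  Subtracting \<open>2 H(\<theta>)\<close> is free in both trace terms, for different reasons: the
  kernel of \<open>Vtr2\<close> has mean zero over a half period, while in \<open>Vtr1\<close> the
  product of differences symmetrises to it. The weight \<open>1 - cos t\<close> controls a kernel
  only at \<open>t = 0\<close>. For \<sigma> near -1 the mass sits at \<open>t = \<pi>\<close>,
  where a second difference need not be small; this is what the reflection repairs.

  Three features of the definitions shape the rest. Elements of \<open>H2\<close> are known up to
  null sets only, so estimates run on a \<open>C1\<close> representative, yet values of the given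
  function at the edges still matter. Derivatives and integrals may take default values. The values
  at \<sigma> = 1 and -1 are limits, whose existence has to be shown before they can be bounded.
  Since \<sigma> does not depend on \<open>N\<close>, constants may depend on it, and uniformity is
  needed only on the way to those limits.\<close>

definition angle :: "real measure" where
  "angle = density lborel (\<lambda>t. ennreal (indicator {0..pi} t))"

text \<open>The arcsine law without its factor \<open>1 / pi\<close>.\<close>

definition arc :: "real measure" where
  "arc = density lborel (\<lambda>x. ennreal (indicator {-2..2} x / sqrt (4 - x\<^sup>2)))"

text \<open>The minus sign makes \<open>cs\<close> increasing on \<open>{0..pi}\<close>, so that its
  derivative is nonnegative as the substitution rule requires.\<close>

definition cs :: "real \<Rightarrow> real" where
  "cs t = - 2 * cos t"

lemma sets_angle [simp, measurable_cong]: "sets angle = sets borel"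
  and space_angle [simp]: "space angle = UNIV"
  and sets_arc [simp, measurable_cong]: "sets arc = sets borel"
  and space_arc [simp]: "space arc = UNIV"
  by (simp_all add: angle_def arc_def)

lemma cs_measurable [measurable]: "cs \<in> borel_measurable borel"
  unfolding cs_def by measurable

lemma continuous_cs [continuous_intros]: "continuous_on S cs"
  unfolding cs_def by (intro continuous_intros)

lemma cs_even [simp]: "cs (- t) = cs t"
  and cs_periodic: "cs (t + 2 * pi) = cs t"
  by (simp_all add: cs_def)

lemma sq_le_4: "x\<^sup>2 \<le> 4" if "- 2 \<le> x" "x \<le> 2" for x :: real
  using that abs_le_square_iff[of x 2] by (simp add: abs_le_iff)

lemma sqrt_4_cs: "sqrt (4 - (cs t)\<^sup>2) = 2 * \<bar>sin t\<bar>"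
proof -
  have "4 - (cs t)\<^sup>2 = (2 * sin t)\<^sup>2"
    by (simp add: cs_def power_mult_distrib sin_squared_eq)
  then show ?thesis by (metis abs_mult abs_numeral real_sqrt_abs)
qed

lemma arc_eq_distr: "arc = distr angle borel cs"
proof (rule measure_eqI)
  show "sets arc = sets (distr angle borel cs)" by simp
next
  fix A assume "A \<in> sets arc"
  then have [measurable]: "A \<in> sets borel" by simp
  let ?f = "\<lambda>x. indicator A x / sqrt (4 - x\<^sup>2)"
  have fm: "?f \<in> borel_measurable borel" by measurable
  have *: "(\<integral>\<^sup>+x. ?f x * indicator {cs 0..cs pi} x \<partial>lborel) =
             (\<integral>\<^sup>+t. ?f (cs t) * (2 * sin t) * indicator {0..pi} t \<partial>lborel)"
  proof (rule nn_integral_substitution)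
    show "set_borel_measurable borel {cs 0..cs pi} ?f"
      unfolding set_borel_measurable_def using fm by measurable
    show "(cs has_real_derivative 2 * sin t) (at t)" for t
      unfolding cs_def by (auto intro!: derivative_eq_intros)
    show "continuous_on {0..pi} (\<lambda>t. 2 * sin t)" by (intro continuous_intros)
    show "0 \<le> 2 * sin t" if "t \<in> {0..pi}" for t using that sin_ge_zero by auto
  qed simp
  have "emeasure arc A = (\<integral>\<^sup>+x. ?f x * indicator {cs 0..cs pi} x \<partial>lborel)"
    unfolding arc_def
    by (subst emeasure_density) (auto simp: cs_def intro!: nn_integral_cong split: split_indicator)
  also have "\<dots> = (\<integral>\<^sup>+t. ennreal (indicator {0..pi} t) * indicator A (cs t) \<partial>lborel)"
    unfolding *
  proof (rule nn_integral_cong_AE)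
    \<comment> \<open>At the endpoints \<open>1 / 0 = 0\<close> annihilates the left-hand side, so
      the integrands agree only almost everywhere.\<close>
    have "AE t in lborel. t \<noteq> 0" "AE t in lborel. t \<noteq> pi"
      by (simp_all add: AE_lborel_singleton)
    then show "AE t in lborel. ennreal (?f (cs t) * (2 * sin t) * indicator {0..pi} t) =
        ennreal (indicator {0..pi} t) * indicator A (cs t)"
    proof eventually_elim
      fix t :: real assume t: "t \<noteq> 0" "t \<noteq> pi"
      have "sqrt (4 - (cs t)\<^sup>2) = 2 * \<bar>sin t\<bar>" by (rule sqrt_4_cs)
      moreover have "0 < sin t" if "t \<in> {0..pi}"
        using that t by (intro sin_gt_zero) auto
      ultimately show "ennreal (?f (cs t) * (2 * sin t) * indicator {0..pi} t) =
        ennreal (indicator {0..pi} t) * indicator A (cs t)"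
        by (auto split: split_indicator)
    qed
  qed
  also have "\<dots> = emeasure (distr angle borel cs) A"
    using measurable_sets_borel[OF cs_measurable \<open>A \<in> sets borel\<close>] unfolding angle_def
    by (subst emeasure_distr, simp, simp, subst emeasure_density)
       (auto intro!: nn_integral_cong split: split_indicator)
  finally show "emeasure arc A = emeasure (distr angle borel cs) A" .
qed

lemma finite_measure_angle: "finite_measure angle"
proof
  have "emeasure angle UNIV = (\<integral>\<^sup>+t. (indicator {0..pi} t :: ennreal) \<partial>lborel)"
    unfolding angle_def
    by (subst emeasure_density) (auto intro!: nn_integral_cong split: split_indicator simp del: nn_integral_indicator)
  also have "\<dots> = emeasure lborel {0..pi}" by (rule nn_integral_indicator) simp
  finally show "emeasure angle (space angle) \<noteq> \<infinity>" by simp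
qed

interpretation angle: finite_measure angle by (rule finite_measure_angle)

lemma finite_measure_arc: "finite_measure arc"
  unfolding arc_eq_distr by (rule angle.finite_measure_distr) simp

interpretation arc: finite_measure arc by (rule finite_measure_arc)

interpretation angle2: pair_sigma_finite angle angle ..

lemma finite_measure_angle2: "finite_measure (angle \<Otimes>\<^sub>M angle)"
  by (rule finite_measure_pair_measure) (rule finite_measure_angle)+

interpretation angle2f: finite_measure "angle \<Otimes>\<^sub>M angle" by (rule finite_measure_angle2)

lemma integral_arc:
  fixes \<Phi> :: "real \<Rightarrow> real"
  assumes [measurable]: "\<Phi> \<in> borel_measurable borel"
  shows "(LINT x:{-2..2}|lborel. \<Phi> x / sqrt (4 - x\<^sup>2)) = (LINT t|angle. \<Phi> (cs t))"
proof -
  have "(LINT t|angle. \<Phi> (cs t)) = integral\<^sup>L arc \<Phi>"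
    unfolding arc_eq_distr by (subst integral_distr) auto
  also have "\<dots> = (LINT x:{-2..2}|lborel. \<Phi> x / sqrt (4 - x\<^sup>2))"
    unfolding arc_def set_lebesgue_integral_def
    by (subst integral_density)
       (auto simp: sq_le_4 split: split_indicator intro!: Bochner_Integration.integral_cong)
  finally show ?thesis ..
qed

lemma arc_pair: "arc \<Otimes>\<^sub>M arc = density lborel (\<lambda>(x, y). ennreal
    (indicator ({-2..2} \<times> {-2..2}) (x, y) / (sqrt (4 - x\<^sup>2) * sqrt (4 - y\<^sup>2))))"
proof -
  have sf: "sigma_finite_measure arc" ..
  have *: "0 \<le> sqrt (4 - x\<^sup>2)" if "x \<in> {-2..2}" for x :: real
    using that by (auto simp: sq_le_4)
  have "arc \<Otimes>\<^sub>M arc = density (lborel \<Otimes>\<^sub>M lborel) (\<lambda>(x, y).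
      ennreal (indicator {-2..2} x / sqrt (4 - x\<^sup>2)) * ennreal (indicator {-2..2} y / sqrt (4 - y\<^sup>2)))"
    using sf unfolding arc_def
    by (subst pair_measure_density) (auto intro: lborel.sigma_finite_measure_axioms)
  also have "\<dots> = density lborel (\<lambda>(x, y). ennreal
    (indicator ({-2..2} \<times> {-2..2}) (x, y) / (sqrt (4 - x\<^sup>2) * sqrt (4 - y\<^sup>2))))"
    unfolding lborel_prod
    using * by (intro arg_cong[where f="density lborel"] ext) (auto simp: ennreal_mult'[symmetric] split: split_indicator)
  finally show ?thesis .
qed

lemma arc_pair_distr: "arc \<Otimes>\<^sub>M arc = distr (angle \<Otimes>\<^sub>M angle) borel (\<lambda>(s, t). (cs s, cs t))"
proof -
  have "sigma_finite_measure (distr angle borel cs)"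
    unfolding arc_eq_distr[symmetric] ..
  then have "arc \<Otimes>\<^sub>M arc = distr (angle \<Otimes>\<^sub>M angle) (borel \<Otimes>\<^sub>M borel) (\<lambda>(s, t). (cs s, cs t))"
    unfolding arc_eq_distr by (subst pair_measure_distr) auto
  then show ?thesis by (simp add: borel_prod)
qed

text \<open>No integrability is assumed: passing to a density or to an image measure is
  unconditional for the Bochner integral. This matters for \<open>Vtr1\<close>, whose integrand is
  never shown to be integrable.\<close>

lemma integral_arc2:
  fixes \<Phi> :: "real \<Rightarrow> real \<Rightarrow> real"
  assumes \<Phi> [measurable]: "case_prod \<Phi> \<in> borel_measurable borel"
  shows "(LINT (x, y):{-2..2} \<times> {-2..2}|lborel. \<Phi> x y / (sqrt (4 - x\<^sup>2) * sqrt (4 - y\<^sup>2))) =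
    (LINT (s, t)|(angle \<Otimes>\<^sub>M angle). \<Phi> (cs s) (cs t))"
proof -
  have [measurable]: "case_prod \<Phi> \<in> borel_measurable (borel \<Otimes>\<^sub>M borel)"
    using \<Phi> by (simp add: borel_prod)
  have "(LINT (s, t)|(angle \<Otimes>\<^sub>M angle). \<Phi> (cs s) (cs t)) = integral\<^sup>L (arc \<Otimes>\<^sub>M arc) (case_prod \<Phi>)"
    unfolding arc_pair_distr by (subst integral_distr) (auto simp: borel_prod[symmetric] split_beta intro!: Bochner_Integration.integral_cong)
  also have "\<dots> = (LINT (x, y):{-2..2} \<times> {-2..2}|lborel. \<Phi> x y / (sqrt (4 - x\<^sup>2) * sqrt (4 - y\<^sup>2)))"
  proof -
    have *: "0 \<le> sqrt (4 - x\<^sup>2)" if "x \<in> {-2..2}" for x :: real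
      using that by (auto simp: sq_le_4)
    let ?g = "\<lambda>z. indicator ({-2..2} \<times> {-2..2}) z / (sqrt (4 - (fst z)\<^sup>2) * sqrt (4 - (snd z)\<^sup>2)) :: real"
    have "integral\<^sup>L (arc \<Otimes>\<^sub>M arc) (case_prod \<Phi>) = integral\<^sup>L (density lborel ?g) (case_prod \<Phi>)"
      unfolding arc_pair by (simp add: case_prod_beta')
    also have "\<dots> = (LINT z|lborel. ?g z *\<^sub>R case_prod \<Phi> z)"
    proof (rule integral_density)
      show "case_prod \<Phi> \<in> borel_measurable lborel" using \<Phi> by simp
      show "?g \<in> borel_measurable lborel"
        by (simp add: borel_prod[symmetric])
      show "AE z in lborel. 0 \<le> ?g z"
        using * by (auto split: split_indicator intro!: AE_I2)
    qed
    finally show ?thesis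
      unfolding set_lebesgue_integral_def
      by (auto intro!: Bochner_Integration.integral_cong split: split_indicator)
  qed
  finally show ?thesis ..
qed

section \<open>Periodic functions on a half period\<close>

lemma integral_full_period:
  fixes f :: "real \<Rightarrow> real"
  assumes cont: "continuous_on UNIV f" and per: "\<And>t. f (t + 2 * pi) = f t"
  shows "integral {a - pi..a + pi} f = integral {- pi..pi} f"
proof -
  have int: "f integrable_on {c..d}" for c d
    using cont by (intro integrable_continuous_real) (auto intro: continuous_on_subset)
  have shift: "integral {c + 2 * pi..d + 2 * pi} f = integral {c..d} f" for c d
  proof -
    have "integral {c..d} f = integral {c..d} (\<lambda>t. f (t + 2 * pi))" by (simp add: per)
    also have "\<dots> = integral {c + 2 * pi..d + 2 * pi} f"
      using integral_shift_real_ivl[of "c + 2 * pi" "2 * pi" "d + 2 * pi" f] by simp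
    finally show ?thesis ..
  qed
  \<comment> \<open>Two windows at most a period apart share a middle piece, and the remaining
    pieces are translates of each other by a period. Larger distances are first reduced by whole
    periods.\<close>
  have aux: "integral {b..b + 2 * pi} f = integral {c..c + 2 * pi} f" if "b \<le> c" "c \<le> b + 2 * pi" for b c
  proof -
    have "integral {b..c} f + integral {c..b + 2 * pi} f = integral {b..b + 2 * pi} f"
      using that int by (intro Henstock_Kurzweil_Integration.integral_combine) auto
    moreover have "integral {c..b + 2 * pi} f + integral {b + 2 * pi..c + 2 * pi} f = integral {c..c + 2 * pi} f"
      using that int by (intro Henstock_Kurzweil_Integration.integral_combine) auto
    ultimately show ?thesis using shift[of b c] by simp
  qed
  have step: "integral {b..b + 2 * pi} f = integral {b + 2 * pi..b + 2 * pi + 2 * pi} f" for b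
    using aux[of b "b + 2 * pi"] by simp
  have nat: "integral {b..b + 2 * pi} f = integral {b + real n * (2 * pi)..b + real n * (2 * pi) + 2 * pi} f" for b n
  proof (induction n)
    case (Suc n)
    then show ?case using step[of "b + real n * (2 * pi)"] by (simp add: algebra_simps)
  qed simp
  have all: "integral {b..b + 2 * pi} f = integral {c..c + 2 * pi} f" if "b \<le> c" for b c
  proof -
    define n where "n = nat \<lfloor>(c - b) / (2 * pi)\<rfloor>"
    have "real n = of_int \<lfloor>(c - b) / (2 * pi)\<rfloor>"
      using that unfolding n_def by simp
    then have "real n \<le> (c - b) / (2 * pi)" "(c - b) / (2 * pi) \<le> real n + 1" by linarith+
    then have "real n * (2 * pi) \<le> c - b" "c - b \<le> (real n + 1) * (2 * pi)"
      by (simp_all add: field_simps)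
    then show ?thesis using nat[of b n] aux[of "b + real n * (2 * pi)" c] by (simp add: algebra_simps)
  qed
  show ?thesis
    using all[of "a - pi" "- pi"] all[of "- pi" "a - pi"] by (cases "a \<le> 0") (auto simp: algebra_simps)
qed

lemma integral_reflect_sym:
  fixes f :: "real \<Rightarrow> real"
  assumes "continuous_on UNIV f"
  shows "integral {- pi..pi} f = integral {0..pi} (\<lambda>t. f t + f (- t))"
proof -
  have int: "f integrable_on {c..d}" for c d
    using assms by (intro integrable_continuous_real) (auto intro: continuous_on_subset)
  have int': "(\<lambda>t. f (- t)) integrable_on {c..d}" for c d
    by (intro integrable_continuous_real continuous_on_compose2[OF assms] continuous_intros) auto
  have "integral {- pi..pi} f = integral {- pi..0} f + integral {0..pi} f"
    using int by (intro Henstock_Kurzweil_Integration.integral_combine[symmetric]) auto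
  also have "integral {- pi..0} f = integral {0..pi} (\<lambda>t. f (- t))"
  proof -
    have "integral {- pi..- 0} (\<lambda>t. f (- (- t))) = integral {0..pi} (\<lambda>t. f (- t))"
      by (rule Henstock_Kurzweil_Integration.integral_reflect_real)
    then show ?thesis by (simp only: minus_zero minus_minus)
  qed
  finally show ?thesis
    using int int' by (simp add: Henstock_Kurzweil_Integration.integral_add)
qed

text \<open>The parity of \<open>H\<close> merges the two kernel terms into one convolution over a
  full period, which is then recentred at \<open>t\<close> and folded back. The factor
  \<open>e\<close> is \<open>1\<close> for the trace kernels and \<open>- 1\<close> for the
  eigenvector kernel, where the even function is multiplied by \<open>sin\<close>.\<close>

lemma integral_half_period_convolution:
  fixes H k :: "real \<Rightarrow> real"
  assumes H: "continuous_on UNIV H" "\<And>t. H (t + 2 * pi) = H t" "\<And>t. H (- t) = e * H t"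
    and k: "continuous_on UNIV k" "\<And>t. k (t + 2 * pi) = k t" "\<And>t. k (- t) = k t"
  shows "integral {0..pi} (\<lambda>u. H u * (k (t - u) + e * k (t + u))) =
    integral {0..pi} (\<lambda>u. (H (t + u) + H (t - u)) * k u)"
proof -
  have cH: "continuous_on S (\<lambda>u. H (g u))" if "continuous_on S g" for S and g :: "real \<Rightarrow> real"
    using that by (intro continuous_on_compose2[OF H(1)]) auto
  have ck: "continuous_on S (\<lambda>u. k (g u))" if "continuous_on S g" for S and g :: "real \<Rightarrow> real"
    using that by (intro continuous_on_compose2[OF k(1)]) auto
  have per: "H (u - 2 * pi) = H u" "k (u - 2 * pi) = k u" for u
    using H(2)[of "u - 2 * pi"] k(2)[of "u - 2 * pi"] by simp_all
  have "integral {0..pi} (\<lambda>u. H u * (k (t - u) + e * k (t + u))) =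
      integral {0..pi} (\<lambda>u. H u * k (t - u) + H (- u) * k (t - (- u)))"
    by (simp add: H(3) algebra_simps)
  also have "\<dots> = integral {- pi..pi} (\<lambda>u. H u * k (t - u))"
    by (rule integral_reflect_sym[symmetric]) (intro continuous_intros cH ck)
  also have "\<dots> = integral {t - pi..t + pi} (\<lambda>u. H u * k (t - u))"
  proof (rule integral_full_period[symmetric])
    show "H (u + 2 * pi) * k (t - (u + 2 * pi)) = H u * k (t - u)" for u
      using per(2)[of "t - u"] H(2)[of u] by (simp add: algebra_simps)
  qed (intro continuous_intros cH ck)
  also have "\<dots> = integral {- pi..pi} (\<lambda>u. H (u + t) * k (t - (u + t)))"
    using integral_shift_real_ivl[of "t - pi" t "t + pi" "\<lambda>u. H u * k (t - u)"] by simp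
  also have "\<dots> = integral {0..pi} (\<lambda>u. H (u + t) * k (- u) + H (- u + t) * k u)"
    by (subst integral_reflect_sym) (auto intro!: continuous_intros cH ck)
  also have "\<dots> = integral {0..pi} (\<lambda>u. (H (t + u) + H (t - u)) * k u)"
    by (simp add: k(3) algebra_simps)
  finally show ?thesis .
qed

section \<open>Continuously differentiable representatives\<close>

text \<open>Half lines determine a finite Borel measure, so the positive and the negative part of
  \<open>v\<close> are densities of the same measure; densities are unique almost
  everywhere.\<close>

lemma AE_zero_if_tail_integrals_zero:
  fixes v :: "real \<Rightarrow> real"
  assumes v: "integrable lborel v"
    and tails: "\<And>x. (LINT t|lborel. indicator {x<..} t * v t) = 0"
  shows "AE t in lborel. v t = 0"
proof -
  have [measurable]: "v \<in> borel_measurable borel"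
    using v by (auto dest: borel_measurable_integrable)
  define p q where "p t = max (v t) 0" and "q t = max (- v t) 0" for t
  have [measurable]: "p \<in> borel_measurable borel" "q \<in> borel_measurable borel"
    unfolding p_def q_def by measurable
  have pq: "integrable lborel p" "integrable lborel q"
    using v unfolding p_def q_def by (auto intro!: integrable_max)
  have ipq: "integrable lborel (\<lambda>t. indicator {x<..} t * p t)" "integrable lborel (\<lambda>t. indicator {x<..} t * q t)" for x
    using pq by (auto intro!: integrable_mult_indicator[where 'b=real, simplified])
  have pos: "emeasure (density lborel f) {x<..} = ennreal (LINT t|lborel. indicator {x<..} t * f t)"
    if "integrable lborel (\<lambda>t. indicator {x<..} t * f t)" "\<And>t. 0 \<le> f t" "f \<in> borel_measurable borel"
    for f :: "real \<Rightarrow> real" and x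
  proof -
    have "emeasure (density lborel f) {x<..} = (\<integral>\<^sup>+t. ennreal (indicator {x<..} t * f t) \<partial>lborel)"
      using that by (subst emeasure_density) (auto intro!: nn_integral_cong split: split_indicator)
    also have "\<dots> = ennreal (LINT t|lborel. indicator {x<..} t * f t)"
      using that by (intro nn_integral_eq_integral) auto
    finally show ?thesis .
  qed
  have "density lborel p = density lborel q"
  proof (rule measure_eqI_lessThan)
    fix x
    have "(LINT t|lborel. indicator {x<..} t * p t) - (LINT t|lborel. indicator {x<..} t * q t)
        = (LINT t|lborel. indicator {x<..} t * v t)"
      unfolding Bochner_Integration.integral_diff[OF ipq, symmetric]
      by (intro Bochner_Integration.integral_cong) (auto simp: p_def q_def split: split_indicator)
    then show "emeasure (density lborel p) {x<..} = emeasure (density lborel q) {x<..}"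
      using ipq[of x] by (subst (1 2) pos) (auto simp: tails p_def q_def)
    show "emeasure (density lborel p) {x<..} < \<infinity>"
      using ipq[of x] by (subst pos) (auto simp: p_def)
  qed auto
  then have "AE t in lborel. ennreal (p t) = ennreal (q t)"
    by (subst (asm) sigma_finite_measure.density_unique_iff[OF sigma_finite_lborel]) auto
  then show ?thesis
  proof eventually_elim
    fix t assume "ennreal (p t) = ennreal (q t)"
    then have "p t = q t" by (subst (asm) ennreal_inj) (auto simp: p_def q_def)
    then show "v t = 0" by (simp add: p_def q_def max_def split: if_splits)
  qed
qed

lemma integrable_test_function:
  fixes \<psi> :: "real \<Rightarrow> real"
  assumes "continuous_on UNIV \<psi>" "\<And>x. m \<le> \<bar>x\<bar> \<Longrightarrow> \<psi> x = 0"
  shows "integrable lborel \<psi>"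
proof -
  have *: "\<psi> x = indicator {-m..m} x * \<psi> x" for x
    using assms(2)[of x] by (auto split: split_indicator)
  have "set_integrable lborel {-m..m} \<psi>"
    using assms(1) unfolding set_integrable_def
    by (intro borel_integrable_compact) (auto intro: continuous_on_subset)
  then show ?thesis
    unfolding set_integrable_def real_scaleR_def by (simp only: *[symmetric])
qed

lemma integrable_mult_test_function:
  fixes \<psi> v :: "real \<Rightarrow> real"
  assumes m: "0 < m" and \<psi>: "continuous_on UNIV \<psi>" "\<And>x. m \<le> \<bar>x\<bar> \<Longrightarrow> \<psi> x = 0"
    and v: "integrable lborel (\<lambda>x. indicator {-m..m} x * v x)"
  shows "integrable lborel (\<lambda>x. v x * \<psi> x)"
proof -
  define V where "V = (\<lambda>x. indicator {-m..m} x * v x)"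
  have V: "integrable lborel V" using v by (simp add: V_def)
  have [measurable]: "V \<in> borel_measurable borel" "\<psi> \<in> borel_measurable borel"
    using V \<psi>(1) by (auto dest: borel_measurable_integrable intro: borel_measurable_continuous_onI)
  have "compact (\<psi> ` {-m..m})"
    using \<psi>(1) by (intro compact_continuous_image) (auto intro: continuous_on_subset)
  then obtain b where b: "\<And>x. x \<in> {-m..m} \<Longrightarrow> \<bar>\<psi> x\<bar> \<le> b"
    by (meson bounded_real compact_imp_bounded imageI)
  have b0: "0 \<le> b" using b[of 0] m by auto
  have "integrable lborel (\<lambda>x. V x * \<psi> x)"
  proof (rule Bochner_Integration.integrable_bound[of lborel "\<lambda>x. b * V x"])
    show "AE x in lborel. norm (V x * \<psi> x) \<le> norm (b * V x)"
    proof (rule AE_I2)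
      fix x
      show "norm (V x * \<psi> x) \<le> norm (b * V x)"
      proof (cases "x \<in> {-m..m}")
        case True
        then show ?thesis
          using mult_right_mono[OF b[of x], of "\<bar>V x\<bar>"] b0 by (simp add: abs_mult mult.commute)
      qed (simp add: V_def)
    qed
  qed (use V in auto)
  also have "(\<lambda>x. V x * \<psi> x) = (\<lambda>x. v x * \<psi> x)"
    using \<psi>(2) by (auto simp: V_def fun_eq_iff split: split_indicator)
  finally show ?thesis .
qed

text \<open>Test functions of mean zero form a hyperplane, so integration against \<open>v\<close>
  is a multiple \<open>c\<close> of the plain integral on all test functions. Approximating
  indicators of intervals then identifies \<open>v\<close> with \<open>c\<close>.\<close>

lemma du_bois_reymond:
  fixes v :: "real \<Rightarrow> real"
  assumes m: "0 < m" and v: "integrable lborel (\<lambda>x. indicator {-m..m} x * v x)"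
    and test: "\<And>\<psi>. continuous_on UNIV \<psi> \<Longrightarrow> (\<And>x. m \<le> \<bar>x\<bar> \<Longrightarrow> \<psi> x = 0) \<Longrightarrow>
      (LINT x|lborel. \<psi> x) = 0 \<Longrightarrow> (LINT x|lborel. v x * \<psi> x) = 0"
  shows "\<exists>c. AE x in lborel. \<bar>x\<bar> < m \<longrightarrow> v x = c"
proof -
  define V where "V = (\<lambda>x. indicator {-m..m} x * v x)"
  have V: "integrable lborel V" using v by (simp add: V_def)
  then have [measurable]: "V \<in> borel_measurable borel"
    by (auto dest: borel_measurable_integrable)
  note icont = integrable_test_function integrable_mult_test_function[OF m _ _ v]
  \<comment> \<open>A tent of positive integral; subtracting a multiple of it gives any test
    function mean zero.\<close>
  define \<rho> where "\<rho> x = max 0 (m - \<bar>x\<bar>)" for x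
  have \<rho>: "continuous_on UNIV \<rho>" "\<And>x. m \<le> \<bar>x\<bar> \<Longrightarrow> \<rho> x = 0"
    unfolding \<rho>_def by (auto intro!: continuous_intros)
  define I0 where "I0 = (LINT x|lborel. \<rho> x)"
  have "(LINT x|lborel. m/2 * indicator {-m/2..m/2} x) \<le> I0"
    unfolding I0_def
  proof (rule integral_mono)
    show "integrable lborel (\<lambda>x. m / 2 * indicator {-m/2..m/2} x)"
      by (intro integrable_mult_right integrable_real_indicator) (auto simp: emeasure_lborel_Icc_eq)
    show "m / 2 * indicator {-m/2..m/2} x \<le> \<rho> x" for x
      by (auto simp: \<rho>_def abs_if split: split_indicator)
  qed (rule icont[OF \<rho>])
  moreover have "(LINT x|lborel. m/2 * indicator {-m/2..m/2} x) = m / 2 * m" using m by simp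
  ultimately have I0: "0 < I0" using mult_pos_pos[of "m / 2" m] m by linarith
  define c where "c = (LINT x|lborel. v x * \<rho> x) / I0"
  have eq: "(LINT x|lborel. v x * \<psi> x) = c * (LINT x|lborel. \<psi> x)"
    if \<psi>: "continuous_on UNIV \<psi>" "\<And>x. m \<le> \<bar>x\<bar> \<Longrightarrow> \<psi> x = 0" for \<psi>
  proof -
    define j where "j = (LINT x|lborel. \<psi> x) / I0"
    have "(LINT x|lborel. v x * (\<psi> x - j * \<rho> x)) = 0"
    proof (rule test)
      show "continuous_on UNIV (\<lambda>x. \<psi> x - j * \<rho> x)" using \<psi> \<rho> by (intro continuous_intros)
      show "\<psi> x - j * \<rho> x = 0" if "m \<le> \<bar>x\<bar>" for x using that \<psi> \<rho> by simp
      have "(LINT x|lborel. \<psi> x - j * \<rho> x) = (LINT x|lborel. \<psi> x) - j * I0"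
        unfolding I0_def using icont[OF \<psi>] icont[OF \<rho>] by simp
      then show "(LINT x|lborel. \<psi> x - j * \<rho> x) = 0" using I0 by (simp add: j_def)
    qed
    moreover have "(LINT x|lborel. v x * (\<psi> x - j * \<rho> x)) =
        (LINT x|lborel. v x * \<psi> x) - j * (LINT x|lborel. v x * \<rho> x)"
      using icont[OF \<psi>] icont[OF \<rho>] by (simp add: right_diff_distrib mult.left_commute)
    ultimately show ?thesis by (simp add: j_def c_def)
  qed
  have lim: "(LINT t|lborel. V t * indicator {a<..<m} t) = c * (LINT t|lborel. indicator {a<..<m} t)"
    if "- m \<le> a" for a
  proof -
    \<comment> \<open>Continuous approximations of the indicator of \<open>{a<..<m}\<close>. They
      vanish for \<open>m \<le> \<bar>x\<bar>\<close> because \<open>- m \<le> a\<close>.\<close>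
    define \<psi> where "\<psi> k t = min 1 (real k * max 0 (min (t - a) (m - t)))" for k t
    have \<psi>: "continuous_on UNIV (\<psi> k)" "\<And>x. m \<le> \<bar>x\<bar> \<Longrightarrow> \<psi> k x = 0" for k
      unfolding \<psi>_def using that by (auto intro!: continuous_intros)
    have [measurable]: "\<psi> k \<in> borel_measurable borel" for k
      using \<psi>(1) by (rule borel_measurable_continuous_onI)
    have \<psi>_lim: "(\<lambda>k. \<psi> k t) \<longlonglongrightarrow> indicator {a<..<m} t" for t
    proof (cases "t \<in> {a<..<m}")
      case True
      then have d: "0 < min (t - a) (m - t)" by auto
      have "eventually (\<lambda>k. 1 / min (t - a) (m - t) \<le> real k) sequentially"
        using filterlim_real_sequentially by (simp add: filterlim_at_top)
      then have "eventually (\<lambda>k. \<psi> k t = 1) sequentially"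
      proof eventually_elim
        case (elim k)
        then have "1 \<le> real k * min (t - a) (m - t)" using d by (simp add: pos_divide_le_eq)
        then show ?case using d unfolding \<psi>_def by (auto simp: max_def)
      qed
      then show ?thesis using True by (simp add: tendsto_eventually)
    next
      case False
      then have "\<psi> k t = 0" for k unfolding \<psi>_def by auto
      then show ?thesis using False by simp
    qed
    have \<psi>_bd: "\<bar>\<psi> k t\<bar> \<le> indicator {-m..m} t" for k t
      using \<psi>(2)[of t k] unfolding \<psi>_def by (auto split: split_indicator)
    have "(\<lambda>k. LINT t|lborel. V t * \<psi> k t) \<longlonglongrightarrow> (LINT t|lborel. V t * indicator {a<..<m} t)"
    proof (rule integral_dominated_convergence[where w="\<lambda>t. \<bar>V t\<bar>"])
      show "AE t in lborel. norm (V t * \<psi> k t) \<le> \<bar>V t\<bar>" for k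
      proof (rule AE_I2)
        fix t
        have "\<bar>\<psi> k t\<bar> \<le> 1" using \<psi>_bd[of k t] by (auto split: split_indicator_asm)
        then show "norm (V t * \<psi> k t) \<le> \<bar>V t\<bar>" by (simp add: abs_mult mult_left_le)
      qed
      show "AE t in lborel. (\<lambda>k. V t * \<psi> k t) \<longlonglongrightarrow> V t * indicator {a<..<m} t"
        using \<psi>_lim by (intro AE_I2 tendsto_mult) auto
    qed (use V in auto)
    moreover have "(\<lambda>k. LINT t|lborel. \<psi> k t) \<longlonglongrightarrow> (LINT t|lborel. indicator {a<..<m} t)"
    proof (rule integral_dominated_convergence[where w="indicator {-m..m}"])
      show "AE t in lborel. norm (\<psi> k t) \<le> indicator {-m..m} t" for k
        using \<psi>_bd by auto
      show "AE t in lborel. (\<lambda>k. \<psi> k t) \<longlonglongrightarrow> indicator {a<..<m} t"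
        using \<psi>_lim by auto
    qed (auto intro!: integrable_real_indicator simp: emeasure_lborel_Icc_eq)
    moreover have "(LINT t|lborel. V t * \<psi> k t) = c * (LINT t|lborel. \<psi> k t)" for k
    proof -
      have "(\<lambda>t. V t * \<psi> k t) = (\<lambda>t. v t * \<psi> k t)"
        using \<psi>(2)[of _ k] by (intro ext) (auto simp: V_def split: split_indicator)
      then show ?thesis using eq[OF \<psi>, of k] by (simp only:)
    qed
    ultimately have "(\<lambda>k. c * (LINT t|lborel. \<psi> k t)) \<longlonglongrightarrow> (LINT t|lborel. V t * indicator {a<..<m} t)"
      "(\<lambda>k. c * (LINT t|lborel. \<psi> k t)) \<longlonglongrightarrow> c * (LINT t|lborel. indicator {a<..<m} t)"
      by (auto intro!: tendsto_intros)
    then show ?thesis by (rule LIMSEQ_unique)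
  qed
  have "AE t in lborel. indicator {-m<..<m} t * (V t - c) = 0"
  proof (rule AE_zero_if_tail_integrals_zero)
    have iV: "integrable lborel (\<lambda>t. V t * indicator A t)" if "A \<in> sets borel" for A
      using integrable_mult_indicator[of A lborel V] V that by (simp add: mult.commute)
    have ind: "integrable lborel (\<lambda>t. indicator {b<..<m} t :: real)" for b
      by (cases "b \<le> m") (auto intro!: integrable_real_indicator)
    show "integrable lborel (\<lambda>t. indicator {-m<..<m} t * (V t - c))"
    proof -
      have "integrable lborel (\<lambda>t. V t * indicator {-m<..<m} t - c * indicator {-m<..<m} t)"
        using iV[of "{-m<..<m}"] ind[of "-m"] by (intro Bochner_Integration.integrable_diff) auto
      then show ?thesis by (simp add: algebra_simps)
    qed
    fix x
    have "(LINT t|lborel. indicator {x<..} t * (indicator {-m<..<m} t * (V t - c))) =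
        (LINT t|lborel. V t * indicator {max x (-m)<..<m} t - c * indicator {max x (-m)<..<m} t)"
      by (intro Bochner_Integration.integral_cong) (auto split: split_indicator)
    also have "\<dots> = (LINT t|lborel. V t * indicator {max x (-m)<..<m} t) - c * (LINT t|lborel. indicator {max x (-m)<..<m} t)"
      using iV[of "{max x (-m)<..<m}"] ind[of "max x (-m)"] by (subst Bochner_Integration.integral_diff) auto
    finally show "(LINT t|lborel. indicator {x<..} t * (indicator {-m<..<m} t * (V t - c))) = 0"
      using lim[of "max x (-m)"] by simp
  qed
  then have "AE x in lborel. \<bar>x\<bar> < m \<longrightarrow> v x = c"
    by eventually_elim (auto simp: V_def split: split_indicator_asm)
  then show ?thesis ..
qed

lemma set_integrable_if_L2_fun:
  assumes "L2_fun f"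
  shows "integrable lborel (\<lambda>x. indicator {a..b} x * f x)"
proof -
  have [measurable]: "f \<in> borel_measurable borel" and sq: "integrable lborel (\<lambda>x. (f x)\<^sup>2)"
    using assms by (auto simp: L2_fun_def)
  have ind: "integrable lborel (\<lambda>x. indicator {a..b} x :: real)"
    by (intro integrable_real_indicator) (auto simp: emeasure_lborel_Icc_eq)
  show ?thesis
  proof (rule Bochner_Integration.integrable_bound[OF Bochner_Integration.integrable_add[OF ind sq]])
    have "\<bar>f x\<bar> \<le> 1 + (f x)\<^sup>2" for x
      using sum_squares_bound[of "\<bar>f x\<bar>" 1] by simp
    then show "AE x in lborel. norm (indicator {a..b} x * f x) \<le> norm (indicator {a..b} x + (f x)\<^sup>2)"
      by (auto intro!: AE_I2 split: split_indicator)
  qed auto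
qed

text \<open>A continuous test function \<open>\<psi>\<close> of mean zero is the derivative of a
  compactly supported \<open>C1\<close> function, so the definition of the weak derivative applies
  to it. It shows that \<open>u\<close> and the indefinite integral of \<open>u'\<close> agree
  against every such \<open>\<psi>\<close>, and \<open>du_bois_reymond\<close> makes their
  difference constant.\<close>

lemma weak_derivative_primitive:
  assumes m: "0 < m" and u: "L2_fun u" and u': "L2_fun u'" and weak: "has_weak_derivative u u'"
  shows "\<exists>c. AE x in lborel. \<bar>x\<bar> < m \<longrightarrow>
    u x = c + (LINT t|lborel. indicator {..x} t * (indicator {-m..m} t * u' t))"
proof -
  have [measurable]: "u \<in> borel_measurable borel" "u' \<in> borel_measurable borel"
    using u u' by (auto simp: L2_fun_def)
  define w where "w = (\<lambda>t. indicator {-m..m} t * u' t)"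
  have w: "integrable lborel w" unfolding w_def by (rule set_integrable_if_L2_fun[OF u'])
  have [measurable]: "w \<in> borel_measurable borel" unfolding w_def by measurable
  define F where "F = (\<lambda>x. LINT t|lborel. indicator {..x} t * w t)"
  have Fm [measurable]: "F \<in> borel_measurable borel"
  proof -
    have "(\<lambda>x. LINT t|lborel. (if t \<le> x then 1 else 0) * w t) \<in> borel_measurable borel"
      by measurable
    also have "(\<lambda>x. LINT t|lborel. (if t \<le> x then 1 else 0) * w t) = F"
      unfolding F_def by (auto intro!: ext Bochner_Integration.integral_cong split: split_indicator)
    finally show ?thesis .
  qed
  have F_bd: "\<bar>F x\<bar> \<le> (LINT t|lborel. \<bar>w t\<bar>)" for x
  proof -
    have "\<bar>F x\<bar> \<le> (LINT t|lborel. \<bar>indicator {..x} t * w t\<bar>)"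
      unfolding F_def by (rule integral_abs_bound)
    also have "\<dots> \<le> (LINT t|lborel. \<bar>w t\<bar>)"
    proof (rule integral_mono)
      show "integrable lborel (\<lambda>t. \<bar>indicator {..x} t * w t\<bar>)"
        using integrable_mult_indicator[of "{..x}" lborel w] w by auto
    qed (use w in \<open>auto split: split_indicator\<close>)
    finally show ?thesis .
  qed
  have iu: "integrable lborel (\<lambda>x. indicator {-m..m} x * u x)"
    by (rule set_integrable_if_L2_fun[OF u])
  have iF: "integrable lborel (\<lambda>x. indicator {-m..m} x * F x)"
  proof (rule Bochner_Integration.integrable_bound)
    show "integrable lborel (\<lambda>x. (LINT t|lborel. \<bar>w t\<bar>) * indicator {-m..m} x)"
      by (intro integrable_mult_right integrable_real_indicator) (auto simp: emeasure_lborel_Icc_eq)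
    show "AE x in lborel. norm (indicator {-m..m} x * F x) \<le> norm ((LINT t|lborel. \<bar>w t\<bar>) * indicator {-m..m} x)"
      using F_bd by (auto split: split_indicator intro!: AE_I2) 
  qed auto
  have "\<exists>c. AE x in lborel. \<bar>x\<bar> < m \<longrightarrow> u x - F x = c"
  proof (rule du_bois_reymond[OF m])
    show "integrable lborel (\<lambda>x. indicator {-m..m} x * (u x - F x))"
      using iu iF by (simp add: right_diff_distrib)
  next
    fix \<psi> :: "real \<Rightarrow> real"
    assume \<psi>: "continuous_on UNIV \<psi>" "\<And>x. m \<le> \<bar>x\<bar> \<Longrightarrow> \<psi> x = 0" "(LINT x|lborel. \<psi> x) = 0"
    have [measurable]: "\<psi> \<in> borel_measurable borel"
      using \<psi>(1) by (rule borel_measurable_continuous_onI)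
    have isC: "isCont \<psi> x" for x
      using \<psi>(1) by (simp add: continuous_on_eq_continuous_at)
    have i\<psi>: "integrable lborel \<psi>" by (rule integrable_test_function[OF \<psi>(1,2)])
    have times: "integrable lborel (\<lambda>x. v x * \<psi> x)" if "integrable lborel (\<lambda>x. indicator {-m..m} x * v x)" for v
      by (rule integrable_mult_test_function[OF m \<psi>(1) _ that]) (rule \<psi>(2))
    have "\<exists>\<Phi>. \<forall>x. - \<infinity> < ereal x \<longrightarrow> ereal x < \<infinity> \<longrightarrow> (\<Phi> has_vector_derivative \<psi> x) (at x)"
      by (rule einterval_antiderivative) (auto intro: isC)
    then obtain \<Phi> where \<Phi>: "\<And>x. (\<Phi> has_real_derivative \<psi> x) (at x)"
      by (auto simp: has_real_derivative_iff_has_vector_derivative)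
    define \<phi> where "\<phi> x = \<Phi> x - \<Phi> m" for x
    have d\<phi>: "(\<phi> has_real_derivative \<psi> x) (at x)" for x
      unfolding \<phi>_def using \<Phi>[of x] by (auto intro!: derivative_eq_intros)
    have ftc: "(LINT x|lborel. \<psi> x * indicator {s..t} x) = \<phi> t - \<phi> s" if "s \<le> t" for s t
      using that d\<phi> isC by (intro integral_FTC_Icc_real) auto
    have \<phi>m: "\<phi> m = 0" by (simp add: \<phi>_def)
    \<comment> \<open>To the right of \<open>m\<close> the primitive vanishes by its normalisation,
      to the left of \<open>- m\<close> because \<open>\<psi>\<close> has mean zero.\<close>
    have \<phi>0: "\<phi> x = 0" if "m \<le> \<bar>x\<bar>" for x
    proof -
      have right: "\<phi> y = 0" if "m \<le> y" for y
      proof -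
        have "(LINT x|lborel. \<psi> x * indicator {m..y} x) = (LINT x|(lborel::real measure). 0)"
          using \<psi>(2) by (intro Bochner_Integration.integral_cong) (auto split: split_indicator)
        then show ?thesis using ftc[OF that] \<phi>m by simp
      qed
      have left: "\<phi> y = 0" if "y \<le> - m" for y
      proof -
        have "(LINT x|lborel. \<psi> x * indicator {y..m} x) = (LINT x|lborel. \<psi> x)"
        proof (rule Bochner_Integration.integral_cong)
          fix x show "\<psi> x * indicator {y..m} x = \<psi> x"
            using \<psi>(2)[of x] that by (auto split: split_indicator)
        qed simp
        then show ?thesis using ftc[of y m] \<phi>m \<psi>(3) that m by simp
      qed
      show ?thesis using that left[of x] right[of x] m by (cases "0 \<le> x") auto
    qed
    have deriv: "deriv \<phi> x = \<psi> x" for x using d\<phi> by (rule DERIV_imp_deriv)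
    have "\<phi> C1_differentiable_on UNIV"
      unfolding C1_differentiable_on_def
      using d\<phi> \<psi>(1) by (auto simp: has_real_derivative_iff_has_vector_derivative intro!: exI[of _ \<psi>])
    moreover have "compactly_supported \<phi>"
      unfolding compactly_supported_def compact_closure
    proof (rule bounded_subset)
      show "bounded {-m..m}" by simp
      show "{x. \<phi> x \<noteq> 0} \<subseteq> {-m..m}" using \<phi>0 by (force simp: abs_le_iff)
    qed
    ultimately have "(LINT x|lborel. u x * deriv \<phi> x) = - (LINT x|lborel. u' x * \<phi> x)"
      using weak unfolding has_weak_derivative_def by blast
    then have w1: "(LINT x|lborel. u x * \<psi> x) = - (LINT x|lborel. u' x * \<phi> x)"
      by (simp add: deriv)
    \<comment> \<open>Fubini takes the place of integration by parts, since \<open>F\<close> is only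
      an indefinite integral of an integrable function and need not be differentiable
      everywhere.\<close>
    have int2: "integrable (lborel \<Otimes>\<^sub>M lborel) (case_prod (\<lambda>t x. (if t \<le> x then 1 else 0) * w t * \<psi> x))"
    proof (rule lborel_pair.Fubini_integrable)
      have i1: "integrable lborel (\<lambda>x. (if t \<le> x then 1 else 0) * w t * \<psi> x)" for t
        by (rule Bochner_Integration.integrable_bound[of lborel "\<lambda>x. w t * \<psi> x"])
          (use i\<psi> in \<open>auto intro!: AE_I2\<close>)
      then show "AE t in lborel. integrable lborel (\<lambda>x. case (t, x) of (t, x) \<Rightarrow> (if t \<le> x then 1 else 0) * w t * \<psi> x)"
        by simp
      have "integrable lborel (\<lambda>t. LINT x|lborel. norm ((if t \<le> x then 1 else 0) * w t * \<psi> x))"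
      proof (rule Bochner_Integration.integrable_bound[of lborel "\<lambda>t. (LINT x|lborel. \<bar>\<psi> x\<bar>) * w t"])
        show "AE t in lborel. norm (LINT x|lborel. norm ((if t \<le> x then 1 else 0) * w t * \<psi> x)) \<le>
            norm ((LINT x|lborel. \<bar>\<psi> x\<bar>) * w t)"
        proof (rule AE_I2)
          fix t
          have "(LINT x|lborel. norm ((if t \<le> x then 1 else 0) * w t * \<psi> x)) \<le> (LINT x|lborel. \<bar>w t\<bar> * \<bar>\<psi> x\<bar>)"
            by (intro integral_mono integrable_norm[OF i1] integrable_mult_right integrable_abs i\<psi>)
               (auto simp: abs_mult)
          moreover have "0 \<le> (LINT x|lborel. norm ((if t \<le> x then 1 else 0) * w t * \<psi> x))"
            by (rule Bochner_Integration.integral_nonneg) auto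
          ultimately show "norm (LINT x|lborel. norm ((if t \<le> x then 1 else 0) * w t * \<psi> x)) \<le>
            norm ((LINT x|lborel. \<bar>\<psi> x\<bar>) * w t)"
            by (simp add: abs_mult mult.commute)
        qed
      qed (use w in auto)
      then show "integrable lborel (\<lambda>t. LINT x|lborel. norm (case (t, x) of (t, x) \<Rightarrow> (if t \<le> x then 1 else 0) * w t * \<psi> x))"
        by simp
    qed measurable
    have "(LINT x|lborel. F x * \<psi> x) = (LINT x|lborel. LINT t|lborel. (if t \<le> x then 1 else 0) * w t * \<psi> x)"
      unfolding F_def
      by (subst Bochner_Integration.integral_mult_left_zero[symmetric])
         (auto intro!: Bochner_Integration.integral_cong split: split_indicator)
    also have "\<dots> = (LINT t|lborel. LINT x|lborel. (if t \<le> x then 1 else 0) * w t * \<psi> x)"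
      by (rule lborel_pair.Fubini_integral[OF int2])
    also have "\<dots> = (LINT t|lborel. - (u' t * \<phi> t))"
    proof (rule Bochner_Integration.integral_cong)
      fix t
      show "(LINT x|lborel. (if t \<le> x then 1 else 0) * w t * \<psi> x) = - (u' t * \<phi> t)"
      proof (cases "t \<in> {-m..m}")
        case True
        have "(LINT x|lborel. (if t \<le> x then 1 else 0) * w t * \<psi> x) = (LINT x|lborel. w t * (\<psi> x * indicator {t..m} x))"
          using \<psi>(2) by (intro Bochner_Integration.integral_cong) (auto split: split_indicator)
        also have "\<dots> = w t * (\<phi> m - \<phi> t)"
          using ftc[of t m] True by simp
        finally show ?thesis using True \<phi>m by (simp add: w_def)
      next
        case False
        then have "\<phi> t = 0" "w t = 0" using \<phi>0[of t] by (auto simp: w_def)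
        then show ?thesis by simp
      qed
    qed simp
    finally have "(LINT x|lborel. F x * \<psi> x) = - (LINT x|lborel. u' x * \<phi> x)" by simp
    then show "(LINT x|lborel. (u x - F x) * \<psi> x) = 0"
      using w1 times[OF iu] times[OF iF] by (simp add: left_diff_distrib)
  qed
  then obtain c where "AE x in lborel. \<bar>x\<bar> < m \<longrightarrow> u x - F x = c" by blast
  then have "AE x in lborel. \<bar>x\<bar> < m \<longrightarrow> u x = c + F x"
    by eventually_elim auto
  then show ?thesis unfolding F_def w_def by blast
qed

lemma continuous_AE_zero_imp_zero:
  fixes f :: "real \<Rightarrow> real"
  assumes cont: "continuous_on UNIV f" and ae: "AE x in lborel. x \<in> {a<..<b} \<longrightarrow> f x = 0"
    and x: "x \<in> {a..b}" and ab: "a < b"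
  shows "f x = 0"
proof -
  let ?S = "{x \<in> {a<..<b}. f x \<noteq> 0}"
  have op: "open ?S"
  proof -
    have "open (f -` (- {0}))"
      using cont by (intro open_vimage) auto
    then have "open ({a<..<b} \<inter> f -` (- {0}))" by auto
    also have "{a<..<b} \<inter> f -` (- {0}) = ?S" by auto
    finally show ?thesis .
  qed
  have "AE x in lborel. x \<notin> ?S" using ae by eventually_elim auto
  moreover have "?S \<in> sets lborel" using op by simp
  ultimately have "?S \<in> null_sets lborel"
    by (subst (asm) AE_iff_null_sets[symmetric]) auto
  then have "negligible ?S"
    by (simp add: negligible_iff_null_sets null_sets_completionI)
  then have "?S = {}" using open_not_negligible[OF op] by blast
  then have z: "f y = 0" if "y \<in> {a<..<b}" for y using that by blast
  have cl: "closure {a<..<b} = {a..b}" using ab by simp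
  show ?thesis
    by (rule continuous_constant_on_closure[of "{a<..<b}" f 0 x])
       (use z x cl cont in \<open>auto intro: continuous_on_subset\<close>)
qed

lemma zero_derivative_if_locally_zero:
  fixes f :: "real \<Rightarrow> real"
  assumes "(f has_real_derivative D) (at x)" "open S" "x \<in> S" "\<And>y. y \<in> S \<Longrightarrow> f y = 0"
  shows "D = 0"
proof -
  have "((\<lambda>_. 0) has_real_derivative D) (at x)"
    by (rule has_field_derivative_transform_within_open[OF assms(1-3)]) (use assms(4) in auto)
  then show ?thesis using DERIV_unique DERIV_const by blast
qed

text \<open>One-dimensional Sobolev embedding: the first weak derivative is a primitive of an
  \<open>L2\<close> function, hence Hoelder continuous of exponent \<open>1 / 2\<close>, and
  integrating it once more gives \<open>G\<close>. Vanishing for large arguments is recorded both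
  for \<open>G\<close> and, pointwise, for \<open>g\<close> itself, because \<open>Vtr2\<close> is
  sensitive to the values of \<open>g\<close> at single points.\<close>

lemma H2c_fun_C1_representative:
  assumes "H2c_fun g"
  obtains G G' B L K R where
    "AE x in lborel. g x = G x" "\<And>x. (G has_real_derivative G' x) (at x)"
    "\<And>x. \<bar>G x\<bar> \<le> B" "\<And>x. \<bar>G' x\<bar> \<le> L" "\<And>x y. \<bar>G' x - G' y\<bar> \<le> K * sqrt \<bar>x - y\<bar>"
    "\<And>x. R \<le> \<bar>x\<bar> \<Longrightarrow> G x = 0" "\<And>x. R \<le> \<bar>x\<bar> \<Longrightarrow> g x = 0" "0 < R" "0 \<le> K"
proof -
  obtain g1 g2 where L2: "L2_fun g" "L2_fun g1" "L2_fun g2"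
    and weak: "has_weak_derivative g g1" "has_weak_derivative g1 g2"
    using assms by (auto simp: H2c_fun_def H2_fun_def)
  have "bounded {x. g x \<noteq> 0}"
    using assms by (auto simp: H2c_fun_def compactly_supported_def)
  then obtain R0 where R0: "\<And>x. g x \<noteq> 0 \<Longrightarrow> \<bar>x\<bar> \<le> R0" unfolding bounded_real by auto
  define R where "R = \<bar>R0\<bar> + 1"
  \<comment> \<open>The margin between \<open>R\<close> and \<open>m\<close> leaves open intervals
    on which \<open>g\<close> vanishes; continuity then forces \<open>G\<close> and
    \<open>G'\<close> to vanish on them and at their ends.\<close>
  define m where "m = R + 1"
  have R: "0 < R" "R < m" and m: "0 < m" by (auto simp: R_def m_def)
  have gR: "g x = 0" if "R \<le> \<bar>x\<bar>" for x using R0[of x] that unfolding R_def by linarith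
  define w where "w = (\<lambda>t. indicator {-m..m} t * g2 t)"
  have [measurable]: "g \<in> borel_measurable borel" "g1 \<in> borel_measurable borel" "g2 \<in> borel_measurable borel"
    using L2 by (auto simp: L2_fun_def)
  have w: "integrable lborel w" unfolding w_def by (rule set_integrable_if_L2_fun[OF L2(3)])
  have [measurable]: "w \<in> borel_measurable borel" unfolding w_def by measurable
  have w2: "integrable lborel (\<lambda>t. (w t)\<^sup>2)"
    by (rule Bochner_Integration.integrable_bound[of lborel "\<lambda>t. (g2 t)\<^sup>2"])
       (use L2(3) in \<open>auto simp: L2_fun_def w_def split: split_indicator\<close>)
  define W where "W = (\<lambda>x. LINT t|lborel. indicator {..x} t * w t)"
  have iw: "integrable lborel (\<lambda>t. indicator A t * w t)" if "A \<in> sets borel" for A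
    using integrable_mult_indicator[of A lborel w] w that by simp
  define K where "K = ((LINT t|lborel. (w t)\<^sup>2) + 1) / 2"
  have K0: "0 \<le> K" unfolding K_def by (simp add: Bochner_Integration.integral_nonneg)
  have W_diff: "\<bar>W y - W x\<bar> \<le> K * sqrt (y - x)" if "x < y" for x y
  proof -
    \<comment> \<open>Young's inequality with weight \<open>l\<close> replaces Cauchy-Schwarz: it
      bounds the increment by \<open>l / 2\<close> times the square integral plus
      \<open>(y - x) / (2 * l)\<close>, and both terms are of order \<open>l\<close>.\<close>
    define l where "l = sqrt (y - x)"
    have l: "0 < l" "l * l = y - x" using that by (auto simp: l_def)
    have ind: "integrable lborel (\<lambda>t. indicator {x<..y} t :: real)"
      using that by (intro integrable_real_indicator) auto
    have "W y - W x = (LINT t|lborel. indicator {x<..y} t * w t)"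
      unfolding W_def using that
      by (subst Bochner_Integration.integral_diff[symmetric])
         (auto intro!: iw Bochner_Integration.integral_cong split: split_indicator)
    then have "\<bar>W y - W x\<bar> \<le> (LINT t|lborel. \<bar>indicator {x<..y} t * w t\<bar>)"
      by (simp add: integral_abs_bound)
    also have "\<dots> \<le> (LINT t|lborel. l / 2 * (w t)\<^sup>2 + indicator {x<..y} t / (2 * l))"
    proof (rule integral_mono)
      show "integrable lborel (\<lambda>t. \<bar>indicator {x<..y} t * w t\<bar>)" by (intro integrable_abs iw) auto
      show "integrable lborel (\<lambda>t. l / 2 * (w t)\<^sup>2 + indicator {x<..y} t / (2 * l))"
        using w2 ind by (intro Bochner_Integration.integrable_add) auto
      fix t
      have "2 * (l * \<bar>w t\<bar>) * 1 \<le> (l * \<bar>w t\<bar>)\<^sup>2 + 1\<^sup>2" by (rule sum_squares_bound)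
      then have "\<bar>w t\<bar> \<le> l / 2 * (w t)\<^sup>2 + 1 / (2 * l)"
        using l by (simp add: field_simps power2_eq_square)
      then show "\<bar>indicator {x<..y} t * w t\<bar> \<le> l / 2 * (w t)\<^sup>2 + indicator {x<..y} t / (2 * l)"
        using l by (auto split: split_indicator)
    qed
    also have "\<dots> = l / 2 * (LINT t|lborel. (w t)\<^sup>2) + (LINT t|lborel. indicator {x<..y} t) / (2 * l)"
      using w2 ind by (subst Bochner_Integration.integral_add) auto
    also have "(LINT t|lborel. indicator {x<..y} t) = l * l" using that l by simp
    also have "l / 2 * (LINT t|lborel. (w t)\<^sup>2) + l * l / (2 * l) = K * l"
      using l by (simp add: K_def field_simps)
    finally show ?thesis by (simp add: l_def)
  qed
  obtain c1 where c1: "AE x in lborel. \<bar>x\<bar> < m \<longrightarrow> g1 x = c1 + W x"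
    using weak_derivative_primitive[OF m L2(2,3) weak(2)] unfolding W_def w_def by blast
  define G' where "G' x = c1 + W x" for x
  have holder: "\<bar>G' x - G' y\<bar> \<le> K * sqrt \<bar>x - y\<bar>" for x y
  proof (cases x y rule: linorder_cases)
    case less then show ?thesis using W_diff[of x y] by (simp add: G'_def abs_minus_commute)
  next
    case greater then show ?thesis using W_diff[of y x] by (simp add: G'_def)
  qed simp
  have contG': "isCont G' x" for x
  proof -
    have "((\<lambda>y. K * sqrt \<bar>y - x\<bar>) \<longlongrightarrow> K * sqrt \<bar>x - x\<bar>) (at x)" by (intro tendsto_intros)
    then have lim: "((\<lambda>y. K * sqrt \<bar>y - x\<bar>) \<longlongrightarrow> 0) (at x)" by simp
    have "((\<lambda>y. G' y - G' x) \<longlongrightarrow> 0) (at x)"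
      by (rule Lim_null_comparison[OF _ lim]) (use holder in auto)
    then show ?thesis unfolding isCont_def by (subst LIM_zero_iff[symmetric])
  qed
  then have contG'_on: "continuous_on S G'" for S by (simp add: continuous_at_imp_continuous_on)
  have "\<exists>\<Gamma>. \<forall>x. - \<infinity> < ereal x \<longrightarrow> ereal x < \<infinity> \<longrightarrow> (\<Gamma> has_vector_derivative G' x) (at x)"
    by (rule einterval_antiderivative) (auto intro: contG')
  then obtain \<Gamma> where \<Gamma>: "\<And>x. (\<Gamma> has_real_derivative G' x) (at x)"
    by (auto simp: has_real_derivative_iff_has_vector_derivative)
  obtain c0 where c0: "AE x in lborel. \<bar>x\<bar> < m \<longrightarrow>
      g x = c0 + (LINT t|lborel. indicator {..x} t * (indicator {-m..m} t * g1 t))"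
    using weak_derivative_primitive[OF m L2(1,2) weak(1)] by blast
  define G where "G x = c0 + \<Gamma> x - \<Gamma> (- m)" for x
  have dG: "(G has_real_derivative G' x) (at x)" for x
    unfolding G_def using \<Gamma>[of x] by (auto intro!: derivative_eq_intros)
  then have contG: "continuous_on S G" for S
    by (meson DERIV_isCont continuous_at_imp_continuous_on)
  have prim: "(LINT t|lborel. indicator {..x} t * (indicator {-m..m} t * g1 t)) = \<Gamma> x - \<Gamma> (- m)" if "\<bar>x\<bar> < m" for x
  proof -
    have [measurable]: "G' \<in> borel_measurable borel"
      using contG'_on by (rule borel_measurable_continuous_onI)
    have "(LINT t|lborel. indicator {..x} t * (indicator {-m..m} t * g1 t)) = (LINT t|lborel. G' t * indicator {-m..x} t)"
    proof (rule integral_cong_AE)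
      have "AE t in lborel. t \<noteq> - m" by (rule AE_lborel_singleton)
      with c1 show "AE t in lborel. indicator {..x} t * (indicator {-m..m} t * g1 t) = G' t * indicator {-m..x} t"
        by eventually_elim (use that in \<open>auto simp: G'_def split: split_indicator\<close>)
    qed auto
    also have "\<dots> = \<Gamma> x - \<Gamma> (- m)"
      using \<Gamma> contG' that by (intro integral_FTC_Icc_real) auto
    finally show ?thesis .
  qed
  have gG: "AE x in lborel. \<bar>x\<bar> < m \<longrightarrow> g x = G x"
    using c0 by eventually_elim (auto simp: G_def prim)
  have G0: "G x = 0" if "R \<le> \<bar>x\<bar>" "\<bar>x\<bar> \<le> m" for x
  proof (cases "0 \<le> x")
    case True
    have "AE x in lborel. x \<in> {R<..<m} \<longrightarrow> G x = 0"
      using gG by eventually_elim (use R gR in auto)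
    then show ?thesis by (rule continuous_AE_zero_imp_zero[OF contG]) (use True that R in auto)
  next
    case False
    have "AE x in lborel. x \<in> {-m<..<-R} \<longrightarrow> G x = 0"
    proof (use gG in eventually_elim, intro impI)
      fix x assume "\<bar>x\<bar> < m \<longrightarrow> g x = G x" "x \<in> {-m<..<-R}"
      then show "G x = 0" using R gR[of x] by auto
    qed
    then show ?thesis by (rule continuous_AE_zero_imp_zero[OF contG]) (use False that R in auto)
  qed
  have G'in: "G' x = 0" if "R < \<bar>x\<bar>" "\<bar>x\<bar> < m" for x
  proof (rule zero_derivative_if_locally_zero[OF dG])
    show "open ({R<..<m} \<union> {-m<..<-R})" by auto
    show "x \<in> {R<..<m} \<union> {-m<..<-R}" using that by (auto simp: abs_if split: if_splits)
    show "G y = 0" if "y \<in> {R<..<m} \<union> {-m<..<-R}" for y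
      using that R by (intro G0) auto
  qed
  have G'm: "G' m = 0" "G' (- m) = 0"
    by (rule continuous_AE_zero_imp_zero[OF contG'_on, of R m m] continuous_AE_zero_imp_zero[OF contG'_on, of "-m" "-R" "-m"],
        use R G'in in \<open>auto intro!: AE_I2\<close>)+
  \<comment> \<open>The density \<open>w\<close> is cut off at \<open>{-m..m}\<close>, so beyond
    this interval \<open>W\<close> keeps the value it has at the ends.\<close>
  have G'out: "G' x = 0" if "m \<le> \<bar>x\<bar>" for x
  proof (cases "0 \<le> x")
    case True
    have "W x = W m"
      unfolding W_def using True that
      by (intro Bochner_Integration.integral_cong) (auto simp: w_def split: split_indicator)
    then show ?thesis using G'm by (simp add: G'_def)
  next
    case False
    have "W x = W (- m)"
      unfolding W_def
    proof (rule integral_cong_AE)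
      have "AE t in lborel. t \<noteq> - m" by (rule AE_lborel_singleton)
      then show "AE t in lborel. indicator {..x} t * w t = indicator {..- m} t * w t"
        by eventually_elim (use False that in \<open>auto simp: w_def split: split_indicator\<close>)
    qed auto
    then show ?thesis using G'm by (simp add: G'_def)
  qed
  have Gout: "G x = 0" if "R \<le> \<bar>x\<bar>" for x
  proof (cases "\<bar>x\<bar> \<le> m")
    case False
    have "G x = (if 0 \<le> x then G m else G (- m))"
    proof (cases "0 \<le> x")
      case True
      have "G x = G m"
        by (rule DERIV_isconst_end[of m x G]) (use contG dG G'out True False m in \<open>auto simp: DERIV_isCont\<close>, metis G'out abs_of_pos dG less_imp_le order_less_trans)
      then show ?thesis using True by simp
    next
      case neg: False
      have "G (- m) = G x"
        by (rule DERIV_isconst_end[of x "-m" G]) (use contG dG G'out neg False m in \<open>auto simp: DERIV_isCont\<close>, smt (verit) G'out dG)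
      then show ?thesis using neg by simp
    qed
    then show ?thesis using G0[of m] G0[of "-m"] R m by auto
  qed (use G0 that in auto)
  have bdd: "\<exists>b. \<forall>x. \<bar>f x\<bar> \<le> b" if f: "continuous_on {-m..m} f" "\<And>x. m \<le> \<bar>x\<bar> \<Longrightarrow> f x = 0" for f :: "real \<Rightarrow> real"
  proof -
    have "compact (f ` {-m..m})" using f(1) by (intro compact_continuous_image) auto
    then obtain b where b: "\<And>x. x \<in> {-m..m} \<Longrightarrow> \<bar>f x\<bar> \<le> b"
      by (meson bounded_real compact_imp_bounded imageI)
    have "\<bar>f x\<bar> \<le> b" for x
      using b[of x] b[of 0] f(2)[of x] m by (cases "x \<in> {-m..m}") auto
    then show ?thesis by blast
  qed
  obtain B where B: "\<And>x. \<bar>G x\<bar> \<le> B" using bdd[OF contG] Gout R by force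
  obtain L where L: "\<And>x. \<bar>G' x\<bar> \<le> L" using bdd[OF contG'_on] G'out by force
  have ae: "AE x in lborel. g x = G x"
    using gG
  proof eventually_elim
    fix x assume "\<bar>x\<bar> < m \<longrightarrow> g x = G x"
    then show "g x = G x" using gR[of x] Gout[of x] R by (cases "\<bar>x\<bar> < m") auto
  qed
  show thesis by (rule that[OF ae dG B L holder Gout gR R(1) K0])
qed

section \<open>Second differences and periodic kernels\<close>

lemma integral_angle:
  fixes f :: "real \<Rightarrow> real"
  assumes "f \<in> borel_measurable borel"
  shows "integral\<^sup>L angle f = (LINT t|lborel. indicator {0..pi} t * f t)"
  unfolding angle_def using assms by (subst integral_density) (auto simp: mult.commute)

lemma integrable_angle_iff:
  fixes f :: "real \<Rightarrow> real"
  assumes "f \<in> borel_measurable borel"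
  shows "integrable angle f \<longleftrightarrow> integrable lborel (\<lambda>t. indicator {0..pi} t * f t)"
  unfolding angle_def using assms by (subst integrable_density) (auto simp: mult.commute)

lemma integral_angle_continuous:
  fixes f :: "real \<Rightarrow> real"
  assumes "continuous_on UNIV f"
  shows "integral\<^sup>L angle f = integral {0..pi} f"
proof -
  have "f \<in> borel_measurable borel" using assms by (rule borel_measurable_continuous_onI)
  moreover have "set_integrable lborel {0..pi} f"
    unfolding set_integrable_def using assms by (intro borel_integrable_compact) (auto intro: continuous_on_subset)
  then have "(LINT t:{0..pi}|lborel. f t) = integral {0..pi} f" by (rule set_borel_integral_eq_integral)
  ultimately show ?thesis by (simp add: integral_angle set_lebesgue_integral_def)
qed

lemma integrable_angle_bounded:
  fixes f :: "real \<Rightarrow> real"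
  assumes "f \<in> borel_measurable borel" "\<And>t. \<bar>f t\<bar> \<le> b"
  shows "integrable angle f"
  using assms by (intro angle.integrable_const_bound[of _ b]) (auto intro!: AE_I2)

lemma integrable_angle2_bounded:
  fixes f :: "real \<times> real \<Rightarrow> real"
  assumes "f \<in> borel_measurable (borel \<Otimes>\<^sub>M borel)" "\<And>z. \<bar>f z\<bar> \<le> b"
  shows "integrable (angle \<Otimes>\<^sub>M angle) f"
  using assms by (intro angle2f.integrable_const_bound[of _ b]) (auto intro!: AE_I2)

lemma AE_angle: "AE t in angle. t \<in> {0..pi}"
  unfolding angle_def by (subst AE_density) (auto intro!: AE_I2 split: split_indicator_asm)

lemma AE_angle_if_AE_lborel:
  assumes "AE x in lborel. P x"
  shows "AE t in angle. P (cs t)"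
proof -
  have "AE x in arc. P x"
    unfolding arc_def using assms by (subst AE_density) auto
  then show ?thesis
    unfolding arc_eq_distr by (rule AE_distrD[rotated]) simp
qed

lemma AE_angle2:
  assumes "AE s in angle. P s" "AE u in angle. Q u"
  shows "AE z in (angle \<Otimes>\<^sub>M angle). P (fst z) \<and> Q (snd z)"
proof -
  obtain A where A: "A \<in> null_sets angle" "{s. \<not> P s} \<subseteq> A"
    using assms(1) by (auto simp: eventually_ae_filter)
  obtain B where B: "B \<in> null_sets angle" "{u. \<not> Q u} \<subseteq> B"
    using assms(2) by (auto simp: eventually_ae_filter)
  have "A \<times> UNIV \<in> null_sets (angle \<Otimes>\<^sub>M angle)" "UNIV \<times> B \<in> null_sets (angle \<Otimes>\<^sub>M angle)"
    using A(1) B(1) angle.emeasure_pair_measure_Times[of A angle UNIV] angle.emeasure_pair_measure_Times[of UNIV angle B]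
    by (auto simp: null_sets_def)
  then have "A \<times> UNIV \<union> UNIV \<times> B \<in> null_sets (angle \<Otimes>\<^sub>M angle)" by auto
  then show ?thesis
    by (rule AE_I') (use A(2) B(2) in auto)
qed

lemma integral_angle_convolution:
  fixes H k :: "real \<Rightarrow> real"
  assumes H: "continuous_on UNIV H" "\<And>t. H (t + 2 * pi) = H t" "\<And>t. H (- t) = e * H t"
    and k: "continuous_on UNIV k" "\<And>t. k (t + 2 * pi) = k t" "\<And>t. k (- t) = k t"
  shows "(LINT u|angle. H u * (k (t - u) + e * k (t + u))) = (LINT u|angle. (H (t + u) + H (t - u)) * k u)"
proof -
  have cH: "continuous_on S (\<lambda>u. H (g u))" if "continuous_on S g" for S and g :: "real \<Rightarrow> real"
    using that by (intro continuous_on_compose2[OF H(1)]) auto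
  have ck: "continuous_on S (\<lambda>u. k (g u))" if "continuous_on S g" for S and g :: "real \<Rightarrow> real"
    using that by (intro continuous_on_compose2[OF k(1)]) auto
  show ?thesis
    using integral_half_period_convolution[OF assms, of t]
    by (subst (1 2) integral_angle_continuous) (auto intro!: continuous_intros cH ck)
qed

lemma integral_angle2_convolution:
  fixes F H k :: "real \<Rightarrow> real"
  assumes F: "F \<in> borel_measurable borel" "\<And>t. \<bar>F t\<bar> \<le> bF"
    and H: "continuous_on UNIV H" "\<And>t. H (t + 2 * pi) = H t" "\<And>t. H (- t) = e * H t" "\<And>t. \<bar>H t\<bar> \<le> bH"
    and k: "continuous_on UNIV k" "\<And>t. k (t + 2 * pi) = k t" "\<And>t. k (- t) = k t" "\<And>t. \<bar>k t\<bar> \<le> bk"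
  shows "(LINT (s, u)|(angle \<Otimes>\<^sub>M angle). F s * (H u * (k (s - u) + e * k (s + u)))) =
    (LINT s|angle. F s * (LINT u|angle. (H (s + u) + H (s - u)) * k u))"
    and "integrable (angle \<Otimes>\<^sub>M angle) (\<lambda>(s, u). F s * (H u * (k (s - u) + e * k (s + u))))"
proof -
  have [measurable]: "F \<in> borel_measurable borel" "H \<in> borel_measurable borel" "k \<in> borel_measurable borel"
    using F H(1) k(1) by (auto intro: borel_measurable_continuous_onI)
  show int: "integrable (angle \<Otimes>\<^sub>M angle) (\<lambda>(s, u). F s * (H u * (k (s - u) + e * k (s + u))))"
  proof (rule integrable_angle2_bounded)
    fix z
    have nn: "0 \<le> bF" "0 \<le> bH" "0 \<le> bk" using F(2)[of 0] H(4)[of 0] k(4)[of 0] by linarith+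
    have "\<bar>k (fst z - snd z) + e * k (fst z + snd z)\<bar> \<le> bk + \<bar>e\<bar> * bk"
      using k(4) by (intro order.trans[OF abs_triangle_ineq] add_mono) (auto simp: abs_mult intro!: mult_left_mono)
    then show "\<bar>case z of (s, u) \<Rightarrow> F s * (H u * (k (s - u) + e * k (s + u)))\<bar> \<le> bF * (bH * (bk + \<bar>e\<bar> * bk))"
      using nn F(2) H(4) by (auto simp: abs_mult split_beta intro!: mult_mono)
  qed measurable
  have "(LINT (s, u)|(angle \<Otimes>\<^sub>M angle). F s * (H u * (k (s - u) + e * k (s + u)))) =
      (LINT s|angle. LINT u|angle. F s * (H u * (k (s - u) + e * k (s + u))))"
    by (rule angle2.integral_fst[OF int, symmetric])
  also have "\<dots> = (LINT s|angle. F s * (LINT u|angle. (H (s + u) + H (s - u)) * k u))"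
    using integral_angle_convolution[OF H(1-3) k(1-3)] by simp
  finally show "(LINT (s, u)|(angle \<Otimes>\<^sub>M angle). F s * (H u * (k (s - u) + e * k (s + u)))) =
    (LINT s|angle. F s * (LINT u|angle. (H (s + u) + H (s - u)) * k u))" .
qed

text \<open>Symmetric in \<open>u\<close>, so the first-order term cancels; a kernel with a
  singularity of order \<open>1 / u ^ 2\<close> requires this.\<close>

definition second_diff :: "(real \<Rightarrow> real) \<Rightarrow> real \<Rightarrow> real \<Rightarrow> real" where
  "second_diff H s u = H (s + u) + H (s - u) - 2 * H s"

text \<open>The convolution identity is used for \<open>H\<close>, and for the constant
  \<open>1\<close> with \<open>F * H\<close> in place of \<open>F\<close>. Boundedness of the kernel
  lets the two parts of the difference be integrated separately.\<close>

lemma integral_angle2_second_diff: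
  fixes F H k :: "real \<Rightarrow> real"
  assumes F: "F \<in> borel_measurable borel" "\<And>t. \<bar>F t\<bar> \<le> bF"
    and H: "continuous_on UNIV H" "\<And>t. H (t + 2 * pi) = H t" "\<And>t. H (- t) = H t" "\<And>t. \<bar>H t\<bar> \<le> bH"
    and k: "continuous_on UNIV k" "\<And>t. k (t + 2 * pi) = k t" "\<And>t. k (- t) = k t" "\<And>t. \<bar>k t\<bar> \<le> bk"
  shows "(LINT (s, u)|(angle \<Otimes>\<^sub>M angle). F s * ((H u - H s) * (k (s - u) + k (s + u)))) =
      (LINT s|angle. F s * (LINT u|angle. second_diff H s u * k u))"
    and "integrable (angle \<Otimes>\<^sub>M angle) (\<lambda>(s, u). F s * ((H u - H s) * (k (s - u) + k (s + u))))"
proof -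
  have [measurable]: "F \<in> borel_measurable borel" "H \<in> borel_measurable borel" "k \<in> borel_measurable borel"
    using F H(1) k(1) by (auto intro: borel_measurable_continuous_onI)
  have nn: "0 \<le> bF" "0 \<le> bH" "0 \<le> bk" using F(2)[of 0] H(4)[of 0] k(4)[of 0] by linarith+
  have FH: "\<bar>F t * H t\<bar> \<le> bF * bH" for t
    unfolding abs_mult using F H nn by (intro mult_mono) auto
  note i1 = integral_angle2_convolution[where e=1 and F=F and H=H and k=k, OF F H(1,2) _ H(4) k, simplified, OF H(3)]
  note i2 = integral_angle2_convolution[where e=1 and F="\<lambda>s. F s * H s" and H="\<lambda>_. 1" and k=k, OF _ FH _ _ _ _ k, of 1, simplified]
  have eq: "(\<lambda>(s, u). F s * ((H u - H s) * (k (s - u) + k (s + u)))) =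
      (\<lambda>z. (case z of (s, u) \<Rightarrow> F s * (H u * (k (s - u) + k (s + u)))) -
           (case z of (s, u) \<Rightarrow> F s * H s * (k (s - u) + k (s + u))))"
    by (auto simp: algebra_simps)
  show "integrable (angle \<Otimes>\<^sub>M angle) (\<lambda>(s, u). F s * ((H u - H s) * (k (s - u) + k (s + u))))"
    unfolding eq by (intro Bochner_Integration.integrable_diff i1 i2)
  have ik: "integrable angle (\<lambda>u. c * k u)" for c
    by (intro integrable_mult_right integrable_angle_bounded[of k bk] k) auto
  have iHk: "integrable angle (\<lambda>u. (H (s + u) + H (s - u)) * k u)" for s
  proof (rule integrable_angle_bounded)
    show "\<bar>(H (s + u) + H (s - u)) * k u\<bar> \<le> (bH + bH) * bk" for u
      unfolding abs_mult using H(4) nn k(4)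
      by (intro mult_mono order.trans[OF abs_triangle_ineq] add_mono) auto
  qed measurable
  have isd: "(LINT u|angle. second_diff H s u * k u) =
      (LINT u|angle. (H (s + u) + H (s - u)) * k u) - H s * (LINT u|angle. 2 * k u)" for s
  proof -
    have "second_diff H s u * k u = (H (s + u) + H (s - u)) * k u - H s * (2 * k u)" for u
      by (simp add: second_diff_def algebra_simps)
    then show ?thesis using iHk[of s] ik by (simp del: mult.assoc)
  qed
  have b2: "\<bar>LINT u|angle. g u\<bar> \<le> c * measure angle UNIV" if "\<And>u. \<bar>g u\<bar> \<le> c" "integrable angle g" for g c
  proof -
    have "\<bar>LINT u|angle. g u\<bar> \<le> (LINT u|angle. \<bar>g u\<bar>)" by (rule integral_abs_bound)
    also have "\<dots> \<le> (LINT u|angle. c)" using that by (intro integral_mono) auto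
    finally show ?thesis by (simp add: mult.commute)
  qed
  have m1: "(\<lambda>s. LINT u|angle. (H (s + u) + H (s - u)) * k u) \<in> borel_measurable borel"
    by measurable
  have j1: "integrable angle (\<lambda>s. F s * (LINT u|angle. (H (s + u) + H (s - u)) * k u))"
  proof (rule integrable_angle_bounded)
    have "\<bar>(H (s + u) + H (s - u)) * k u\<bar> \<le> (bH + bH) * bk" for s u
      unfolding abs_mult using H(4) nn k(4)
      by (intro mult_mono order.trans[OF abs_triangle_ineq] add_mono) auto
    from b2[OF this iHk] show "\<bar>F s * (LINT u|angle. (H (s + u) + H (s - u)) * k u)\<bar> \<le> bF * ((bH + bH) * bk * measure angle UNIV)" for s
      unfolding abs_mult using F nn by (intro mult_mono) auto
  qed (use m1 in measurable)
  have j2: "integrable angle (\<lambda>s. F s * (H s * (LINT u|angle. 2 * k u)))"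
  proof (rule integrable_angle_bounded)
    show "\<bar>F s * (H s * (LINT u|angle. 2 * k u))\<bar> \<le> bF * bH * \<bar>LINT u|angle. 2 * k u\<bar>" for s
      using FH[of s] by (simp add: abs_mult mult.assoc[symmetric] mult_right_mono)
  qed measurable
  have "(LINT (s, u)|(angle \<Otimes>\<^sub>M angle). F s * ((H u - H s) * (k (s - u) + k (s + u)))) =
     (LINT s|angle. F s * (LINT u|angle. (H (s + u) + H (s - u)) * k u)) - (LINT s|angle. F s * H s * (LINT u|angle. 2 * k u))"
    unfolding eq using i1 i2 by (subst Bochner_Integration.integral_diff) auto
  also have "\<dots> = (LINT s|angle. F s * (LINT u|angle. second_diff H s u * k u))"
    unfolding isd using j1 j2 by (subst Bochner_Integration.integral_diff[symmetric]) (auto simp: algebra_simps)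
  finally show "(LINT (s, u)|(angle \<Otimes>\<^sub>M angle). F s * ((H u - H s) * (k (s - u) + k (s + u)))) =
      (LINT s|angle. F s * (LINT u|angle. second_diff H s u * k u))" .
qed

text \<open>The function \<open>w\<close> measures the second difference relative to the singularity
  \<open>1 / (1 - cos u)\<close>. It depends neither on the base point \<open>s\<close> nor on the
  kernel, so a single integrable function serves all bounds and all passages to the limit.\<close>

lemma AE_second_diff_kernel:
  fixes H k w :: "real \<Rightarrow> real"
  assumes w: "\<And>u. 0 \<le> w u"
    and sd: "\<And>s u. u \<in> {0..pi} \<Longrightarrow> \<bar>second_diff H s u\<bar> \<le> w u * (1 - cos u)"
    and kb: "\<And>u. \<bar>k u\<bar> * (1 - cos u) \<le> 1"
  shows "AE u in angle. \<bar>second_diff H s u * k u\<bar> \<le> w u"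
  using AE_angle
proof eventually_elim
  fix u assume u: "u \<in> {0..pi}"
  show "\<bar>second_diff H s u * k u\<bar> \<le> w u"
  proof (cases "u = 0")
    case True
    then show ?thesis using w[of 0] by (simp add: second_diff_def)
  next
    case False
    have "\<bar>second_diff H s u * k u\<bar> \<le> w u * (1 - cos u) * \<bar>k u\<bar>"
      unfolding abs_mult by (intro mult_right_mono sd u) auto
    also have "\<dots> = w u * (\<bar>k u\<bar> * (1 - cos u))" by simp
    also have "\<dots> \<le> w u * 1" by (intro mult_left_mono kb w)
    finally show ?thesis by simp
  qed
qed

lemma integral_second_diff_bound:
  fixes H k w :: "real \<Rightarrow> real"
  assumes w: "integrable angle w" "\<And>u. 0 \<le> w u"
    and sd: "\<And>s u. u \<in> {0..pi} \<Longrightarrow> \<bar>second_diff H s u\<bar> \<le> w u * (1 - cos u)"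
    and kb: "\<And>u. \<bar>k u\<bar> * (1 - cos u) \<le> 1"
  shows "\<bar>LINT u|angle. second_diff H s u * k u\<bar> \<le> (LINT u|angle. w u)"
proof -
  have "\<bar>LINT u|angle. second_diff H s u * k u\<bar> \<le> (LINT u|angle. \<bar>second_diff H s u * k u\<bar>)"
    by (rule integral_abs_bound)
  also have "\<dots> \<le> (LINT u|angle. w u)"
    using AE_second_diff_kernel[where k=k, OF w(2) sd kb] w by (intro integral_mono_AE') auto
  finally show ?thesis .
qed

lemma second_diff_bound:
  fixes F H k w :: "real \<Rightarrow> real"
  assumes F: "integrable angle F"
    and w: "integrable angle w" "\<And>u. 0 \<le> w u"
    and sd: "\<And>s u. u \<in> {0..pi} \<Longrightarrow> \<bar>second_diff H s u\<bar> \<le> w u * (1 - cos u)"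
    and kb: "\<And>u. \<bar>k u\<bar> * (1 - cos u) \<le> 1"
  shows "\<bar>LINT s|angle. F s * (LINT u|angle. second_diff H s u * k u)\<bar> \<le> (LINT s|angle. \<bar>F s\<bar>) * (LINT u|angle. w u)"
proof -
  have "\<bar>LINT s|angle. F s * (LINT u|angle. second_diff H s u * k u)\<bar> \<le>
      (LINT s|angle. \<bar>F s * (LINT u|angle. second_diff H s u * k u)\<bar>)"
    by (rule integral_abs_bound)
  also have "\<dots> \<le> (LINT s|angle. \<bar>F s\<bar> * (LINT u|angle. w u))"
    using F integral_second_diff_bound[where k=k, OF w sd kb] w(2)
    by (intro integral_mono') (auto simp: abs_mult intro!: mult_left_mono Bochner_Integration.integral_nonneg)
  finally show ?thesis by simp
qed

section \<open>The trace covariance\<close>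

lemma one_minus_cos_product: "(1 - cos (s - u)) * (1 - cos (s + u)) = (cos s - cos u)\<^sup>2" for s u :: real
proof -
  have "(1 - cos (s - u)) * (1 - cos (s + u)) = (1 - cos s * cos u)\<^sup>2 - (sin s)\<^sup>2 * (sin u)\<^sup>2"
    by (simp add: cos_add cos_diff power2_eq_square algebra_simps)
  also have "\<dots> = (cos s - cos u)\<^sup>2"
    unfolding sin_squared_eq by (simp add: power2_eq_square algebra_simps)
  finally show ?thesis .
qed

text \<open>Partial fractions: the numerator is twice the sum, and the denominator four times the
  product, of \<open>1 - cos (s - u)\<close> and \<open>1 - cos (s + u)\<close>.\<close>

lemma trace_kernel_angle:
  assumes "cs s \<noteq> cs u"
  shows "(4 - cs s * cs u) / (cs s - cs u)\<^sup>2 = (1 / (1 - cos (s - u)) + 1 / (1 - cos (s + u))) / 2"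
    and "0 < 1 - cos (s - u)" and "0 < 1 - cos (s + u)"
proof -
  define p where "p = 1 - cos (s - u)"
  define q where "q = 1 - cos (s + u)"
  have pq: "p * q = (cos s - cos u)\<^sup>2" unfolding p_def q_def by (rule one_minus_cos_product)
  have ne: "cos s - cos u \<noteq> 0" using assms by (simp add: cs_def)
  then have "p * q \<noteq> 0" using pq by simp
  moreover have "0 \<le> p" "0 \<le> q" by (simp_all add: p_def q_def)
  ultimately have pos: "0 < p" "0 < q" by auto
  then show "0 < 1 - cos (s - u)" "0 < 1 - cos (s + u)" by (simp_all add: p_def q_def)
  define c where "c = 1 - cos s * cos u"
  have "p + q = 2 * c" by (simp add: p_def q_def c_def cos_add cos_diff)
  moreover have "(cs s - cs u)\<^sup>2 = 4 * (p * q)" unfolding pq by (simp add: cs_def power2_eq_square algebra_simps)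
  moreover have "1 / p + 1 / q = (p + q) / (p * q)" using pos by (simp add: field_simps)
  moreover have "4 - cs s * cs u = 4 * c" by (simp add: cs_def c_def)
  ultimately have "(4 - cs s * cs u) / (cs s - cs u)\<^sup>2 = (1 / p + 1 / q) / 2" by simp
  then show "(4 - cs s * cs u) / (cs s - cs u)\<^sup>2 = (1 / (1 - cos (s - u)) + 1 / (1 - cos (s + u))) / 2"
    by (simp add: p_def q_def)
qed

text \<open>Here \<open>f\<close> stands for the function on the finer scale and \<open>h\<close>
  for the one on the coarser scale, with continuous representatives \<open>f0\<close> and
  \<open>h0\<close>. The given functions are kept beside them because they occur in the covariances
  and their edge values matter.\<close>

locale test_functions =
  fixes f h f0 h0 :: "real \<Rightarrow> real" and bf bh :: real
  assumes f_measurable [measurable]: "f \<in> borel_measurable borel"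
    and h_measurable [measurable]: "h \<in> borel_measurable borel"
    and f_AE: "AE x in lborel. f x = f0 x" and h_AE: "AE x in lborel. h x = h0 x"
    and f0_cont: "continuous_on UNIV f0" and h0_cont: "continuous_on UNIV h0"
    and f0_bound: "\<And>x. \<bar>f0 x\<bar> \<le> bf" and h0_bound: "\<And>x. \<bar>h0 x\<bar> \<le> bh"
begin

definition F :: "real \<Rightarrow> real" where "F t = f0 (cs t)"
definition H :: "real \<Rightarrow> real" where "H t = h0 (cs t)"

lemma F_cont: "continuous_on S F" and H_cont: "continuous_on S H"
  unfolding F_def H_def
  by (rule continuous_on_compose2[OF f0_cont] continuous_on_compose2[OF h0_cont]; simp add: continuous_cs)+

lemma F_measurable [measurable]: "F \<in> borel_measurable borel"
  and H_measurable [measurable]: "H \<in> borel_measurable borel"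
  using F_cont H_cont by (auto intro: borel_measurable_continuous_onI)

lemma F_bound: "\<bar>F t\<bar> \<le> bf" and H_bound: "\<bar>H t\<bar> \<le> bh"
  using f0_bound h0_bound by (auto simp: F_def H_def)

lemma bounds_nonneg: "0 \<le> bf" "0 \<le> bh"
  using F_bound[of 0] H_bound[of 0] by linarith+

lemma H_even: "H (- t) = H t" and H_periodic: "H (t + 2 * pi) = H t"
  by (simp_all add: H_def cs_periodic)

lemma F_AE: "AE t in angle. f (cs t) = F t" and H_AE: "AE t in angle. h (cs t) = H t"
  unfolding F_def H_def using f_AE h_AE by (auto intro: AE_angle_if_AE_lborel[where P="\<lambda>x. f x = f0 x"]
      AE_angle_if_AE_lborel[where P="\<lambda>x. h x = h0 x"])

lemma F_integrable: "integrable angle F" and H_integrable: "integrable angle H"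
  by (rule integrable_angle_bounded[OF F_measurable F_bound] integrable_angle_bounded[OF H_measurable H_bound])+

text \<open>All covariance bounds are linear in \<open>J\<close>, which will supply the negative
  power of \<open>N\<close>.\<close>

definition J :: real where "J = (LINT t|angle. \<bar>F t\<bar>)"

lemma J_nonneg: "0 \<le> J"
  unfolding J_def by (rule Bochner_Integration.integral_nonneg) simp

lemma Vtr1_eq: "Vtr1 f h = 1 / (4 * pi\<^sup>2) * (LINT (s, u)|(angle \<Otimes>\<^sub>M angle).
    (F s - F u) * (H s - H u) * ((1 / (1 - cos (s - u)) + 1 / (1 - cos (s + u))) / 2))"
proof -
  let ?\<Phi> = "\<lambda>x y. (f x - f y) * (h x - h y) / (x - y)\<^sup>2 * (4 - x * y)"
  have "(LINT (x, y):{-2..2} \<times> {-2..2}|lborel.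
        (f x - f y) * (h x - h y) / (x - y)\<^sup>2 * ((4 - x * y) / sqrt ((4 - x\<^sup>2) * (4 - y\<^sup>2)))) =
      (LINT (x, y):{-2..2} \<times> {-2..2}|lborel. ?\<Phi> x y / (sqrt (4 - x\<^sup>2) * sqrt (4 - y\<^sup>2)))"
    by (simp add: real_sqrt_mult)
  also have "\<dots> = (LINT (s, u)|(angle \<Otimes>\<^sub>M angle). ?\<Phi> (cs s) (cs u))"
    by (rule integral_arc2) (simp add: borel_prod[symmetric])
  also have "\<dots> = (LINT (s, u)|(angle \<Otimes>\<^sub>M angle).
      (F s - F u) * (H s - H u) * ((1 / (1 - cos (s - u)) + 1 / (1 - cos (s + u))) / 2))"
  proof (rule integral_cong_AE)
    have *: "?\<Phi> (cs s) (cs u) = (F s - F u) * (H s - H u) * ((1 / (1 - cos (s - u)) + 1 / (1 - cos (s + u))) / 2)"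
      if "f (cs s) = F s" "h (cs s) = H s" "f (cs u) = F u" "h (cs u) = H u" for s u
    proof (cases "cs s = cs u")
      case True
      then show ?thesis by (simp add: F_def)
    next
      case False
      have "?\<Phi> (cs s) (cs u) = (F s - F u) * (H s - H u) * ((4 - cs s * cs u) / (cs s - cs u)\<^sup>2)"
        using that by simp
      then show ?thesis unfolding trace_kernel_angle(1)[OF False] .
    qed
    have "AE t in angle. f (cs t) = F t \<and> h (cs t) = H t"
      using F_AE H_AE by eventually_elim auto
    from AE_angle2[OF this this] show "AE z in (angle \<Otimes>\<^sub>M angle). (case z of (s, u) \<Rightarrow> ?\<Phi> (cs s) (cs u)) =
      (case z of (s, u) \<Rightarrow> (F s - F u) * (H s - H u) * ((1 / (1 - cos (s - u)) + 1 / (1 - cos (s + u))) / 2))"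
    proof eventually_elim
      case (elim z)
      then show ?case using *[of "fst z" "snd z"] unfolding case_prod_beta by blast
    qed
  qed measurable
  finally show ?thesis unfolding Vtr1_def by simp
qed

text \<open>Nothing is claimed about the integrability of the integrand: if it is not integrable, its Bochner
  integral is \<open>0\<close>.  Otherwise it dominates its regularisations by \<open>1 / (d + (1 - cos t))\<close>, for
  which the double integral may be split.\<close>

lemma Vtr1_bound:
  assumes w: "integrable angle w" "\<And>u. 0 \<le> w u"
    and sd: "\<And>s u. u \<in> {0..pi} \<Longrightarrow> \<bar>second_diff H s u\<bar> \<le> w u * (1 - cos u)"
  shows "\<bar>Vtr1 f h\<bar> \<le> J * (LINT u|angle. w u) / (4 * pi\<^sup>2)"
proof -
  let ?W = "LINT u|angle. w u"
  have W0: "0 \<le> ?W" using w by (intro Bochner_Integration.integral_nonneg) auto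
  let ?\<Phi> = "\<lambda>(s, u). (F s - F u) * (H s - H u) * ((1 / (1 - cos (s - u)) + 1 / (1 - cos (s + u))) / 2)"
  have "\<bar>integral\<^sup>L (angle \<Otimes>\<^sub>M angle) ?\<Phi>\<bar> \<le> J * ?W"
  proof (cases "integrable (angle \<Otimes>\<^sub>M angle) ?\<Phi>")
    case False
    then show ?thesis using J_nonneg W0 by (simp add: not_integrable_integral_eq)
  next
    case True
    define d where "d n = 1 / real (Suc n)" for n
    have d0: "0 < d n" for n by (simp add: d_def)
    have d_lim: "d \<longlonglongrightarrow> 0" unfolding d_def by (rule LIMSEQ_inverse_real_of_nat[unfolded inverse_eq_divide])
    define k where "k n t = 1 / (d n + (1 - cos t))" for n t
    have dp: "0 < d n + (1 - cos t)" for n t using d0[of n] cos_le_one[of t] by linarith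
    have k: "continuous_on UNIV (k n)" "\<And>t. k n (t + 2 * pi) = k n t" "\<And>t. k n (- t) = k n t" "\<And>t. \<bar>k n t\<bar> \<le> 1 / d n" for n
    proof -
      show "continuous_on UNIV (k n)"
        unfolding k_def using dp by (intro continuous_intros) (auto simp: less_imp_neq[symmetric] dest: less_imp_neq)
      show "\<bar>k n t\<bar> \<le> 1 / d n" for t
        unfolding k_def using d0[of n] dp[of n t] by (auto simp: abs_of_pos intro!: divide_left_mono)
    qed (simp_all add: k_def)
    have [measurable]: "k n \<in> borel_measurable borel" for n
      using k(1) by (rule borel_measurable_continuous_onI)
    let ?A = "\<lambda>n. \<lambda>(s, u). (F s - F u) * (H s - H u) * ((k n (s - u) + k n (s + u)) / 2)"
    have lim: "(\<lambda>n. integral\<^sup>L (angle \<Otimes>\<^sub>M angle) (?A n)) \<longlonglongrightarrow> integral\<^sup>L (angle \<Otimes>\<^sub>M angle) ?\<Phi>"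
    proof (rule integral_dominated_convergence[where w="\<lambda>z. norm (?\<Phi> z)"])
      show "integrable (angle \<Otimes>\<^sub>M angle) (\<lambda>z. norm (?\<Phi> z))" using True by (rule integrable_norm)
      show "AE z in angle \<Otimes>\<^sub>M angle. (\<lambda>n. ?A n z) \<longlonglongrightarrow> ?\<Phi> z"
      proof (rule AE_I2, clarify)
        fix s u
        show "(\<lambda>n. (F s - F u) * (H s - H u) * ((k n (s - u) + k n (s + u)) / 2)) \<longlonglongrightarrow>
            (F s - F u) * (H s - H u) * ((1 / (1 - cos (s - u)) + 1 / (1 - cos (s + u))) / 2)"
        proof (cases "cs s = cs u")
          case True
          then show ?thesis by (simp add: F_def)
        next
          case False
          have klim: "(\<lambda>n. k n t) \<longlonglongrightarrow> 1 / (0 + (1 - cos t))" if "0 < 1 - cos t" for t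
            unfolding k_def using that by (intro tendsto_intros d_lim) auto
          show ?thesis
            using klim[OF trace_kernel_angle(2)[OF False]] klim[OF trace_kernel_angle(3)[OF False]]
            by (intro tendsto_intros) auto
        qed
      qed
      show "AE z in angle \<Otimes>\<^sub>M angle. norm (?A n z) \<le> norm (?\<Phi> z)" for n
      proof (rule AE_I2, clarify)
        fix s u
        show "norm ((F s - F u) * (H s - H u) * ((k n (s - u) + k n (s + u)) / 2)) \<le>
            norm ((F s - F u) * (H s - H u) * ((1 / (1 - cos (s - u)) + 1 / (1 - cos (s + u))) / 2))"
        proof (cases "cs s = cs u")
          case True
          then show ?thesis by (simp add: F_def)
        next
          case False
          have kle: "0 \<le> k n t \<and> k n t \<le> 1 / (1 - cos t)" if "0 < 1 - cos t" for t
            unfolding k_def using that d0[of n] dp[of n t] by (auto intro!: divide_left_mono mult_pos_pos simp: less_imp_le)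
          show ?thesis
            using kle[OF trace_kernel_angle(2)[OF False]] kle[OF trace_kernel_angle(3)[OF False]]
            unfolding norm_mult by (intro mult_left_mono) auto
        qed
      qed
    qed measurable
    have bd: "\<bar>integral\<^sup>L (angle \<Otimes>\<^sub>M angle) (?A n)\<bar> \<le> J * ?W" for n
    proof -
      let ?P = "\<lambda>(s, u). F s * ((H u - H s) * (k n (s - u) + k n (s + u)))"
      note P = integral_angle2_second_diff[OF F_measurable F_bound H_cont H_periodic H_even H_bound k(1)[of n] k(2)[of n] k(3)[of n] k(4)[of n]]
      \<comment> \<open>The product \<open>(F s - F u) * (H s - H u)\<close> is minus the sum of
        \<open>F s * (H u - H s)\<close> and the same expression with \<open>s\<close> and
        \<open>u\<close> exchanged. As the kernel is even, exchanging the variables shows that both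
        halves have the same integral.\<close>
      have swap: "integral\<^sup>L (angle \<Otimes>\<^sub>M angle) (\<lambda>(s, u). ?P (u, s)) = integral\<^sup>L (angle \<Otimes>\<^sub>M angle) ?P"
        "integrable (angle \<Otimes>\<^sub>M angle) (\<lambda>(s, u). ?P (u, s))"
        using angle2.integral_product_swap[of ?P] P(2) angle2.integrable_product_swap[of ?P] by (auto simp: split_beta)
      have "?A n z = - ((1/2) * ?P z + (1/2) * (case z of (s, u) \<Rightarrow> ?P (u, s)))" for z
      proof (cases z)
        case (Pair s u)
        have "k n (u - s) = k n (s - u)" using k(3)[of n "s - u"] by simp
        then show ?thesis by (simp add: Pair add.commute field_simps)
      qed
      then have "integral\<^sup>L (angle \<Otimes>\<^sub>M angle) (?A n) =
          (LINT z|(angle \<Otimes>\<^sub>M angle). - ((1/2) * ?P z + (1/2) * (case z of (s, u) \<Rightarrow> ?P (u, s))))"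
        by (intro Bochner_Integration.integral_cong) auto
      also have "\<dots> = - ((1/2) * integral\<^sup>L (angle \<Otimes>\<^sub>M angle) ?P + (1/2) * integral\<^sup>L (angle \<Otimes>\<^sub>M angle) (\<lambda>(s, u). ?P (u, s)))"
        using P(2) swap(2) by (subst Bochner_Integration.integral_minus, subst Bochner_Integration.integral_add)
          (auto intro!: integrable_mult_right simp del: times_divide_eq_left)
      also have "\<dots> = - (LINT s|angle. F s * (LINT u|angle. second_diff H s u * k n u))"
        unfolding swap(1) P(1) by simp
      finally have "\<bar>integral\<^sup>L (angle \<Otimes>\<^sub>M angle) (?A n)\<bar> = \<bar>LINT s|angle. F s * (LINT u|angle. second_diff H s u * k n u)\<bar>"
        by simp
      also have "\<dots> \<le> J * ?W"
        unfolding J_def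
      proof (rule second_diff_bound[OF F_integrable w sd])
        show "\<bar>k n u\<bar> * (1 - cos u) \<le> 1" for u
          unfolding k_def using dp[of n u] d0[of n] by (simp add: abs_of_pos)
      qed auto
      finally show ?thesis .
    qed
    show ?thesis
      using tendsto_upperbound[OF tendsto_rabs[OF lim], of "J * ?W"] bd by auto
  qed
  then show ?thesis
    unfolding Vtr1_eq abs_mult by (simp add: divide_simps)
qed

end

section \<open>The Poisson denominator and the kernel of \<open>Vtr2\<close>\<close>

definition poisson_den :: "real \<Rightarrow> real \<Rightarrow> real" where
  "poisson_den s c = 1 + s\<^sup>2 - 2 * s * c"

text \<open>With \<open>c = cos t\<close> this is the second derivative in \<open>t\<close> of
  \<open>ln (poisson_den s (cos t))\<close>; keeping \<open>c\<close> as the variable turns the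
  estimates into polynomial inequalities. For \<open>s = 1\<close> and \<open>c \<noteq> 1\<close>
  it reduces to \<open>- 1 / (1 - c)\<close>, the kernel of \<open>Vtr1\<close> up to sign.\<close>

definition trace_kernel :: "real \<Rightarrow> real \<Rightarrow> real" where
  "trace_kernel s c = 2 * s * ((1 + s\<^sup>2) * c - 2 * s) / (poisson_den s c)\<^sup>2"

lemma poisson_den_ge:
  assumes "\<bar>c\<bar> \<le> 1"
  shows "(1 - \<bar>s\<bar>)\<^sup>2 \<le> poisson_den s c"
proof -
  have "s * c \<le> \<bar>s\<bar> * \<bar>c\<bar>" by (metis abs_ge_self abs_mult)
  also have "\<dots> \<le> \<bar>s\<bar> * 1" using assms by (intro mult_left_mono) auto
  finally show ?thesis by (simp add: poisson_den_def power2_diff algebra_simps)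
qed

lemma poisson_den_pos:
  assumes "\<bar>c\<bar> \<le> 1" "\<bar>s\<bar> < 1"
  shows "0 < poisson_den s c"
proof -
  have "0 < (1 - \<bar>s\<bar>)\<^sup>2" using assms by simp
  then show ?thesis using poisson_den_ge[OF assms(1), of s] by linarith
qed

text \<open>\<open>poisson_den s c\<close> minus and plus the expression on the left factor as
  \<open>(1 + s) ^ 2 * (1 - c)\<close> and \<open>(1 - s) ^ 2 * (1 + c)\<close>.\<close>

lemma trace_kernel_numerator:
  assumes "\<bar>c\<bar> \<le> 1"
  shows "\<bar>(1 + s\<^sup>2) * c - 2 * s\<bar> \<le> poisson_den s c"
proof -
  have "0 \<le> (1 + s)\<^sup>2 * (1 - c)" "0 \<le> (1 - s)\<^sup>2 * (1 + c)" using assms by auto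
  then show ?thesis
    by (simp add: poisson_den_def abs_le_iff power2_sum power2_diff algebra_simps)
qed

lemma abs_trace_kernel_le:
  assumes "\<bar>c\<bar> \<le> 1" "\<bar>s\<bar> < 1"
  shows "\<bar>trace_kernel s c\<bar> \<le> 2 * \<bar>s\<bar> / poisson_den s c"
proof -
  note p = poisson_den_pos[OF assms]
  have "\<bar>trace_kernel s c\<bar> = 2 * \<bar>s\<bar> * \<bar>(1 + s\<^sup>2) * c - 2 * s\<bar> / (poisson_den s c)\<^sup>2"
    by (simp add: trace_kernel_def abs_mult)
  also have "\<dots> \<le> 2 * \<bar>s\<bar> * poisson_den s c / (poisson_den s c)\<^sup>2"
    using trace_kernel_numerator[OF assms(1)] by (intro divide_right_mono mult_left_mono) auto
  also have "\<dots> = 2 * \<bar>s\<bar> / poisson_den s c" using p by (simp add: power2_eq_square)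
  finally show ?thesis .
qed

lemma trace_kernel_bounded:
  assumes "\<bar>c\<bar> \<le> 1" "\<bar>s\<bar> < 1"
  shows "\<bar>trace_kernel s c\<bar> \<le> 2 / (1 - \<bar>s\<bar>)\<^sup>2"
proof -
  have "2 * \<bar>s\<bar> / poisson_den s c \<le> 2 / (1 - \<bar>s\<bar>)\<^sup>2"
    using assms poisson_den_ge[OF assms(1), of s] by (intro frac_le) auto
  then show ?thesis using abs_trace_kernel_le[OF assms] by linarith
qed

text \<open>Since \<open>poisson_den s c = (1 - s) ^ 2 + 2 * s * (1 - c)\<close>, for nonnegative
  \<open>s\<close> the second summand alone suffices, uniformly up to \<open>s = 1\<close>. For
  negative \<open>s\<close> the denominator is smallest at \<open>c = - 1\<close>, where the factor
  \<open>1 - c\<close> gives no help.\<close>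

lemma trace_kernel_bound:
  assumes "\<bar>c\<bar> \<le> 1" "0 \<le> s" "s < 1"
  shows "\<bar>trace_kernel s c\<bar> * (1 - c) \<le> 1"
proof -
  have s: "\<bar>s\<bar> < 1" using assms by simp
  note p = poisson_den_pos[OF assms(1) s]
  have "\<bar>trace_kernel s c\<bar> * (1 - c) \<le> 2 * s / poisson_den s c * (1 - c)"
    using abs_trace_kernel_le[OF assms(1) s] assms by (intro mult_right_mono) auto
  also have "\<dots> = 2 * s * (1 - c) / poisson_den s c" by simp
  also have "\<dots> \<le> 1"
  proof -
    have "poisson_den s c = (1 - s)\<^sup>2 + 2 * s * (1 - c)"
      by (simp add: poisson_den_def power2_diff algebra_simps)
    then have "2 * s * (1 - c) \<le> poisson_den s c" by simp
    then show ?thesis using p by simp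
  qed
  finally show ?thesis .
qed

lemma trace_kernel_measurable [measurable]: "trace_kernel s \<in> borel_measurable borel"
  unfolding trace_kernel_def poisson_den_def by measurable

lemma trace_kernel_continuous:
  assumes "\<bar>s\<bar> < 1"
  shows "continuous_on UNIV (\<lambda>t. trace_kernel s (cos t))"
proof -
  have "poisson_den s (cos t) \<noteq> 0" for t using poisson_den_pos[of "cos t" s] assms by simp
  then show ?thesis
    unfolding trace_kernel_def poisson_den_def by (intro continuous_intros) auto
qed

section \<open>Mixed derivatives of the logarithm in \<open>Vtr2_interior\<close>\<close>

definition log_poisson' :: "real \<Rightarrow> real \<Rightarrow> real" where
  "log_poisson' s t = 2 * s * sin t / poisson_den s (cos t)"

lemma DERIV_log_poisson:
  assumes "\<bar>s\<bar> < 1"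
  shows "((\<lambda>t. ln (poisson_den s (cos t))) has_real_derivative log_poisson' s t) (at t)"
  using poisson_den_pos[of "cos t" s] assms unfolding poisson_den_def log_poisson'_def
  by (auto intro!: derivative_eq_intros)

lemma DERIV_log_poisson':
  assumes "\<bar>s\<bar> < 1"
  shows "(log_poisson' s has_real_derivative trace_kernel s (cos t)) (at t)"
proof -
  have p: "poisson_den s (cos t) \<noteq> 0" using poisson_den_pos[of "cos t" s] assms by simp
  have eq: "2 * s * cos t * poisson_den s (cos t) - 2 * s * sin t * (2 * s * sin t) = 2 * s * ((1 + s\<^sup>2) * cos t - 2 * s)"
  proof -
    have "sin t * sin t = 1 - cos t * cos t"
      using sin_squared_eq[of t] by (simp add: power2_eq_square)
    moreover have "2 * s * sin t * (2 * s * sin t) = 4 * s * s * (sin t * sin t)" by simp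
    ultimately have "2 * s * sin t * (2 * s * sin t) = 4 * s * s * (1 - cos t * cos t)" by simp
    then show ?thesis by (simp add: poisson_den_def power2_eq_square algebra_simps)
  qed
  have "((\<lambda>t. 2 * s * sin t / poisson_den s (cos t)) has_real_derivative
      (2 * s * cos t * poisson_den s (cos t) - 2 * s * sin t * (2 * s * sin t)) / (poisson_den s (cos t))\<^sup>2) (at t)"
    using p unfolding poisson_den_def
    by (auto intro!: derivative_eq_intros simp: power2_eq_square)
  then show ?thesis
    unfolding eq log_poisson'_def[abs_def] trace_kernel_def .
qed

text \<open>The primitive \<open>log_poisson' s\<close> carries a factor \<open>sin t\<close> and so
  vanishes at both ends. Mean zero is what turns \<open>H (a + u) + H (a - u)\<close> into a second
  difference at no cost.\<close>

lemma integral_trace_kernel: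
  assumes "\<bar>s\<bar> < 1"
  shows "(LINT t|angle. trace_kernel s (cos t)) = 0"
proof -
  have "(LINT t|lborel. trace_kernel s (cos t) * indicator {0..pi} t) = log_poisson' s pi - log_poisson' s 0"
  proof (rule integral_FTC_Icc_real)
    show "isCont (\<lambda>t. trace_kernel s (cos t)) x" for x
      using trace_kernel_continuous[OF assms] by (simp add: continuous_on_eq_continuous_at)
  qed (auto intro: DERIV_log_poisson'[OF assms])
  then show ?thesis
    by (simp add: integral_angle mult.commute log_poisson'_def)
qed

text \<open>Up to the common factor \<open>4\<close>, the two arguments of the logarithm are
  \<open>\<bar>1 - s * exp (\<i> * (a \<plusminus> b))\<bar>\<^sup>2\<close>.\<close>

lemma log_ratio_cs:
  assumes "s\<in>{-1<..<1}" "a \<in> {0..pi}" "b \<in> {0..pi}"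
  shows "log_ratio s (cs a) (cs b) = ln (poisson_den s (cos (a + b))) - ln (poisson_den s (cos (a - b)))"
proof -
  have sq: "sqrt (4 - (cs a)\<^sup>2) = 2 * sin a" "sqrt (4 - (cs b)\<^sup>2) = 2 * sin b"
    unfolding sqrt_4_cs using assms sin_ge_zero by (auto simp: abs_of_nonneg)
  have t: "(sin a)\<^sup>2 = 1 - (cos a)\<^sup>2" "(sin b)\<^sup>2 = 1 - (cos b)\<^sup>2" by (simp_all add: sin_squared_eq)
  have poly1: "(- 2 * c - s * (- 2 * d))\<^sup>2 + (2 * p + s * (2 * q))\<^sup>2 =
      4 * (c\<^sup>2 + p\<^sup>2 + s\<^sup>2 * (d\<^sup>2 + q\<^sup>2) - 2 * s * (c * d - p * q))"
    and poly2: "(- 2 * c - s * (- 2 * d))\<^sup>2 + (2 * p - s * (2 * q))\<^sup>2 =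
      4 * (c\<^sup>2 + p\<^sup>2 + s\<^sup>2 * (d\<^sup>2 + q\<^sup>2) - 2 * s * (c * d + p * q))" for c d p q :: real
    by (simp_all add: power2_eq_square algebra_simps)
  have 1: "(cs a - s * cs b)\<^sup>2 + (2 * sin a + s * (2 * sin b))\<^sup>2 = 4 * poisson_den s (cos (a + b))"
  proof -
    have "(cs a - s * cs b)\<^sup>2 + (2 * sin a + s * (2 * sin b))\<^sup>2 =
        4 * ((cos a)\<^sup>2 + (sin a)\<^sup>2 + s\<^sup>2 * ((cos b)\<^sup>2 + (sin b)\<^sup>2) - 2 * s * (cos a * cos b - sin a * sin b))"
      unfolding cs_def by (rule poly1)
    then show ?thesis by (simp only: sin_cos_squared_add2 cos_add poisson_den_def mult_1_right)
  qed
  have 2: "(cs a - s * cs b)\<^sup>2 + (2 * sin a - s * (2 * sin b))\<^sup>2 = 4 * poisson_den s (cos (a - b))"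
  proof -
    have "(cs a - s * cs b)\<^sup>2 + (2 * sin a - s * (2 * sin b))\<^sup>2 =
        4 * ((cos a)\<^sup>2 + (sin a)\<^sup>2 + s\<^sup>2 * ((cos b)\<^sup>2 + (sin b)\<^sup>2) - 2 * s * (cos a * cos b + sin a * sin b))"
      unfolding cs_def by (rule poly2)
    then show ?thesis by (simp only: sin_cos_squared_add2 cos_diff poisson_den_def mult_1_right)
  qed
  have "0 < poisson_den s (cos (a + b))" "0 < poisson_den s (cos (a - b))"
    using assms by (auto intro!: poisson_den_pos)
  then show ?thesis
    unfolding log_ratio_def sq 1 2 by (simp add: ln_div)
qed

text \<open>Inverse of \<open>cs\<close> on \<open>{-2..2}\<close>. The derivatives in
  \<open>Vtr2_interior\<close> are taken in \<open>x\<close> and \<open>y\<close>, so the angle is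
  needed as a function of them.\<close>

definition al :: "real \<Rightarrow> real" where "al x = arccos (- x / 2)"

lemma al:
  assumes "- 2 \<le> x" "x \<le> 2"
  shows "al x \<in> {0..pi}" "cs (al x) = x" "2 * sin (al x) = sqrt (4 - x\<^sup>2)"
proof -
  show a: "al x \<in> {0..pi}" and b: "cs (al x) = x"
    using assms by (auto simp: al_def cs_def arccos_lbound arccos_ubound)
  show "2 * sin (al x) = sqrt (4 - x\<^sup>2)"
    using sqrt_4_cs[of "al x"] a by (simp add: b sin_ge_zero)
qed

lemma al_interior:
  assumes "- 2 < x" "x < 2"
  shows "0 < al x" "al x < pi" "(al has_real_derivative 1 / sqrt (4 - x\<^sup>2)) (at x)"
proof -
  show "0 < al x" "al x < pi" using assms unfolding al_def by (auto intro!: arccos_lt_bounded[THEN conjunct1] arccos_lt_bounded[THEN conjunct2])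
  have "(al has_real_derivative inverse (- sqrt (1 - (- x / 2)\<^sup>2)) * (- 1 / 2)) (at x)"
    unfolding al_def[abs_def] using assms
    by (intro DERIV_chain2[where f=arccos] DERIV_arccos) (auto intro!: derivative_eq_intros)
  also have "inverse (- sqrt (1 - (- x / 2)\<^sup>2)) * (- 1 / 2) = 1 / sqrt (4 - x\<^sup>2)"
  proof -
    have "sqrt (4 - x\<^sup>2) = sqrt (4 * (1 - (- x / 2)\<^sup>2))" by (simp add: power2_eq_square algebra_simps)
    also have "\<dots> = 2 * sqrt (1 - (- x / 2)\<^sup>2)" by (subst real_sqrt_mult) simp
    finally show ?thesis by (simp add: field_simps)
  qed
  finally show "(al has_real_derivative 1 / sqrt (4 - x\<^sup>2)) (at x)" .
qed

lemma deriv_log_ratio_interior: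
  assumes s: "s \<in> {-1<..<1}" and x: "x \<in> {-2..2}" and y: "y \<in> {-2<..<2}"
  shows "deriv (\<lambda>v. log_ratio s x v) y = (log_poisson' s (al x + al y) + log_poisson' s (al x - al y)) / sqrt (4 - y\<^sup>2)"
proof (rule DERIV_imp_deriv)
  have s': "\<bar>s\<bar> < 1" using s by auto
  have "((\<lambda>v. ln (poisson_den s (cos (al x + al v))) - ln (poisson_den s (cos (al x - al v)))) has_real_derivative
      log_poisson' s (al x + al y) * (0 + 1 / sqrt (4 - y\<^sup>2)) - log_poisson' s (al x - al y) * (0 - 1 / sqrt (4 - y\<^sup>2))) (at y)"
    using al_interior(3)[of y] y
    by (intro DERIV_diff DERIV_chain2[OF DERIV_log_poisson[OF s']] DERIV_add DERIV_const) auto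
  then have "((\<lambda>v. ln (poisson_den s (cos (al x + al v))) - ln (poisson_den s (cos (al x - al v)))) has_real_derivative
      (log_poisson' s (al x + al y) + log_poisson' s (al x - al y)) / sqrt (4 - y\<^sup>2)) (at y)"
    by (simp add: add_divide_distrib)
  then show "((\<lambda>v. log_ratio s x v) has_real_derivative
      (log_poisson' s (al x + al y) + log_poisson' s (al x - al y)) / sqrt (4 - y\<^sup>2)) (at y)"
  proof (rule has_field_derivative_transform_within_open)
    show "open {-2<..<2::real}" "y \<in> {-2<..<2}" using y by auto
    fix v :: real assume "v \<in> {-2<..<2}"
    then show "ln (poisson_den s (cos (al x + al v))) - ln (poisson_den s (cos (al x - al v))) = log_ratio s x v"
      using log_ratio_cs[OF s, of "al x" "al v"] al[of x] al[of v] x by simp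
  qed
qed

text \<open>The chain rule produces exactly the two square roots of the arcsine densities, so that
  after the substitution only the kernel remains.\<close>

lemma deriv2_log_ratio_interior:
  assumes s: "s \<in> {-1<..<1}" and x: "x \<in> {-2<..<2}" and y: "y \<in> {-2<..<2}"
  shows "deriv (\<lambda>u. deriv (\<lambda>v. log_ratio s u v) y) x =
    (trace_kernel s (cos (al x + al y)) + trace_kernel s (cos (al x - al y))) / (sqrt (4 - x\<^sup>2) * sqrt (4 - y\<^sup>2))"
proof (rule DERIV_imp_deriv)
  have s': "\<bar>s\<bar> < 1" using s by auto
  have "((\<lambda>u. (log_poisson' s (al u + al y) + log_poisson' s (al u - al y)) / sqrt (4 - y\<^sup>2)) has_real_derivative
      (trace_kernel s (cos (al x + al y)) * (1 / sqrt (4 - x\<^sup>2) + 0) + trace_kernel s (cos (al x - al y)) * (1 / sqrt (4 - x\<^sup>2) - 0)) / sqrt (4 - y\<^sup>2)) (at x)"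
    using al_interior(3)[of x] x
    by (intro DERIV_cdivide DERIV_diff DERIV_chain2[OF DERIV_log_poisson'[OF s']] DERIV_add DERIV_const) auto
  then have "((\<lambda>u. (log_poisson' s (al u + al y) + log_poisson' s (al u - al y)) / sqrt (4 - y\<^sup>2)) has_real_derivative
      (trace_kernel s (cos (al x + al y)) + trace_kernel s (cos (al x - al y))) / (sqrt (4 - x\<^sup>2) * sqrt (4 - y\<^sup>2))) (at x)"
    by (simp add: add_divide_distrib)
  then show "((\<lambda>u. deriv (\<lambda>v. log_ratio s u v) y) has_real_derivative
    (trace_kernel s (cos (al x + al y)) + trace_kernel s (cos (al x - al y))) / (sqrt (4 - x\<^sup>2) * sqrt (4 - y\<^sup>2))) (at x)"
  proof (rule has_field_derivative_transform_within_open)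
    show "open {-2<..<2::real}" "x \<in> {-2<..<2}" using x by auto
  qed (use deriv_log_ratio_interior[OF s _ y] in auto)
qed

text \<open>At \<open>\<bar>y\<bar> = 2\<close> the inner \<^const>\<open>deriv\<close> in \<^const>\<open>Vtr2_interior\<close> is an unspecified value which,
  by non-differentiability, does not depend on \<open>u\<close>; hence the outer one vanishes.\<close>

lemma log_ratio_not_differentiable_edge:
  assumes s: "s \<in> {-1<..<1}" "s \<noteq> 0" and u: "u \<in> {-2<..<2}" and y: "y \<in> {-2, 2}"
  shows "\<not> ((\<lambda>v. log_ratio s u v) has_real_derivative D) (at y)"
proof
  assume D: "((\<lambda>v. log_ratio s u v) has_real_derivative D) (at y)"
  have s': "\<bar>s\<bar> < 1" using s by auto
  define b where "b = (if y = 2 then pi else 0)"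
  have b: "b \<in> {0..pi}" "cs b = y" "sin b = 0" using y by (auto simp: b_def cs_def)
  let ?a = "al u"
  have a: "?a \<in> {0..pi}" "cs ?a = u" using al[of u] u by auto
  \<comment> \<open>As \<open>cs\<close> is stationary at \<open>b\<close>, differentiability in
    \<open>v\<close> would make the derivative in the angle vanish. Computed directly it is
    \<open>2 * log_poisson' s (?a + b)\<close>, a nonzero multiple of \<open>sin ?a\<close>. The
    comparison is one-sided because the formula for \<open>log_ratio\<close> is available on
    \<open>{0..pi}\<close>.\<close>
  have "(cs has_real_derivative 2 * sin b) (at b)" unfolding cs_def by (auto intro!: derivative_eq_intros)
  then have "(cs has_real_derivative 0) (at b within {0..pi})" using b(3) by (simp add: has_field_derivative_at_within)
  then have "((\<lambda>t. log_ratio s u (cs t)) has_real_derivative D * 0) (at b within {0..pi})"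
    using D b(2) by (intro DERIV_chain2[where f="log_ratio s u"]) auto
  then have 1: "((\<lambda>t. log_ratio s u (cs t)) has_vector_derivative 0) (at b within cbox 0 pi)"
    by (simp add: has_real_derivative_iff_has_vector_derivative)
  have "((\<lambda>t. ln (poisson_den s (cos (?a + t))) - ln (poisson_den s (cos (?a - t)))) has_real_derivative
      log_poisson' s (?a + b) * (0 + 1) - log_poisson' s (?a - b) * (0 - 1)) (at b)"
    by (intro DERIV_diff DERIV_chain2[OF DERIV_log_poisson[OF s']] DERIV_add DERIV_const DERIV_ident)
  then have "((\<lambda>t. ln (poisson_den s (cos (?a + t))) - ln (poisson_den s (cos (?a - t)))) has_real_derivative
      log_poisson' s (?a + b) + log_poisson' s (?a - b)) (at b within {0..pi})"
    by (simp add: has_field_derivative_at_within)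
  then have "((\<lambda>t. log_ratio s u (cs t)) has_real_derivative
      log_poisson' s (?a + b) + log_poisson' s (?a - b)) (at b within {0..pi})"
    by (rule has_field_derivative_transform_within[where d=1])
       (use b(1) log_ratio_cs[OF s(1) a(1)] a(2) in auto)
  then have 2: "((\<lambda>t. log_ratio s u (cs t)) has_vector_derivative
      log_poisson' s (?a + b) + log_poisson' s (?a - b)) (at b within cbox 0 pi)"
    by (simp add: has_real_derivative_iff_has_vector_derivative)
  have "log_poisson' s (?a + b) + log_poisson' s (?a - b) = 0"
    by (rule vector_derivative_unique_within_closed_interval[OF _ _ 2 1]) (use b in auto)
  moreover have "sin (?a + b) = (if y = 2 then - sin ?a else sin ?a)" "sin (?a - b) = (if y = 2 then - sin ?a else sin ?a)"
    "cos (?a + b) = cos (?a - b)"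
    by (auto simp: b_def sin_diff cos_diff)
  ultimately have "log_poisson' s (?a + b) = 0" by (simp add: log_poisson'_def)
  then have "sin ?a = 0"
    using s(2) poisson_den_pos[of "cos (?a + b)" s] s' \<open>sin (?a + b) = _\<close> by (auto simp: log_poisson'_def split: if_splits)
  then show False using al_interior[of u] u sin_gt_zero[of ?a] by auto
qed

lemma deriv2_log_ratio_edge:
  assumes s: "s \<in> {-1<..<1}" and x: "x \<in> {-2<..<2}" and y: "y \<in> {-2, 2}"
  shows "deriv (\<lambda>u. deriv (\<lambda>v. log_ratio s u v) y) x = 0"
proof (cases "s = 0")
  case True
  have "log_ratio s u v = 0" for u v
  proof -
    have "0 < u\<^sup>2 + (sqrt (4 - u\<^sup>2))\<^sup>2"
      by (cases "u = 0") (auto intro: add_pos_nonneg)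
    then show ?thesis by (simp add: log_ratio_def True)
  qed
  then show ?thesis by simp
next
  case False
  have "((\<lambda>u. deriv (\<lambda>v. log_ratio s u v) y) has_real_derivative 0) (at x)"
  proof (rule has_field_derivative_transform_within_open)
    show "((\<lambda>u. SOME D::real. False) has_real_derivative 0) (at x)" by simp
    show "open {-2<..<2::real}" "x \<in> {-2<..<2}" using x by auto
    fix u :: real assume u: "u \<in> {-2<..<2}"
    show "(SOME D::real. False) = deriv (\<lambda>v. log_ratio s u v) y"
      unfolding deriv_def using log_ratio_not_differentiable_edge[OF s False u y] by simp
  qed
  then show ?thesis by (rule DERIV_imp_deriv)
qed

section \<open>Reflection of the second function and bounds for \<open>Vtr2\<close>\<close>

lemma integral_angle_reflect:
  fixes g :: "real \<Rightarrow> real"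
  assumes "continuous_on UNIV g"
  shows "(LINT u|angle. g (pi - u)) = (LINT u|angle. g u)"
proof -
  have "(LINT u|angle. g (pi - u)) = integral {0..pi} (\<lambda>u. g (pi - u))"
    by (intro integral_angle_continuous continuous_on_compose2[OF assms] continuous_intros) auto
  also have "\<dots> = integral {- pi..0} (\<lambda>x. g (- x))"
    using integral_shift_real_ivl[of "- pi" "- pi" 0 "\<lambda>x. g (- x)"] by simp
  also have "\<dots> = integral {0..pi} g"
  proof -
    have "integral {- pi..- 0} (\<lambda>x. g (- x)) = integral {0..pi} g"
      by (rule Henstock_Kurzweil_Integration.integral_reflect_real)
    then show ?thesis by (simp only: minus_zero)
  qed
  also have "\<dots> = (LINT u|angle. g u)" using assms by (rule integral_angle_continuous[symmetric])
  finally show ?thesis .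
qed

text \<open>Negation carries the left neighbourhoods of \<open>1\<close> to the right neighbourhoods
  of \<open>- 1\<close>. The existence of \<open>L\<close> makes both uses of \<open>Lim\<close>
  genuine limits.\<close>

lemma extend_to_endpoints_reflect:
  assumes L: "(W \<longlongrightarrow> L) (at_left 1)" and eq: "\<And>t. t \<in> {0<..<1} \<Longrightarrow> V (- t) = W t"
  shows "extend_to_endpoints V (- 1) = extend_to_endpoints W 1"
proof -
  have "eventually (\<lambda>t. t \<in> {0<..<1::real}) (at_left 1)"
    by (rule eventually_at_leftI[of 0]) auto
  then have "eventually (\<lambda>t. W t = V (- t)) (at_left 1)"
    by eventually_elim (simp add: eq)
  then have "((\<lambda>t. V (- t)) \<longlongrightarrow> L) (at_left 1)"
    by (rule Lim_transform_eventually[OF L])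
  then have "(V \<longlongrightarrow> L) (at_right (- 1))"
    by (simp add: at_right_minus[of "- 1"] filterlim_filtermap)
  then have "Lim (at_right (-1)) V = L" by (intro tendsto_Lim) auto
  moreover have "Lim (at_left 1) W = L" using L by (intro tendsto_Lim) auto
  ultimately show ?thesis by (simp add: extend_to_endpoints_def)
qed

text \<open>Expresses the kernel in \<open>x\<close> and \<open>y\<close> without
  \<open>arccos\<close>, which gives \<open>integral_arc2\<close> an integrand that is measurable by
  inspection.\<close>

lemma cos_al_add:
  assumes "x \<in> {-2..2}" "y \<in> {-2..2}"
  shows "cos (al x + al y) = (x * y - sqrt (4 - x\<^sup>2) * sqrt (4 - y\<^sup>2)) / 4"
    and "cos (al x - al y) = (x * y + sqrt (4 - x\<^sup>2) * sqrt (4 - y\<^sup>2)) / 4"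
proof -
  have "cos (al x) = - x / 2" "cos (al y) = - y / 2"
    using al(2)[of x] al(2)[of y] assms by (auto simp: cs_def)
  moreover have "sin (al x) = sqrt (4 - x\<^sup>2) / 2" "sin (al y) = sqrt (4 - y\<^sup>2) / 2"
    using al(3)[of x] al(3)[of y] assms by auto
  ultimately show "cos (al x + al y) = (x * y - sqrt (4 - x\<^sup>2) * sqrt (4 - y\<^sup>2)) / 4"
    "cos (al x - al y) = (x * y + sqrt (4 - x\<^sup>2) * sqrt (4 - y\<^sup>2)) / 4"
    by (simp_all only: cos_add cos_diff) (simp_all add: field_simps)
qed

context test_functions
begin

lemma reflected: "test_functions f (\<lambda>y. h (- y)) f0 (\<lambda>y. h0 (- y)) bf bh"
proof
  show "AE x in lborel. h (- x) = h0 (- x)"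
  proof -
    have "AE x in distr lborel borel uminus. h x = h0 x"
      unfolding lborel_distr_uminus using h_AE .
    then show ?thesis by (rule AE_distrD[rotated]) simp
  qed
  show "continuous_on UNIV (\<lambda>y. h0 (- y))"
    by (intro continuous_on_compose2[OF h0_cont] continuous_intros) auto
qed (use f_AE f0_cont f0_bound h0_bound in auto)

text \<open>On the lines \<open>\<bar>x\<bar> = 2\<close> the outer \<^const>\<open>deriv\<close> has no useful value, so \<open>f\<close> has to vanish there.\<close>

lemma Vtr2_interior_eq:
  assumes s: "s \<in> {-1<..<1}" and edge: "f 2 = 0" "f (-2) = 0"
  shows "Vtr2_interior f h s = 1 / (4 * pi\<^sup>2) *
    (LINT a|angle. F a * (LINT u|angle. (H (a + u) + H (a - u)) * trace_kernel s (cos u)))"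
proof -
  have s': "\<bar>s\<bar> < 1" using s by auto
  define \<Phi> where "\<Phi> x y = f x * h y * (trace_kernel s ((x * y + sqrt (4 - x\<^sup>2) * sqrt (4 - y\<^sup>2)) / 4) +
      trace_kernel s ((x * y - sqrt (4 - x\<^sup>2) * sqrt (4 - y\<^sup>2)) / 4))" for x y
  have \<Phi>m: "case_prod \<Phi> \<in> borel_measurable (borel \<Otimes>\<^sub>M borel)" unfolding \<Phi>_def by measurable
  let ?k = "\<lambda>t. trace_kernel s (cos t)"
  have "(LINT (x, y):{-2..2} \<times> {-2..2}|lborel. f x * h y * deriv (\<lambda>u. deriv (\<lambda>v. log_ratio s u v) y) x) =
      (LINT (x, y):{-2..2} \<times> {-2..2}|lborel. \<Phi> x y / (sqrt (4 - x\<^sup>2) * sqrt (4 - y\<^sup>2)))"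
  proof (rule set_lebesgue_integral_cong)
    show "{-2..2} \<times> {-2..2} \<in> sets (lborel :: (real \<times> real) measure)"
      unfolding sets_lborel by (intro borel_closed closed_Times closed_atLeastAtMost)
    have "f x * h y * deriv (\<lambda>u. deriv (\<lambda>v. log_ratio s u v) y) x = \<Phi> x y / (sqrt (4 - x\<^sup>2) * sqrt (4 - y\<^sup>2))"
      if x: "x \<in> {-2..2}" and y: "y \<in> {-2..2}" for x y
    proof -
      have "x \<in> {-2, 2} \<or> x \<in> {-2<..<2}" "y \<in> {-2, 2} \<or> y \<in> {-2<..<2}" using x y by auto
      then consider "x \<in> {-2, 2}" | "x \<in> {-2<..<2}" "y \<in> {-2, 2}" | "x \<in> {-2<..<2}" "y \<in> {-2<..<2}"
        by blast
      then show ?thesis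
      proof cases
        case 1
        then show ?thesis using edge by (auto simp: \<Phi>_def)
      next
        \<comment> \<open>The outer derivative is zero, and so is the other side, as a quotient with
          denominator \<open>0\<close>.\<close>
        case 2
        have "y\<^sup>2 = 4" using 2(2) by auto
        then show ?thesis unfolding deriv2_log_ratio_edge[OF s 2] by simp
      next
        case 3
        show ?thesis
          unfolding deriv2_log_ratio_interior[OF s 3] cos_al_add[OF x y] \<Phi>_def by (simp add: add.commute)
      qed
    qed
    then show "\<forall>z. z \<in> {-2..2} \<times> {-2..2} \<longrightarrow>
        (case z of (x, y) \<Rightarrow> f x * h y * deriv (\<lambda>u. deriv (\<lambda>v. log_ratio s u v) y) x) =
        (case z of (x, y) \<Rightarrow> \<Phi> x y / (sqrt (4 - x\<^sup>2) * sqrt (4 - y\<^sup>2)))"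
      by auto
  qed
  also have "\<dots> = (LINT (a, u)|(angle \<Otimes>\<^sub>M angle). \<Phi> (cs a) (cs u))"
    by (rule integral_arc2) (use \<Phi>m in \<open>simp add: borel_prod\<close>)
  also have "\<dots> = (LINT (a, u)|(angle \<Otimes>\<^sub>M angle). F a * (H u * (?k (a - u) + 1 * ?k (a + u))))"
  proof (rule integral_cong_AE)
    have *: "\<Phi> (cs a) (cs u) = F a * (H u * (?k (a - u) + 1 * ?k (a + u)))"
      if "f (cs a) = F a \<and> a \<in> {0..pi}" "h (cs u) = H u \<and> u \<in> {0..pi}" for a u
    proof -
      have "\<bar>sin a\<bar> = sin a" "\<bar>sin u\<bar> = sin u" using that sin_ge_zero by auto
      then have "(cs a * cs u + sqrt (4 - (cs a)\<^sup>2) * sqrt (4 - (cs u)\<^sup>2)) / 4 = cos (a - u)"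
        "(cs a * cs u - sqrt (4 - (cs a)\<^sup>2) * sqrt (4 - (cs u)\<^sup>2)) / 4 = cos (a + u)"
        unfolding sqrt_4_cs by (simp_all add: cs_def cos_add cos_diff)
      then show ?thesis using that unfolding \<Phi>_def by simp
    qed
    have "AE t in angle. f (cs t) = F t \<and> t \<in> {0..pi}" "AE t in angle. h (cs t) = H t \<and> t \<in> {0..pi}"
      using F_AE H_AE AE_angle by (auto elim: eventually_elim2)
    from AE_angle2[OF this]
    show "AE z in angle \<Otimes>\<^sub>M angle. (case z of (a, u) \<Rightarrow> \<Phi> (cs a) (cs u)) =
        (case z of (a, u) \<Rightarrow> F a * (H u * (?k (a - u) + 1 * ?k (a + u))))"
    proof eventually_elim
      case (elim z)
      then show ?case using *[of "fst z" "snd z"] unfolding case_prod_beta by blast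
    qed
    show "(\<lambda>(a, u). \<Phi> (cs a) (cs u)) \<in> borel_measurable (angle \<Otimes>\<^sub>M angle)" unfolding \<Phi>_def by measurable
  qed measurable
  also have "\<dots> = (LINT a|angle. F a * (LINT u|angle. (H (a + u) + H (a - u)) * ?k u))"
    by (rule integral_angle2_convolution(1)[where bk="2 / (1 - \<bar>s\<bar>)\<^sup>2", OF F_measurable F_bound H_cont H_periodic _ H_bound trace_kernel_continuous[OF s']])
       (use H_even trace_kernel_bounded[OF _ s'] in auto)
  finally show ?thesis unfolding Vtr2_interior_def by simp
qed

text \<open>The substitution of \<open>pi - u\<close> for \<open>u\<close> changes the sign of
  \<open>cos u\<close>, which the sign of \<open>s\<close> absorbs, and shifts \<open>H\<close> by
  half a period, which is the reflection of \<open>h\<close>.\<close>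

lemma Vtr2_interior_reflect:
  assumes s: "s \<in> {-1<..<1}" and edge: "f 2 = 0" "f (-2) = 0"
  shows "Vtr2_interior f h (- s) = Vtr2_interior f (\<lambda>y. h (- y)) s"
proof -
  interpret R: test_functions f "\<lambda>y. h (- y)" f0 "\<lambda>y. h0 (- y)" bf bh by (rule reflected)
  have RH: "R.H t = H (t + pi)" "R.H t = H (t - pi)" for t
    by (simp_all add: R.H_def H_def cs_def)
  have tk: "trace_kernel (- s) (- c) = trace_kernel s c" for c
  proof -
    have "2 * - s * ((1 + (- s)\<^sup>2) * - c - 2 * - s) = 2 * s * ((1 + s\<^sup>2) * c - 2 * s)"
      by (simp add: algebra_simps)
    moreover have "poisson_den (- s) (- c) = poisson_den s c" by (simp add: poisson_den_def)
    ultimately show ?thesis unfolding trace_kernel_def by (simp only:)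
  qed
  have s2: "\<bar>- s\<bar> < 1" using s by auto
  have "(LINT u|angle. (H (a + u) + H (a - u)) * trace_kernel (- s) (cos u)) =
      (LINT u|angle. (R.H (a + u) + R.H (a - u)) * trace_kernel s (cos u))" for a
  proof -
    have "(LINT u|angle. (H (a + u) + H (a - u)) * trace_kernel (- s) (cos u)) =
        (LINT u|angle. (H (a + (pi - u)) + H (a - (pi - u))) * trace_kernel (- s) (cos (pi - u)))"
      by (rule integral_angle_reflect[symmetric])
         (intro continuous_intros trace_kernel_continuous[OF s2] continuous_on_compose2[OF H_cont[of UNIV]]; simp)
    also have "\<dots> = (LINT u|angle. (R.H (a - u) + R.H (a + u)) * trace_kernel s (cos u))"
    proof (rule Bochner_Integration.integral_cong)
      fix u
      have "H (a + (pi - u)) = R.H (a - u)" unfolding RH(1) by (simp add: algebra_simps)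
      moreover have "H (a - (pi - u)) = R.H (a + u)" unfolding RH(2) by (simp add: algebra_simps)
      moreover have "trace_kernel (- s) (cos (pi - u)) = trace_kernel s (cos u)" by (simp add: tk)
      ultimately show "(H (a + (pi - u)) + H (a - (pi - u))) * trace_kernel (- s) (cos (pi - u)) =
          (R.H (a - u) + R.H (a + u)) * trace_kernel s (cos u)" by (simp only:)
    qed simp
    finally show ?thesis by (simp add: add.commute)
  qed
  moreover have "- s \<in> {-1<..<1}" using s by auto
  ultimately show ?thesis
    using Vtr2_interior_eq[OF _ edge, of "- s"] R.Vtr2_interior_eq[OF s edge] by (simp only:)
qed

lemma Vtr2_interior_second_diff:
  assumes s: "s \<in> {-1<..<1}" and edge: "f 2 = 0" "f (-2) = 0"
  shows "Vtr2_interior f h s = 1 / (4 * pi\<^sup>2) *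
    (LINT a|angle. F a * (LINT u|angle. second_diff H a u * trace_kernel s (cos u)))"
proof -
  have s': "\<bar>s\<bar> < 1" using s by auto
  let ?k = "\<lambda>t. trace_kernel s (cos t)"
  have [measurable]: "?k \<in> borel_measurable borel" by measurable
  have kb: "\<bar>?k t\<bar> \<le> 2 / (1 - \<bar>s\<bar>)\<^sup>2" for t using trace_kernel_bounded[OF _ s'] by simp
  have "(LINT u|angle. second_diff H a u * ?k u) = (LINT u|angle. (H (a + u) + H (a - u)) * ?k u)" for a
  proof -
    have i1: "integrable angle (\<lambda>u. (H (a + u) + H (a - u)) * ?k u)"
    proof (rule integrable_angle_bounded)
      show "\<bar>(H (a + u) + H (a - u)) * ?k u\<bar> \<le> (bh + bh) * (2 / (1 - \<bar>s\<bar>)\<^sup>2)" for u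
        unfolding abs_mult using H_bound bounds_nonneg kb
        by (intro mult_mono order.trans[OF abs_triangle_ineq] add_mono) auto
    qed measurable
    have i2: "integrable angle (\<lambda>u. 2 * H a * ?k u)"
      by (intro integrable_mult_right integrable_angle_bounded[OF _ kb]) measurable
    have "(LINT u|angle. second_diff H a u * ?k u) = (LINT u|angle. (H (a + u) + H (a - u)) * ?k u - 2 * H a * ?k u)"
      by (intro Bochner_Integration.integral_cong) (auto simp: second_diff_def algebra_simps)
    also have "\<dots> = (LINT u|angle. (H (a + u) + H (a - u)) * ?k u) - 2 * H a * (LINT u|angle. ?k u)"
      using i1 i2 by (subst Bochner_Integration.integral_diff) auto
    finally show ?thesis using integral_trace_kernel[OF s'] by simp
  qed
  then show ?thesis unfolding Vtr2_interior_eq[OF assms] by simp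
qed

context
  fixes w :: "real \<Rightarrow> real"
  assumes w: "integrable angle w" "\<And>u. 0 \<le> w u"
    and sd: "\<And>s u. u \<in> {0..pi} \<Longrightarrow> \<bar>second_diff H s u\<bar> \<le> w u * (1 - cos u)"
    and edge: "f 2 = 0" "f (-2) = 0"
begin

lemma Vtr2_interior_bound:
  assumes s: "0 \<le> s" "s < 1"
  shows "\<bar>Vtr2_interior f h s\<bar> \<le> J * (LINT u|angle. w u) / (4 * pi\<^sup>2)"
proof -
  have "\<bar>LINT a|angle. F a * (LINT u|angle. second_diff H a u * trace_kernel s (cos u))\<bar> \<le> J * (LINT u|angle. w u)"
    unfolding J_def by (rule second_diff_bound[OF F_integrable w sd]) (use trace_kernel_bound s in auto)
  then show ?thesis
    using s edge by (subst Vtr2_interior_second_diff) (auto simp: abs_mult divide_simps)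
qed

text \<open>The kernel bound is uniform in \<open>s\<close>, so \<open>w\<close> dominates the inner
  integrals, and \<open>\<bar>F\<bar>\<close> times the integral of \<open>w\<close> dominates the
  outer one. At \<open>u = 0\<close>, where the limiting kernel is singular, the second difference
  is zero.\<close>

lemma Vtr2_interior_convergent: "\<exists>L. (Vtr2_interior f h \<longlongrightarrow> L) (at_left 1)"
proof -
  define L where "L = 1 / (4 * pi\<^sup>2) * (LINT a|angle. F a * (LINT u|angle. second_diff H a u * trace_kernel 1 (cos u)))"
  have [measurable]: "(\<lambda>u. second_diff H a u) \<in> borel_measurable borel" for a
    unfolding second_diff_def by measurable
  have [measurable]: "(\<lambda>(a, u). second_diff H a u) \<in> borel_measurable (borel \<Otimes>\<^sub>M borel)"
    unfolding second_diff_def by measurable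
  have "(Vtr2_interior f h \<longlongrightarrow> L) (at_left 1)"
  proof (rule tendsto_at_left_sequentially[of 0])
    fix S :: "nat \<Rightarrow> real"
    assume S: "\<And>n. S n < 1" "\<And>n. 0 < S n" "S \<longlonglongrightarrow> 1"
    have kb: "\<bar>trace_kernel (S n) (cos u)\<bar> * (1 - cos u) \<le> 1" for n u
      using S(1)[of n] S(2)[of n] by (intro trace_kernel_bound) auto
    have inner: "(\<lambda>n. LINT u|angle. second_diff H a u * trace_kernel (S n) (cos u)) \<longlonglongrightarrow>
        (LINT u|angle. second_diff H a u * trace_kernel 1 (cos u))" for a
    proof (rule integral_dominated_convergence[where w=w])
      show "AE u in angle. norm (second_diff H a u * trace_kernel (S n) (cos u)) \<le> w u" for n
        unfolding real_norm_def by (rule AE_second_diff_kernel[OF w(2) sd kb])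
      show "AE u in angle. (\<lambda>n. second_diff H a u * trace_kernel (S n) (cos u)) \<longlonglongrightarrow> second_diff H a u * trace_kernel 1 (cos u)"
        using AE_angle
      proof eventually_elim
        fix u assume u: "u \<in> {0..pi}"
        show "(\<lambda>n. second_diff H a u * trace_kernel (S n) (cos u)) \<longlonglongrightarrow> second_diff H a u * trace_kernel 1 (cos u)"
        proof (cases "u = 0")
          case True
          then show ?thesis by (simp add: second_diff_def)
        next
          case False
          then have "cos u \<noteq> 1" using u cos_monotone_0_pi[of 0 u] by auto
          then show ?thesis
            unfolding trace_kernel_def poisson_den_def by (intro tendsto_intros S(3)) auto
        qed
      qed
    qed (use w in measurable)
    have "(\<lambda>n. LINT a|angle. F a * (LINT u|angle. second_diff H a u * trace_kernel (S n) (cos u))) \<longlonglongrightarrow>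
        (LINT a|angle. F a * (LINT u|angle. second_diff H a u * trace_kernel 1 (cos u)))"
    proof (rule integral_dominated_convergence[where w="\<lambda>a. \<bar>F a\<bar> * (LINT u|angle. w u)"])
      show "integrable angle (\<lambda>a. \<bar>F a\<bar> * (LINT u|angle. w u))" using F_integrable by auto
      show "AE a in angle. (\<lambda>n. F a * (LINT u|angle. second_diff H a u * trace_kernel (S n) (cos u))) \<longlonglongrightarrow>
          F a * (LINT u|angle. second_diff H a u * trace_kernel 1 (cos u))"
        using inner by (intro AE_I2 tendsto_intros) auto
      show "AE a in angle. norm (F a * (LINT u|angle. second_diff H a u * trace_kernel (S n) (cos u))) \<le> \<bar>F a\<bar> * (LINT u|angle. w u)" for n
        unfolding real_norm_def abs_mult
        by (intro AE_I2 mult_left_mono integral_second_diff_bound[OF w sd kb]) auto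
    qed measurable
    then have "(\<lambda>n. 1 / (4 * pi\<^sup>2) * (LINT a|angle. F a * (LINT u|angle. second_diff H a u * trace_kernel (S n) (cos u)))) \<longlonglongrightarrow> L"
      unfolding L_def by (intro tendsto_intros)
    moreover have "Vtr2_interior f h (S n) = 1 / (4 * pi\<^sup>2) * (LINT a|angle. F a * (LINT u|angle. second_diff H a u * trace_kernel (S n) (cos u)))" for n
      using S(1)[of n] S(2)[of n] edge by (intro Vtr2_interior_second_diff) auto
    ultimately show "(\<lambda>n. Vtr2_interior f h (S n)) \<longlonglongrightarrow> L" by simp
  qed simp
  then show ?thesis ..
qed

lemma Vtr2_bound_nonneg:
  assumes s: "0 \<le> s" "s \<le> 1"
  shows "\<bar>Vtr2 f h s\<bar> \<le> J * (LINT u|angle. w u) / (4 * pi\<^sup>2)"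
proof (cases "s = 1")
  case True
  obtain L where L: "(Vtr2_interior f h \<longlongrightarrow> L) (at_left 1)" using Vtr2_interior_convergent by blast
  then have "Vtr2 f h s = L"
    using True by (simp add: Vtr2_def extend_to_endpoints_def tendsto_Lim)
  moreover have "\<bar>L\<bar> \<le> J * (LINT u|angle. w u) / (4 * pi\<^sup>2)"
  proof (rule tendsto_upperbound[OF tendsto_rabs[OF L]])
    have "eventually (\<lambda>s. s \<in> {0<..<1::real}) (at_left 1)"
      by (rule eventually_at_leftI[of 0]) auto
    then show "eventually (\<lambda>s. \<bar>Vtr2_interior f h s\<bar> \<le> J * (LINT u|angle. w u) / (4 * pi\<^sup>2)) (at_left 1)"
      by eventually_elim (auto intro!: Vtr2_interior_bound)
  qed simp
  ultimately show ?thesis by simp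
next
  case False
  then show ?thesis using Vtr2_interior_bound[of s] s by (simp add: Vtr2_def extend_to_endpoints_def)
qed

end

text \<open>Negative \<open>s\<close> is handled by the reflected function. In the angle this is a
  shift of \<open>H\<close>, and since \<open>w\<close> controls second differences at every base
  point, the same \<open>w\<close> applies.\<close>

lemma Vtr2_bound:
  assumes w: "integrable angle w" "\<And>u. 0 \<le> w u"
    and sd: "\<And>s u. u \<in> {0..pi} \<Longrightarrow> \<bar>second_diff H s u\<bar> \<le> w u * (1 - cos u)"
    and edge: "f 2 = 0" "f (-2) = 0" and s: "- 1 \<le> s" "s \<le> 1"
  shows "\<bar>Vtr2 f h s\<bar> \<le> J * (LINT u|angle. w u) / (4 * pi\<^sup>2)"
proof (cases "0 \<le> s")
  case True
  then show ?thesis by (intro Vtr2_bound_nonneg[OF w sd edge] s)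
next
  case False
  interpret R: test_functions f "\<lambda>y. h (- y)" f0 "\<lambda>y. h0 (- y)" bf bh by (rule reflected)
  have RH: "R.H t = H (t + pi)" for t by (simp add: R.H_def H_def cs_def)
  have sdR: "\<bar>second_diff R.H t u\<bar> \<le> w u * (1 - cos u)" if "u \<in> {0..pi}" for t u
    using sd[OF that, of "t + pi"] by (simp add: second_diff_def RH algebra_simps)
  have refl: "Vtr2_interior f h t = Vtr2_interior f (\<lambda>y. h (- y)) (- t)" if "t \<in> {-1<..<1}" for t
    using Vtr2_interior_reflect[of "- t"] that edge by simp
  have "Vtr2 f h s = Vtr2 f (\<lambda>y. h (- y)) (- s)"
  proof (cases "s = - 1")
    case True
    obtain L where L: "(Vtr2_interior f (\<lambda>y. h (- y)) \<longlongrightarrow> L) (at_left 1)"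
      using R.Vtr2_interior_convergent[OF w sdR edge] by blast
    show ?thesis
      unfolding Vtr2_def True using extend_to_endpoints_reflect[OF L, of "Vtr2_interior f h"] refl by simp
  next
    case False
    then show ?thesis using refl[of s] \<open>\<not> 0 \<le> s\<close> s by (simp add: Vtr2_def extend_to_endpoints_def)
  qed
  then show ?thesis using R.Vtr2_bound_nonneg[OF w sdR edge, of "- s"] s False by simp
qed

end

section \<open>The eigenvector covariances\<close>

text \<open>The Taylor bound \<open>x - x ^ 3 / 6\<close> together with
  \<open>x ^ 2 \<le> 4\<close>; hence the slope \<open>1 - 4 / 6\<close>.\<close>

lemma sin_ge_linear:
  fixes x :: real
  assumes "0 \<le> x" "x \<le> pi / 2"
  shows "x / 3 \<le> sin x"
proof -
  have "\<bar>sin x - (\<Sum>m<3. sin_coeff m * x ^ m)\<bar> \<le> inverse (fact 3) * \<bar>x\<bar> ^ 3"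
    by (rule Maclaurin_sin_bound)
  moreover have "(\<Sum>m<3. sin_coeff m * x ^ m) = x"
    by (simp add: lessThan_nat_numeral lessThan_Suc sin_coeff_def)
  moreover have "inverse (fact 3) = (1 / 6 :: real)" by (simp add: fact_numeral)
  ultimately have "\<bar>sin x - x\<bar> \<le> 1 / 6 * \<bar>x\<bar> ^ 3" by (simp only:)
  moreover have "\<bar>x\<bar> ^ 3 = x ^ 3" using assms by simp
  ultimately have "x - x ^ 3 / 6 \<le> sin x" by linarith
  moreover have "x ^ 3 \<le> x * 4"
  proof -
    have "x\<^sup>2 \<le> 2\<^sup>2" using assms pi_half_less_two by (intro power_mono) auto
    then have "x * x\<^sup>2 \<le> x * 4" using assms by (intro mult_left_mono) auto
    then show ?thesis by (simp add: power3_eq_cube power2_eq_square)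
  qed
  ultimately show ?thesis by simp
qed

text \<open>The constant \<open>18\<close> is \<open>36 / 2\<close>, from
  \<open>1 - cos u = 2 * sin (u / 2) ^ 2\<close> and \<open>sin (u / 2) \<ge> u / 6\<close>.\<close>

lemma one_minus_cos_ge:
  assumes "0 \<le> u" "u \<le> pi"
  shows "u\<^sup>2 / 18 \<le> 1 - cos u"
proof -
  have "u / 2 / 3 \<le> sin (u / 2)" using assms by (intro sin_ge_linear) auto
  then have "(u / 6)\<^sup>2 \<le> (sin (u / 2))\<^sup>2" using assms by (intro power_mono) auto
  moreover have "1 - cos u = 2 * (sin (u / 2))\<^sup>2" using cos_double_sin[of "u / 2"] by simp
  ultimately show ?thesis by (simp add: power_divide)
qed

lemma integral_angle_const: "(LINT t|angle. c) = c * pi" for c :: real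
  by (subst integral_angle_continuous) (auto intro!: continuous_intros)

lemma measure_angle [simp]: "measure angle UNIV = pi"
  using integral_angle_const[of 1] by simp

section \<open>The Poisson kernel\<close>

definition poisson_kernel :: "real \<Rightarrow> real \<Rightarrow> real" where
  "poisson_kernel s c = (1 - s\<^sup>2) / poisson_den s c"

lemma poisson_kernel_measurable [measurable]: "poisson_kernel s \<in> borel_measurable borel"
  unfolding poisson_kernel_def poisson_den_def by measurable

lemma poisson_kernel_nonneg:
  assumes "\<bar>c\<bar> \<le> 1" "\<bar>s\<bar> < 1"
  shows "0 \<le> poisson_kernel s c"
proof -
  have "s\<^sup>2 \<le> 1" using assms(2) by (simp add: abs_square_le_1)
  then show ?thesis unfolding poisson_kernel_def using poisson_den_pos[OF assms] by simp
qed

lemma poisson_kernel_bounded: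
  assumes "\<bar>c\<bar> \<le> 1" "\<bar>s\<bar> < 1"
  shows "\<bar>poisson_kernel s c\<bar> \<le> 1 / (1 - \<bar>s\<bar>)\<^sup>2"
proof -
  have "s\<^sup>2 \<le> 1" using assms(2) by (simp add: abs_square_le_1)
  then have "(1 - s\<^sup>2) / poisson_den s c \<le> 1 / (1 - \<bar>s\<bar>)\<^sup>2"
    using assms poisson_den_ge[OF assms(1), of s] by (intro frac_le) auto
  then show ?thesis using poisson_kernel_nonneg[OF assms] by (simp add: poisson_kernel_def)
qed

lemma poisson_kernel_continuous:
  assumes "\<bar>s\<bar> < 1"
  shows "continuous_on UNIV (\<lambda>t. poisson_kernel s (cos t))"
proof -
  have "poisson_den s (cos t) \<noteq> 0" for t using poisson_den_pos[of "cos t" s] assms by simp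
  then show ?thesis
    unfolding poisson_kernel_def poisson_den_def by (intro continuous_intros) auto
qed

text \<open>The antiderivative comes from \<open>arg (1 - s * exp (\<i> * t)) = - arctan (s * sin t / (1 - s * cos t))\<close>.\<close>

lemma integral_poisson_kernel:
  assumes s: "\<bar>s\<bar> < 1"
  shows "(LINT t|angle. poisson_kernel s (cos t)) = pi"
proof -
  let ?g = "\<lambda>t. t + 2 * arctan (s * sin t / (1 - s * cos t))"
  have d: "(?g has_real_derivative poisson_kernel s (cos t)) (at t)" for t
  proof -
    have "\<bar>s * cos t\<bar> \<le> \<bar>s\<bar>" by (simp add: abs_mult mult_left_le)
    then have n: "0 < 1 - s * cos t" using s by linarith
    have p: "0 < poisson_den s (cos t)" using poisson_den_pos[OF _ s] by simp
    have sc: "(sin t)\<^sup>2 = 1 - (cos t)\<^sup>2" by (simp add: sin_squared_eq)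
    have D: "(1 - s * cos t)\<^sup>2 + (s * sin t)\<^sup>2 = poisson_den s (cos t)"
      unfolding power_mult_distrib sc by (simp add: poisson_den_def power2_eq_square algebra_simps)
    have "(?g has_real_derivative 1 + 2 * ((s * cos t * (1 - s * cos t) - s * sin t * (s * sin t)) / (1 - s * cos t)\<^sup>2 *
        inverse (1 + (s * sin t / (1 - s * cos t))\<^sup>2))) (at t)"
      using n by (auto intro!: derivative_eq_intros simp: power2_eq_square)
    also have "inverse (1 + (s * sin t / (1 - s * cos t))\<^sup>2) = (1 - s * cos t)\<^sup>2 / poisson_den s (cos t)"
      using n p unfolding D[symmetric] by (simp add: field_simps power_divide)
    also have "s * cos t * (1 - s * cos t) - s * sin t * (s * sin t) = s * cos t - s\<^sup>2"
    proof -
      have "s * cos t * (1 - s * cos t) - s * sin t * (s * sin t) = s * cos t - s\<^sup>2 * ((sin t)\<^sup>2 + (cos t)\<^sup>2)"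
        by (simp add: power2_eq_square algebra_simps del: sin_cos_squared_add3 sin_cos_squared_add)
      then show ?thesis by simp
    qed
    also have "1 + 2 * ((s * cos t - s\<^sup>2) / (1 - s * cos t)\<^sup>2 * ((1 - s * cos t)\<^sup>2 / poisson_den s (cos t))) =
        poisson_kernel s (cos t)"
    proof -
      have "1 + 2 * ((s * cos t - s\<^sup>2) / (1 - s * cos t)\<^sup>2 * ((1 - s * cos t)\<^sup>2 / poisson_den s (cos t))) =
          1 + 2 * (s * cos t - s\<^sup>2) / poisson_den s (cos t)"
        using n by simp
      also have "\<dots> = (poisson_den s (cos t) + 2 * (s * cos t - s\<^sup>2)) / poisson_den s (cos t)"
        using p by (simp add: field_simps)
      also have "poisson_den s (cos t) + 2 * (s * cos t - s\<^sup>2) = 1 - s\<^sup>2"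
        by (simp add: poisson_den_def algebra_simps)
      finally show ?thesis by (simp add: poisson_kernel_def)
    qed
    finally show ?thesis .
  qed
  have "(LINT t|lborel. poisson_kernel s (cos t) * indicator {0..pi} t) = ?g pi - ?g 0"
  proof (rule integral_FTC_Icc_real)
    show "isCont (\<lambda>t. poisson_kernel s (cos t)) x" for x
      using poisson_kernel_continuous[OF s] by (simp add: continuous_on_eq_continuous_at)
  qed (auto intro: d)
  then show ?thesis
    by (simp add: integral_angle mult.commute)
qed

text \<open>For \<open>s \<ge> 1 / 2\<close> the denominator is at least
  \<open>(1 - s) ^ 2 + (u / 5) ^ 2\<close>, where \<open>5 ^ 2\<close> exceeds the \<open>18\<close>
  of \<open>one_minus_cos_ge\<close>, hence at least \<open>2 * (1 - s) * (u / 5)\<close>; the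
  factor \<open>1 - s\<close> cancels against \<open>1 - s ^ 2\<close>. This dominates the kernel
  times a Lipschitz increment, uniformly as \<open>s\<close> tends to \<open>1\<close>.\<close>

lemma poisson_kernel_moment:
  assumes s: "1 / 2 \<le> s" "s < 1" and u: "0 \<le> u" "u \<le> pi"
  shows "u * poisson_kernel s (cos u) \<le> 5"
proof (cases "u = 0")
  case False
  have p: "poisson_den s (cos u) = (1 - s)\<^sup>2 + 2 * s * (1 - cos u)"
    by (simp add: poisson_den_def power2_diff algebra_simps)
  have "1 * (u\<^sup>2 / 18) \<le> 2 * s * (1 - cos u)"
    using one_minus_cos_ge[OF u] s by (intro mult_mono) auto
  moreover have "(u / 5)\<^sup>2 \<le> 1 * (u\<^sup>2 / 18)" by (simp add: power_divide)
  ultimately have "(1 - s)\<^sup>2 + (u / 5)\<^sup>2 \<le> poisson_den s (cos u)" unfolding p by linarith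
  moreover have "2 * (1 - s) * (u / 5) \<le> (1 - s)\<^sup>2 + (u / 5)\<^sup>2" by (rule sum_squares_bound)
  ultimately have le: "2 * (1 - s) * (u / 5) \<le> poisson_den s (cos u)" by linarith
  have pos: "0 < 2 * (1 - s) * (u / 5)" using False u s by simp
  have "u * poisson_kernel s (cos u) = u * (1 - s\<^sup>2) / poisson_den s (cos u)" by (simp add: poisson_kernel_def)
  also have "\<dots> \<le> u * (1 - s\<^sup>2) / (2 * (1 - s) * (u / 5))"
    using le pos order.strict_trans2[OF pos le] u s False by (intro divide_left_mono mult_nonneg_nonneg mult_pos_pos) (auto simp: abs_square_le_1)
  also have "\<dots> = 5 * (1 + s) / 2"
    using False s by (simp add: field_simps power2_eq_square)
  also have "\<dots> \<le> 5" using s by simp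
  finally show ?thesis .
qed simp

text \<open>The denominator of \<open>Vd2_interior\<close> factors into two Poisson denominators,
  whose difference is \<open>4 * s * sin a * sin u\<close>; partial fractions then give a difference
  of Poisson kernels.\<close>

lemma mean_kernel_angle:
  assumes s: "\<bar>s\<bar> < 1"
  shows "s\<^sup>2 * ((cs a)\<^sup>2 + (cs u)\<^sup>2) + (1 - s\<^sup>2)\<^sup>2 - cs a * cs u * s * (1 + s\<^sup>2) =
      poisson_den s (cos (a - u)) * poisson_den s (cos (a + u))"
    and "4 * s * sin a * sin u / (poisson_den s (cos (a - u)) * poisson_den s (cos (a + u))) =
      1 / poisson_den s (cos (a - u)) - 1 / poisson_den s (cos (a + u))"
proof -
  have "cos (a - u) * cos (a + u) = (cos a)\<^sup>2 * (cos u)\<^sup>2 - (sin a)\<^sup>2 * (sin u)\<^sup>2"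
    by (simp add: cos_add cos_diff power2_eq_square algebra_simps)
  also have "\<dots> = (cos a)\<^sup>2 + (cos u)\<^sup>2 - 1"
    unfolding sin_squared_eq by (simp add: algebra_simps)
  finally have m: "cos (a - u) * cos (a + u) = (cos a)\<^sup>2 + (cos u)\<^sup>2 - 1" .
  have "poisson_den s (cos (a - u)) * poisson_den s (cos (a + u)) =
      (1 + s\<^sup>2)\<^sup>2 - 2 * s * (1 + s\<^sup>2) * (cos (a - u) + cos (a + u)) + 4 * s\<^sup>2 * (cos (a - u) * cos (a + u))"
    by (simp add: poisson_den_def power2_eq_square algebra_simps)
  also have "cos (a - u) + cos (a + u) = 2 * cos a * cos u" by (simp add: cos_add cos_diff)
  finally have "poisson_den s (cos (a - u)) * poisson_den s (cos (a + u)) =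
      (1 + s\<^sup>2)\<^sup>2 - 2 * s * (1 + s\<^sup>2) * (2 * cos a * cos u) + 4 * s\<^sup>2 * ((cos a)\<^sup>2 + (cos u)\<^sup>2 - 1)"
    unfolding m .
  then show "s\<^sup>2 * ((cs a)\<^sup>2 + (cs u)\<^sup>2) + (1 - s\<^sup>2)\<^sup>2 - cs a * cs u * s * (1 + s\<^sup>2) =
      poisson_den s (cos (a - u)) * poisson_den s (cos (a + u))"
    by (simp add: cs_def power2_eq_square algebra_simps)
  have pos: "0 < poisson_den s (cos (a - u))" "0 < poisson_den s (cos (a + u))"
    using s by (auto intro!: poisson_den_pos)
  have "poisson_den s (cos (a + u)) - poisson_den s (cos (a - u)) = 4 * s * sin a * sin u"
    by (simp add: poisson_den_def cos_add cos_diff algebra_simps)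
  then show "4 * s * sin a * sin u / (poisson_den s (cos (a - u)) * poisson_den s (cos (a + u))) =
      1 / poisson_den s (cos (a - u)) - 1 / poisson_den s (cos (a + u))"
    using pos by (simp add: diff_frac_eq mult.commute)
qed

section \<open>Semicircle and arcsine means in the angle\<close>

lemma sc_mean_angle:
  assumes [measurable]: "g \<in> borel_measurable borel"
  shows "sc_mean g = (2 / pi) * (LINT t|angle. g (cs t) * (sin t)\<^sup>2)"
proof -
  have "sc_mean g = (LINT x:{-2..2}|lborel. (g x * (4 - x\<^sup>2) / (2 * pi)) / sqrt (4 - x\<^sup>2))"
    unfolding sc_mean_def
  proof (rule set_lebesgue_integral_cong)
    show "\<forall>x. x \<in> {-2..2} \<longrightarrow> g x * (sqrt (4 - x\<^sup>2) / (2 * pi)) = g x * (4 - x\<^sup>2) / (2 * pi) / sqrt (4 - x\<^sup>2)"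
    proof (intro allI impI)
      fix x :: real assume "x \<in> {-2..2}"
      then have "0 \<le> 4 - x\<^sup>2" using sq_le_4 by auto
      then have "(4 - x\<^sup>2) / sqrt (4 - x\<^sup>2) = sqrt (4 - x\<^sup>2)" by (rule real_div_sqrt)
      moreover have "g x * (4 - x\<^sup>2) / (2 * pi) / sqrt (4 - x\<^sup>2) = g x * ((4 - x\<^sup>2) / sqrt (4 - x\<^sup>2) / (2 * pi))"
        by (simp only: times_divide_eq_right divide_divide_eq_left mult.commute)
      ultimately show "g x * (sqrt (4 - x\<^sup>2) / (2 * pi)) = g x * (4 - x\<^sup>2) / (2 * pi) / sqrt (4 - x\<^sup>2)"
        by (simp only:)
    qed
  qed simp
  also have "\<dots> = (LINT t|angle. g (cs t) * (4 - (cs t)\<^sup>2) / (2 * pi))" by (rule integral_arc) measurable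
  also have "\<dots> = (LINT t|angle. (2 / pi) * (g (cs t) * (sin t)\<^sup>2))"
  proof (rule Bochner_Integration.integral_cong)
    fix t
    have "4 - (cs t)\<^sup>2 = 4 * (sin t)\<^sup>2" by (simp add: cs_def power_mult_distrib sin_squared_eq)
    then show "g (cs t) * (4 - (cs t)\<^sup>2) / (2 * pi) = (2 / pi) * (g (cs t) * (sin t)\<^sup>2)" by simp
  qed simp
  finally show ?thesis by simp
qed

lemma inv_sc_mean_angle:
  assumes [measurable]: "g \<in> borel_measurable borel"
  shows "inv_sc_mean g = (1 / pi) * (LINT t|angle. g (cs t))"
proof -
  have "inv_sc_mean g = (LINT x:{-2..2}|lborel. (g x / pi) / sqrt (4 - x\<^sup>2))"
    unfolding inv_sc_mean_def by simp
  also have "\<dots> = (LINT t|angle. g (cs t) / pi)" by (rule integral_arc) measurable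
  finally show ?thesis by simp
qed

lemma mean_bounds:
  assumes g: "g \<in> borel_measurable borel" and G: "integrable angle G" and le: "AE t in angle. \<bar>g (cs t)\<bar> \<le> G t"
  shows "\<bar>sc_mean g\<bar> \<le> (LINT t|angle. G t)" and "\<bar>inv_sc_mean g\<bar> \<le> (LINT t|angle. G t)"
proof -
  have G0: "0 \<le> (LINT t|angle. G t)"
    by (rule Bochner_Integration.integral_nonneg_AE) (use le in \<open>eventually_elim, meson abs_ge_zero order_trans\<close>)
  have *: "\<bar>LINT t|angle. g (cs t) * v t\<bar> \<le> (LINT t|angle. G t)" if "\<And>t. \<bar>v t\<bar> \<le> 1" for v :: "real \<Rightarrow> real"
  proof -
    have "\<bar>LINT t|angle. g (cs t) * v t\<bar> \<le> (LINT t|angle. \<bar>g (cs t) * v t\<bar>)" by (rule integral_abs_bound)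
    also have "\<dots> \<le> (LINT t|angle. G t)"
    proof (rule integral_mono_AE'[OF G])
      show "AE t in angle. \<bar>g (cs t) * v t\<bar> \<le> G t"
        using le
      proof eventually_elim
        fix t assume "\<bar>g (cs t)\<bar> \<le> G t"
        moreover have "\<bar>g (cs t) * v t\<bar> \<le> \<bar>g (cs t)\<bar> * 1" unfolding abs_mult using that by (intro mult_left_mono) auto
        ultimately show "\<bar>g (cs t) * v t\<bar> \<le> G t" by linarith
      qed
      show "AE t in angle. 0 \<le> G t" using le by eventually_elim (meson abs_ge_zero order_trans)
    qed
    finally show ?thesis .
  qed
  have "\<bar>sc_mean g\<bar> \<le> 2 / pi * (LINT t|angle. G t)"
    unfolding sc_mean_angle[OF g] abs_mult using *[of "\<lambda>t. (sin t)\<^sup>2"] by (intro mult_mono) (auto simp: abs_square_le_1)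
  also have "\<dots> \<le> 1 * (LINT t|angle. G t)" using pi_ge_two G0 by (intro mult_right_mono) auto
  finally show "\<bar>sc_mean g\<bar> \<le> (LINT t|angle. G t)" by simp
  have "\<bar>inv_sc_mean g\<bar> \<le> 1 / pi * (LINT t|angle. G t)"
    unfolding inv_sc_mean_angle[OF g] abs_mult using *[of "\<lambda>t. 1"] by (intro mult_mono) auto
  also have "\<dots> \<le> 1 * (LINT t|angle. G t)" using pi_ge_two G0 by (intro mult_right_mono) auto
  finally show "\<bar>inv_sc_mean g\<bar> \<le> (LINT t|angle. G t)" by simp
qed

context test_functions
begin

text \<open>The finer function is measured by \<open>J\<close> and the coarser one by its supremum,
  so that a product of two means stays linear in \<open>J\<close>.\<close>

lemma f_mean_bounds:
  assumes [measurable]: "p \<in> borel_measurable borel" and p: "\<And>x. x \<in> {-2..2} \<Longrightarrow> \<bar>p x\<bar> \<le> c"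
  shows "\<bar>sc_mean (\<lambda>x. p x * f x)\<bar> \<le> c * J" and "\<bar>inv_sc_mean (\<lambda>x. p x * f x)\<bar> \<le> c * J"
    and "\<bar>sc_mean (\<lambda>x. p x * h x)\<bar> \<le> c * (bh * pi)" and "\<bar>inv_sc_mean (\<lambda>x. p x * h x)\<bar> \<le> c * (bh * pi)"
proof -
  have cs_range: "cs t \<in> {-2..2}" for t
    using cos_ge_minus_one[of t] cos_le_one[of t] unfolding cs_def atLeastAtMost_iff by linarith
  have c0: "0 \<le> c" using p[of 0] by auto
  have 1: "AE t in angle. \<bar>p (cs t) * f (cs t)\<bar> \<le> c * \<bar>F t\<bar>"
    using F_AE by eventually_elim (use p[OF cs_range] in \<open>auto simp: abs_mult intro!: mult_right_mono\<close>)
  have 2: "AE t in angle. \<bar>p (cs t) * h (cs t)\<bar> \<le> c * bh"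
    using H_AE by eventually_elim (use p[OF cs_range] H_bound c0 in \<open>auto simp: abs_mult intro!: mult_mono\<close>)
  have i: "integrable angle (\<lambda>t. c * \<bar>F t\<bar>)" "integrable angle (\<lambda>t. c * bh)"
    using F_integrable by auto
  show "\<bar>sc_mean (\<lambda>x. p x * f x)\<bar> \<le> c * J" "\<bar>inv_sc_mean (\<lambda>x. p x * f x)\<bar> \<le> c * J"
    using mean_bounds[OF _ i(1) 1] by (auto simp: J_def)
  show "\<bar>sc_mean (\<lambda>x. p x * h x)\<bar> \<le> c * (bh * pi)" "\<bar>inv_sc_mean (\<lambda>x. p x * h x)\<bar> \<le> c * (bh * pi)"
    using mean_bounds[OF _ i(2) 2] by (auto simp: mult_ac)
qed

lemma sc_mean_f_bound: "\<bar>sc_mean f\<bar> \<le> J" and sc_mean_h_bound: "\<bar>sc_mean h\<bar> \<le> bh * pi"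
  using f_mean_bounds[of "\<lambda>_. 1" 1] by auto

lemma sc_mean_product_bound: "\<bar>sc_mean f * sc_mean h\<bar> \<le> J * (bh * pi)"
  unfolding abs_mult using sc_mean_f_bound sc_mean_h_bound J_nonneg by (intro mult_mono) auto

lemma Vd1_bound: "\<bar>Vd1 f h\<bar> \<le> (1 + pi) * bh * J"
proof -
  have "AE t in angle. \<bar>f (cs t) * h (cs t)\<bar> \<le> bh * \<bar>F t\<bar>"
    using F_AE H_AE
  proof eventually_elim
    case (elim t)
    then show ?case using mult_right_mono[OF H_bound[of t], of "\<bar>F t\<bar>"] by (simp add: abs_mult mult.commute)
  qed
  then have "\<bar>sc_mean (\<lambda>x. f x * h x)\<bar> \<le> (LINT t|angle. bh * \<bar>F t\<bar>)"
    using F_integrable by (intro mean_bounds) auto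
  then show ?thesis
    unfolding Vd1_def using sc_mean_product_bound by (simp add: J_def algebra_simps abs_diff_le_iff) linarith
qed

text \<open>One factor \<open>4 * sin a * sin u\<close> is the square root in the numerator of
  \<open>Vd2_interior\<close>, the other is the Jacobian of the substitution.\<close>

definition mean_kernel :: "real \<Rightarrow> real \<Rightarrow> real \<Rightarrow> real" where
  "mean_kernel s a u = 16 * (1 - s\<^sup>2) * (sin a)\<^sup>2 * (sin u)\<^sup>2 / (poisson_den s (cos (a - u)) * poisson_den s (cos (a + u)))"

lemma Vd2_interior_eq:
  assumes s: "\<bar>s\<bar> < 1"
  shows "Vd2_interior f h s = 1 / (4 * pi\<^sup>2) * (LINT (a, u)|(angle \<Otimes>\<^sub>M angle). F a * H u * mean_kernel s a u)
    - sc_mean f * sc_mean h"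
proof -
  let ?den = "\<lambda>x y. s\<^sup>2 * (x\<^sup>2 + y\<^sup>2) + (1 - s\<^sup>2)\<^sup>2 - x * y * s * (1 + s\<^sup>2)"
  let ?\<Phi> = "\<lambda>x y. f x * h y * ((1 - s\<^sup>2) * ((4 - x\<^sup>2) * (4 - y\<^sup>2)) / ?den x y)"
  have "(LINT (x, y):{-2..2} \<times> {-2..2}|lborel. f x * h y * ((1 - s\<^sup>2) * sqrt ((4 - x\<^sup>2) * (4 - y\<^sup>2)) / ?den x y)) =
      (LINT (x, y):{-2..2} \<times> {-2..2}|lborel. ?\<Phi> x y / (sqrt (4 - x\<^sup>2) * sqrt (4 - y\<^sup>2)))"
  proof (rule set_lebesgue_integral_cong)
    show "{-2..2} \<times> {-2..2} \<in> sets (lborel :: (real \<times> real) measure)"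
      unfolding sets_lborel by (intro borel_closed closed_Times closed_atLeastAtMost)
    have "f x * h y * ((1 - s\<^sup>2) * sqrt ((4 - x\<^sup>2) * (4 - y\<^sup>2)) / ?den x y) = ?\<Phi> x y / (sqrt (4 - x\<^sup>2) * sqrt (4 - y\<^sup>2))"
      if "x \<in> {-2..2}" "y \<in> {-2..2}" for x y
    proof -
      define X where "X = (4 - x\<^sup>2) * (4 - y\<^sup>2)"
      have "0 \<le> X" unfolding X_def using that sq_le_4 by (intro mult_nonneg_nonneg) auto
      moreover have "c * (r * X / d) / sqrt X = c * (r * (X / sqrt X) / d)" for c r d
        by (simp only: times_divide_eq_right divide_divide_eq_left mult.commute)
      ultimately have "c * (r * sqrt X / d) = c * (r * X / d) / sqrt X" for c r d
        by (simp only: real_div_sqrt)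
      then show ?thesis unfolding X_def[symmetric] real_sqrt_mult[symmetric] .
    qed
    then show "\<forall>z. z \<in> {-2..2} \<times> {-2..2} \<longrightarrow>
        (case z of (x, y) \<Rightarrow> f x * h y * ((1 - s\<^sup>2) * sqrt ((4 - x\<^sup>2) * (4 - y\<^sup>2)) / ?den x y)) =
        (case z of (x, y) \<Rightarrow> ?\<Phi> x y / (sqrt (4 - x\<^sup>2) * sqrt (4 - y\<^sup>2)))"
      by auto
  qed
  also have "\<dots> = (LINT (a, u)|(angle \<Otimes>\<^sub>M angle). ?\<Phi> (cs a) (cs u))"
    by (rule integral_arc2) (unfold borel_prod[symmetric], measurable)
  also have "\<dots> = (LINT (a, u)|(angle \<Otimes>\<^sub>M angle). F a * H u * mean_kernel s a u)"
  proof (rule integral_cong_AE)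
    have *: "?\<Phi> (cs a) (cs u) = F a * H u * mean_kernel s a u" if "f (cs a) = F a" "h (cs u) = H u" for a u
    proof -
      have sq: "4 - (cs t)\<^sup>2 = 4 * (sin t)\<^sup>2" for t
        by (simp add: cs_def power_mult_distrib sin_squared_eq)
      have "mean_kernel s a u = (1 - s\<^sup>2) * (4 * (sin a)\<^sup>2 * (4 * (sin u)\<^sup>2)) /
          (poisson_den s (cos (a - u)) * poisson_den s (cos (a + u)))"
        unfolding mean_kernel_def by (simp only: mult.assoc mult.commute[of "1 - s\<^sup>2"])
      then show ?thesis unfolding that sq mean_kernel_angle(1)[OF s] by (simp only:)
    qed
    from AE_angle2[OF F_AE H_AE]
    show "AE z in angle \<Otimes>\<^sub>M angle. (case z of (a, u) \<Rightarrow> ?\<Phi> (cs a) (cs u)) =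
        (case z of (a, u) \<Rightarrow> F a * H u * mean_kernel s a u)"
    proof eventually_elim
      case (elim z)
      then show ?case using *[of "fst z" "snd z"] unfolding case_prod_beta by blast
    qed
    show "(\<lambda>(a, u). F a * H u * mean_kernel s a u) \<in> borel_measurable (angle \<Otimes>\<^sub>M angle)"
      unfolding mean_kernel_def poisson_den_def by measurable
  qed measurable
  finally show ?thesis unfolding Vd2_interior_def by simp
qed

text \<open>Each Poisson denominator is at least \<open>(1 - \<bar>s\<bar>) ^ 2\<close>. The
  constant explodes as \<open>\<bar>s\<bar>\<close> tends to \<open>1\<close>, which is harmless for
  a fixed \<open>s\<close>. Unlike the Poisson form below, this argument does not divide by
  \<open>s\<close> and so includes \<open>s = 0\<close>.\<close>

lemma Vd2_interior_bound:
  assumes s: "\<bar>s\<bar> < 1"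
  shows "\<bar>Vd2_interior f h s\<bar> \<le> (16 / (1 - \<bar>s\<bar>) ^ 4 + 1) * (bh * pi) * J"
proof -
  define c where "c = 16 / (1 - \<bar>s\<bar>) ^ 4"
  have c0: "0 \<le> c" by (simp add: c_def)
  have kb: "\<bar>mean_kernel s a u\<bar> \<le> c" for a u
  proof -
    have "s\<^sup>2 \<le> 1" using s by (simp add: abs_square_le_1)
    then have "16 * (1 - s\<^sup>2) * (sin a)\<^sup>2 * (sin u)\<^sup>2 \<le> 16 * 1 * 1 * 1"
      by (intro mult_mono) (auto simp: abs_square_le_1)
    moreover have "(1 - \<bar>s\<bar>) ^ 4 \<le> poisson_den s (cos (a - u)) * poisson_den s (cos (a + u))"
    proof -
      have "(1 - \<bar>s\<bar>) ^ 4 = (1 - \<bar>s\<bar>)\<^sup>2 * (1 - \<bar>s\<bar>)\<^sup>2" by (simp add: power_add[symmetric])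
      also have "\<dots> \<le> poisson_den s (cos (a - u)) * poisson_den s (cos (a + u))"
        using poisson_den_pos[OF _ s, of "cos (a - u)"] by (intro mult_mono poisson_den_ge) auto
      finally show ?thesis .
    qed
    moreover have "0 < (1 - \<bar>s\<bar>) ^ 4" using s by simp
    ultimately have "mean_kernel s a u \<le> c"
      unfolding mean_kernel_def c_def by (intro frac_le) auto
    moreover have "0 \<le> mean_kernel s a u"
      unfolding mean_kernel_def using \<open>s\<^sup>2 \<le> 1\<close> poisson_den_pos[OF _ s, of "cos (a - u)"] poisson_den_pos[OF _ s, of "cos (a + u)"] by simp
    ultimately show ?thesis by simp
  qed
  have int: "integrable (angle \<Otimes>\<^sub>M angle) (\<lambda>(a, u). c * bh * \<bar>F a\<bar>)"
  proof (rule integrable_angle2_bounded)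
    show "\<bar>case z of (a, u) \<Rightarrow> c * bh * \<bar>F a\<bar>\<bar> \<le> c * bh * bf" for z
      using F_bound bounds_nonneg c0 by (auto simp: split_beta abs_mult intro!: mult_left_mono)
  qed measurable
  have "\<bar>LINT (a, u)|(angle \<Otimes>\<^sub>M angle). F a * H u * mean_kernel s a u\<bar> \<le>
      (LINT z|(angle \<Otimes>\<^sub>M angle). \<bar>case z of (a, u) \<Rightarrow> F a * H u * mean_kernel s a u\<bar>)" by (rule integral_abs_bound)
  also have "\<dots> \<le> (LINT (a, u)|(angle \<Otimes>\<^sub>M angle). c * bh * \<bar>F a\<bar>)"
  proof (rule integral_mono'[OF int])
    fix z :: "real \<times> real"
    have "\<bar>F a\<bar> * \<bar>H u\<bar> * \<bar>mean_kernel s a u\<bar> \<le> \<bar>F a\<bar> * bh * c" for a u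
      using kb H_bound bounds_nonneg c0 by (intro mult_mono) auto
    then show "\<bar>case z of (a, u) \<Rightarrow> F a * H u * mean_kernel s a u\<bar> \<le> (case z of (a, u) \<Rightarrow> c * bh * \<bar>F a\<bar>)"
      by (auto simp: split_beta abs_mult mult_ac)
    show "0 \<le> (case z of (a, u) \<Rightarrow> c * bh * \<bar>F a\<bar>)" using bounds_nonneg c0 by (auto simp: split_beta)
  qed
  also have "\<dots> = c * bh * pi * J"
    using angle2.integral_fst[OF int] by (simp add: J_def mult_ac)
  finally have 1: "\<bar>LINT (a, u)|(angle \<Otimes>\<^sub>M angle). F a * H u * mean_kernel s a u\<bar> \<le> c * bh * pi * J" .
  have pi1: "1 / (4 * pi\<^sup>2) \<le> 1"
  proof -
    have "1 \<le> pi\<^sup>2" using pi_ge_two by (intro one_le_power) auto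
    then show ?thesis by simp
  qed
  let ?I = "1 / (4 * pi\<^sup>2) * (LINT (a, u)|(angle \<Otimes>\<^sub>M angle). F a * H u * mean_kernel s a u)"
  have "\<bar>?I\<bar> \<le> 1 * (c * bh * pi * J)"
    unfolding abs_mult using 1 pi1 by (intro mult_mono) auto
  then have "\<bar>?I - sc_mean f * sc_mean h\<bar> \<le> c * bh * pi * J + J * (bh * pi)"
    using sc_mean_product_bound by linarith
  also have "\<dots> = (c + 1) * (bh * pi) * J" by (simp add: algebra_simps)
  finally show ?thesis unfolding Vd2_interior_eq[OF s] c_def .
qed

end

section \<open>\<open>Vd2\<close> as a Poisson integral\<close>

lemma abs_cos_diff_le: "\<bar>cos s - cos t\<bar> \<le> \<bar>s - t\<bar>"
  and abs_sin_diff_le: "\<bar>sin s - sin t\<bar> \<le> \<bar>s - t\<bar>" for s t :: real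
proof -
  have *: "\<bar>2 * c * sin x\<bar> \<le> \<bar>2 * x\<bar>" if "\<bar>c\<bar> \<le> 1" for c x :: real
  proof -
    have "\<bar>c\<bar> * \<bar>sin x\<bar> \<le> 1 * \<bar>x\<bar>" using that abs_sin_x_le_abs_x by (intro mult_mono) auto
    then show ?thesis by (simp add: abs_mult)
  qed
  show "\<bar>cos s - cos t\<bar> \<le> \<bar>s - t\<bar>"
    using *[of "sin ((s + t) / 2)" "(t - s) / 2"] by (simp add: cos_diff_cos abs_minus_commute)
  have "sin s - sin t = 2 * cos ((s + t) / 2) * sin ((s - t) / 2)" by (simp add: sin_diff_sin)
  then show "\<bar>sin s - sin t\<bar> \<le> \<bar>s - t\<bar>"
    using *[of "cos ((s + t) / 2)" "(s - t) / 2"] by simp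
qed

lemma abs_cs_diff: "\<bar>cs s - cs t\<bar> = 2 * \<bar>cos s - cos t\<bar>"
proof -
  have "cs s - cs t = - 2 * (cos s - cos t)" by (simp add: cs_def)
  then show ?thesis by (simp only: abs_mult)
qed

context test_functions
begin

text \<open>The sine is left over from the partial fractions. It makes the even function odd, which
  matches the minus sign between the two Poisson kernels.\<close>

definition H1 :: "real \<Rightarrow> real" where "H1 t = H t * sin t"

lemma H1_cont: "continuous_on S H1"
  unfolding H1_def by (intro continuous_intros H_cont)

lemma H1_measurable [measurable]: "H1 \<in> borel_measurable borel"
  using H1_cont by (rule borel_measurable_continuous_onI)

lemma H1_bound: "\<bar>H1 t\<bar> \<le> bh"
proof -
  have "\<bar>H t\<bar> * \<bar>sin t\<bar> \<le> bh * 1" using H_bound bounds_nonneg by (intro mult_mono) auto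
  then show ?thesis by (simp add: H1_def abs_mult)
qed

lemma Vd2_interior_poisson:
  assumes s: "\<bar>s\<bar> < 1" "s \<noteq> 0"
  shows "Vd2_interior f h s = 1 / (pi\<^sup>2 * s) *
    (LINT a|angle. F a * sin a * (LINT u|angle. (H1 (a + u) + H1 (a - u)) * poisson_kernel s (cos u))) - sc_mean f * sc_mean h"
proof -
  let ?k = "\<lambda>t. poisson_kernel s (cos t)"
  have "(LINT (a, u)|(angle \<Otimes>\<^sub>M angle). F a * H u * mean_kernel s a u) =
      (LINT z|(angle \<Otimes>\<^sub>M angle). 4 / s * (case z of (a, u) \<Rightarrow> F a * sin a * (H1 u * (?k (a - u) + (-1) * ?k (a + u)))))"
  proof (rule Bochner_Integration.integral_cong)
    fix z :: "real \<times> real"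
    obtain a u where z: "z = (a, u)" by force
    let ?P = "poisson_den s (cos (a - u)) * poisson_den s (cos (a + u))"
    have "mean_kernel s a u = 4 / s * sin a * sin u * (1 - s\<^sup>2) * (4 * s * sin a * sin u / ?P)"
      using s(2) by (simp add: mean_kernel_def power2_eq_square)
    also have "\<dots> = 4 / s * sin a * sin u * (1 - s\<^sup>2) * (1 / poisson_den s (cos (a - u)) - 1 / poisson_den s (cos (a + u)))"
      unfolding mean_kernel_angle(2)[OF s(1)] ..
    also have "\<dots> = 4 / s * sin a * sin u * (?k (a - u) + (-1) * ?k (a + u))"
    proof -
      have "X * D * (1 / p - 1 / q) = X * (D / p + (-1) * (D / q))" for X D p q :: real
        by (simp add: algebra_simps)
      then show ?thesis unfolding poisson_kernel_def .
    qed
    finally show "(case z of (a, u) \<Rightarrow> F a * H u * mean_kernel s a u) =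
        4 / s * (case z of (a, u) \<Rightarrow> F a * sin a * (H1 u * (?k (a - u) + (-1) * ?k (a + u))))"
      by (simp add: z H1_def)
  qed simp
  also have "\<dots> = 4 / s * (LINT (a, u)|(angle \<Otimes>\<^sub>M angle). F a * sin a * (H1 u * (?k (a - u) + (-1) * ?k (a + u))))"
    by simp
  also have "(LINT (a, u)|(angle \<Otimes>\<^sub>M angle). F a * sin a * (H1 u * (?k (a - u) + (-1) * ?k (a + u)))) =
      (LINT a|angle. F a * sin a * (LINT u|angle. (H1 (a + u) + H1 (a - u)) * ?k u))"
  proof (rule integral_angle2_convolution(1)[where bk="1 / (1 - \<bar>s\<bar>)\<^sup>2", OF _ _ H1_cont _ _ H1_bound poisson_kernel_continuous[OF s(1)]])
    show "\<bar>F t * sin t\<bar> \<le> bf" for t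
    proof -
      have "\<bar>F t\<bar> * \<bar>sin t\<bar> \<le> bf * 1" using F_bound bounds_nonneg by (intro mult_mono) auto
      then show ?thesis by (simp add: abs_mult)
    qed
    show "\<bar>?k t\<bar> \<le> 1 / (1 - \<bar>s\<bar>)\<^sup>2" for t by (rule poisson_kernel_bounded[OF _ s(1)]) simp
  qed (simp_all add: H1_def H_periodic H_even)
  finally show ?thesis unfolding Vd2_interior_eq[OF s(1)] by simp
qed

lemma sc_mean_h: "sc_mean h = 2 / pi * (LINT t|angle. H t * (sin t)\<^sup>2)"
proof -
  have "(LINT t|angle. h (cs t) * (sin t)\<^sup>2) = (LINT t|angle. H t * (sin t)\<^sup>2)"
    by (rule integral_cong_AE) (measurable, use H_AE in eventually_elim, simp)
  then show ?thesis unfolding sc_mean_angle[OF h_measurable] by simp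
qed

text \<open>The same substitution as for the trace, with two signs that cancel: one from the
  prefactor \<open>1 / s\<close>, one from shifting \<open>sin\<close> by \<open>pi\<close>. The
  semicircle mean is invariant under reflection.\<close>

lemma Vd2_interior_reflect:
  assumes s: "\<bar>s\<bar> < 1" "s \<noteq> 0"
  shows "Vd2_interior f h (- s) = Vd2_interior f (\<lambda>y. h (- y)) s"
proof -
  interpret R: test_functions f "\<lambda>y. h (- y)" f0 "\<lambda>y. h0 (- y)" bf bh by (rule reflected)
  have RH: "R.H t = H (t + pi)" "R.H t = H (t - pi)" for t
    by (simp_all add: R.H_def H_def cs_def)
  have RH': "R.H t = H (pi - t)" for t
    by (simp add: R.H_def H_def cs_def cos_diff)
  have RH1: "R.H1 t = - H1 (t + pi)" "R.H1 t = - H1 (t - pi)" for t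
    unfolding R.H1_def H1_def RH(1)[symmetric] RH(2)[symmetric] by simp_all
  have tk: "poisson_kernel (- s) (- c) = poisson_kernel s c" for c
    by (simp add: poisson_kernel_def poisson_den_def)
  have s2: "\<bar>- s\<bar> < 1" "- s \<noteq> 0" using s by auto
  have inner: "(LINT u|angle. (H1 (a + u) + H1 (a - u)) * poisson_kernel (- s) (cos u)) =
      - (LINT u|angle. (R.H1 (a + u) + R.H1 (a - u)) * poisson_kernel s (cos u))" for a
  proof -
    have "(LINT u|angle. (H1 (a + u) + H1 (a - u)) * poisson_kernel (- s) (cos u)) =
        (LINT u|angle. (H1 (a + (pi - u)) + H1 (a - (pi - u))) * poisson_kernel (- s) (cos (pi - u)))"
      by (rule integral_angle_reflect[symmetric])
         (intro continuous_intros poisson_kernel_continuous[OF s2(1)] continuous_on_compose2[OF H1_cont[of UNIV]]; simp)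
    also have "\<dots> = (LINT u|angle. - ((R.H1 (a + u) + R.H1 (a - u)) * poisson_kernel s (cos u)))"
    proof (rule Bochner_Integration.integral_cong)
      fix u
      have "H1 (a + (pi - u)) = - R.H1 (a - u)" unfolding RH1(1) by (simp add: algebra_simps)
      moreover have "H1 (a - (pi - u)) = - R.H1 (a + u)" unfolding RH1(2) by (simp add: algebra_simps)
      moreover have "poisson_kernel (- s) (cos (pi - u)) = poisson_kernel s (cos u)" by (simp add: tk)
      ultimately show "(H1 (a + (pi - u)) + H1 (a - (pi - u))) * poisson_kernel (- s) (cos (pi - u)) =
          - ((R.H1 (a + u) + R.H1 (a - u)) * poisson_kernel s (cos u))"
        by (simp only:) (simp add: algebra_simps)
    qed simp
    finally show ?thesis by simp
  qed
  have mean: "sc_mean (\<lambda>y. h (- y)) = sc_mean h"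
  proof -
    have "(LINT t|angle. H t * (sin t)\<^sup>2) = (LINT t|angle. H (pi - t) * (sin (pi - t))\<^sup>2)"
      by (rule integral_angle_reflect[symmetric]) (intro continuous_intros H_cont)
    then show ?thesis unfolding sc_mean_h R.sc_mean_h RH' by simp
  qed
  show ?thesis
    unfolding Vd2_interior_poisson[OF s2] R.Vd2_interior_poisson[OF s] inner mean by simp
qed

context
  fixes \<Lambda> :: real
  assumes lip: "\<And>x y. \<bar>h0 x - h0 y\<bar> \<le> \<Lambda> * \<bar>x - y\<bar>"
begin

lemma H1_lipschitz: "\<bar>H1 s - H1 t\<bar> \<le> (2 * \<Lambda> + bh) * \<bar>s - t\<bar>"
proof -
  have \<Lambda>0: "0 \<le> \<Lambda>" using lip[of 0 1] by simp
  note sc = abs_cos_diff_le[of s t] abs_sin_diff_le[of s t]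
  have "\<bar>H s - H t\<bar> \<le> \<Lambda> * \<bar>cs s - cs t\<bar>" unfolding H_def by (rule lip)
  also have "\<bar>cs s - cs t\<bar> = 2 * \<bar>cos s - cos t\<bar>" by (rule abs_cs_diff)
  also have "\<Lambda> * (2 * \<bar>cos s - cos t\<bar>) \<le> \<Lambda> * (2 * \<bar>s - t\<bar>)" using \<Lambda>0 sc by (intro mult_left_mono) auto
  finally have 1: "\<bar>H s - H t\<bar> \<le> \<Lambda> * (2 * \<bar>s - t\<bar>)" .
  have "H1 s - H1 t = (H s - H t) * sin s + H t * (sin s - sin t)" by (simp add: H1_def algebra_simps)
  also have "\<bar>\<dots>\<bar> \<le> \<bar>H s - H t\<bar> * \<bar>sin s\<bar> + \<bar>H t\<bar> * \<bar>sin s - sin t\<bar>"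
    unfolding abs_mult[symmetric] by (rule abs_triangle_ineq)
  also have "\<dots> \<le> \<Lambda> * (2 * \<bar>s - t\<bar>) * 1 + bh * \<bar>s - t\<bar>"
    using 1 sc H_bound bounds_nonneg \<Lambda>0 by (intro add_mono mult_mono) auto
  finally show ?thesis by (simp add: algebra_simps)
qed

text \<open>The Poisson kernels form an approximate identity of mass \<open>pi\<close> on the half
  period. The Lipschitz constant supplies the domination. For rescaled functions it grows with
  \<open>N\<close>, so it may serve the existence of the limit but must not enter a bound.\<close>

lemma poisson_integral_tendsto:
  assumes S: "\<And>n. 1 / 2 < S n" "\<And>n. S n < 1" "S \<longlonglongrightarrow> 1"
  shows "(\<lambda>n. LINT u|angle. (H1 (a + u) + H1 (a - u)) * poisson_kernel (S n) (cos u)) \<longlonglongrightarrow> 2 * H1 a * pi"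
proof -
  let ?k = "\<lambda>n u. poisson_kernel (S n) (cos u)"
  have S1: "\<bar>S n\<bar> < 1" for n using S(1)[of n] S(2)[of n] by auto
  have [measurable]: "(\<lambda>u. second_diff H1 a u) \<in> borel_measurable borel"
    unfolding second_diff_def by measurable
  have \<Lambda>0: "0 \<le> 2 * \<Lambda> + bh" using lip[of 0 1] bounds_nonneg by simp
  have lim: "(\<lambda>n. LINT u|angle. second_diff H1 a u * ?k n u) \<longlonglongrightarrow> (LINT u|angle. 0)"
  proof (rule integral_dominated_convergence[where w="\<lambda>_. 2 * (2 * \<Lambda> + bh) * 5"])
    show "AE u in angle. norm (second_diff H1 a u * ?k n u) \<le> 2 * (2 * \<Lambda> + bh) * 5" for n
      using AE_angle
    proof eventually_elim
      fix u assume u: "u \<in> {0..pi}"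
      have "\<bar>second_diff H1 a u\<bar> \<le> 2 * (2 * \<Lambda> + bh) * u"
        using H1_lipschitz[of "a + u" a] H1_lipschitz[of "a - u" a] u
        unfolding second_diff_def by (auto simp: algebra_simps)
      moreover have k0: "0 \<le> ?k n u" by (rule poisson_kernel_nonneg[OF _ S1]) simp
      ultimately have "\<bar>second_diff H1 a u\<bar> * ?k n u \<le> 2 * (2 * \<Lambda> + bh) * u * ?k n u"
        by (intro mult_right_mono)
      also have "\<dots> = 2 * (2 * \<Lambda> + bh) * (u * ?k n u)" by simp
      also have "\<dots> \<le> 2 * (2 * \<Lambda> + bh) * 5"
        using S(1)[of n] S(2)[of n] u \<Lambda>0 by (intro mult_left_mono poisson_kernel_moment) auto
      finally show "norm (second_diff H1 a u * ?k n u) \<le> 2 * (2 * \<Lambda> + bh) * 5"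
        using k0 by (simp add: abs_mult)
    qed
    show "AE u in angle. (\<lambda>n. second_diff H1 a u * ?k n u) \<longlonglongrightarrow> 0"
      using AE_angle
    proof eventually_elim
      fix u assume u: "u \<in> {0..pi}"
      show "(\<lambda>n. second_diff H1 a u * ?k n u) \<longlonglongrightarrow> 0"
      proof (cases "u = 0")
        case True
        then show ?thesis by (simp add: second_diff_def)
      next
        case False
        then have c: "cos u \<noteq> 1" using u cos_monotone_0_pi[of 0 u] by auto
        have "(\<lambda>n. second_diff H1 a u * ?k n u) \<longlonglongrightarrow> second_diff H1 a u * ((1 - 1\<^sup>2) / (1 + 1\<^sup>2 - 2 * 1 * cos u))"
          unfolding poisson_kernel_def poisson_den_def using c by (intro tendsto_intros S(3)) auto
        then show ?thesis by simp
      qed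
    qed
  qed (simp_all, measurable)
  have eq: "(LINT u|angle. (H1 (a + u) + H1 (a - u)) * ?k n u) = (LINT u|angle. second_diff H1 a u * ?k n u) + 2 * H1 a * pi" for n
  proof -
    have kb: "\<bar>?k n t\<bar> \<le> 1 / (1 - \<bar>S n\<bar>)\<^sup>2" for t by (rule poisson_kernel_bounded[OF _ S1]) simp
    have k0: "0 \<le> 1 / (1 - \<bar>S n\<bar>)\<^sup>2" by simp
    have i1: "integrable angle (\<lambda>u. second_diff H1 a u * ?k n u)"
    proof (rule integrable_angle_bounded)
      have "\<bar>second_diff H1 a u\<bar> \<le> 4 * bh" for u
        using H1_bound[of a] H1_bound[of "a + u"] H1_bound[of "a - u"] unfolding second_diff_def by linarith
      then show "\<bar>second_diff H1 a u * ?k n u\<bar> \<le> 4 * bh * (1 / (1 - \<bar>S n\<bar>)\<^sup>2)" for u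
        unfolding abs_mult using kb bounds_nonneg by (intro mult_mono) auto
    qed measurable
    have i2: "integrable angle (\<lambda>u. 2 * H1 a * ?k n u)"
      by (intro integrable_mult_right integrable_angle_bounded[OF _ kb]) measurable
    have "(LINT u|angle. (H1 (a + u) + H1 (a - u)) * ?k n u) = (LINT u|angle. second_diff H1 a u * ?k n u + 2 * H1 a * ?k n u)"
      by (intro Bochner_Integration.integral_cong) (auto simp: second_diff_def algebra_simps)
    also have "\<dots> = (LINT u|angle. second_diff H1 a u * ?k n u) + 2 * H1 a * (LINT u|angle. ?k n u)"
      using i1 i2 by (subst Bochner_Integration.integral_add) auto
    finally show ?thesis using integral_poisson_kernel[OF S1[of n]] by simp
  qed
  have "(\<lambda>n. (LINT u|angle. second_diff H1 a u * ?k n u) + 2 * H1 a * pi) \<longlonglongrightarrow> (LINT u|angle. 0) + 2 * H1 a * pi"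
    by (intro tendsto_intros lim)
  then show ?thesis unfolding eq by simp
qed

text \<open>Positivity and the total mass \<open>pi\<close> leave only the supremum of
  \<open>H1\<close>, uniformly in \<open>s\<close>.\<close>

lemma poisson_integral_bound:
  assumes s: "\<bar>s\<bar> < 1"
  shows "\<bar>LINT u|angle. (H1 (a + u) + H1 (a - u)) * poisson_kernel s (cos u)\<bar> \<le> 2 * bh * pi"
proof -
  have kb: "\<bar>poisson_kernel s (cos t)\<bar> \<le> 1 / (1 - \<bar>s\<bar>)\<^sup>2" for t by (rule poisson_kernel_bounded[OF _ s]) simp
  have "\<bar>LINT u|angle. (H1 (a + u) + H1 (a - u)) * poisson_kernel s (cos u)\<bar> \<le>
      (LINT u|angle. \<bar>(H1 (a + u) + H1 (a - u)) * poisson_kernel s (cos u)\<bar>)" by (rule integral_abs_bound)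
  also have "\<dots> \<le> (LINT u|angle. 2 * bh * poisson_kernel s (cos u))"
  proof (rule integral_mono')
    show "integrable angle (\<lambda>u. 2 * bh * poisson_kernel s (cos u))"
      by (intro integrable_mult_right integrable_angle_bounded[OF _ kb]) measurable
    have k0: "0 \<le> poisson_kernel s (cos u)" for u by (rule poisson_kernel_nonneg[OF _ s]) simp
    then show "0 \<le> 2 * bh * poisson_kernel s (cos u)" for u using bounds_nonneg by simp
    have "\<bar>H1 (a + u) + H1 (a - u)\<bar> \<le> 2 * bh" for u
      using H1_bound[of "a + u"] H1_bound[of "a - u"] by linarith
    then show "\<bar>(H1 (a + u) + H1 (a - u)) * poisson_kernel s (cos u)\<bar> \<le> 2 * bh * poisson_kernel s (cos u)" for u
      using k0[of u] by (auto simp: abs_mult intro!: mult_right_mono)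
  qed
  also have "\<dots> = 2 * bh * pi" using integral_poisson_kernel[OF s] by simp
  finally show ?thesis .
qed

lemma Vd2_interior_convergent: "\<exists>L. (Vd2_interior f h \<longlongrightarrow> L) (at_left 1)"
proof -
  define I where "I s a = (LINT u|angle. (H1 (a + u) + H1 (a - u)) * poisson_kernel s (cos u))" for s a
  define L where "L = 1 / (pi\<^sup>2 * 1) * (LINT a|angle. F a * sin a * (2 * H1 a * pi)) - sc_mean f * sc_mean h"
  have [measurable]: "I s \<in> borel_measurable borel" for s unfolding I_def by measurable
  have "(Vd2_interior f h \<longlongrightarrow> L) (at_left 1)"
  proof (rule tendsto_at_left_sequentially[of "1 / 2"])
    fix S :: "nat \<Rightarrow> real"
    assume S: "\<And>n. S n < 1" "\<And>n. 1 / 2 < S n" "S \<longlonglongrightarrow> 1"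
    have S1: "\<bar>S n\<bar> < 1" "S n \<noteq> 0" for n using S(1)[of n] S(2)[of n] by auto
    have "(\<lambda>n. LINT a|angle. F a * sin a * I (S n) a) \<longlonglongrightarrow> (LINT a|angle. F a * sin a * (2 * H1 a * pi))"
    proof (rule integral_dominated_convergence[where w="\<lambda>a. \<bar>F a\<bar> * (2 * bh * pi)"])
      show "integrable angle (\<lambda>a. \<bar>F a\<bar> * (2 * bh * pi))" using F_integrable by auto
      show "AE a in angle. (\<lambda>n. F a * sin a * I (S n) a) \<longlonglongrightarrow> F a * sin a * (2 * H1 a * pi)"
        unfolding I_def using poisson_integral_tendsto[OF S(2,1,3)] by (intro AE_I2 tendsto_intros) auto
      show "AE a in angle. norm (F a * sin a * I (S n) a) \<le> \<bar>F a\<bar> * (2 * bh * pi)" for n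
      proof (rule AE_I2)
        fix a
        have "\<bar>F a\<bar> * \<bar>sin a\<bar> * \<bar>I (S n) a\<bar> \<le> \<bar>F a\<bar> * 1 * (2 * bh * pi)"
          unfolding I_def by (intro mult_mono poisson_integral_bound S1) auto
        then show "norm (F a * sin a * I (S n) a) \<le> \<bar>F a\<bar> * (2 * bh * pi)" by (simp add: abs_mult)
      qed
    qed measurable
    then have "(\<lambda>n. 1 / (pi\<^sup>2 * S n) * (LINT a|angle. F a * sin a * I (S n) a) - sc_mean f * sc_mean h) \<longlonglongrightarrow> L"
      unfolding L_def by (intro tendsto_intros S(3)) auto
    moreover have "Vd2_interior f h (S n) = 1 / (pi\<^sup>2 * S n) * (LINT a|angle. F a * sin a * I (S n) a) - sc_mean f * sc_mean h" for n
      unfolding I_def by (rule Vd2_interior_poisson[OF S1])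
    ultimately show "(\<lambda>n. Vd2_interior f h (S n)) \<longlonglongrightarrow> L" by simp
  qed simp
  then show ?thesis ..
qed

text \<open>The condition \<open>s > 1 / 2\<close> keeps the prefactor
  \<open>1 / (pi ^ 2 * s)\<close> below \<open>2\<close>. In contrast to
  \<open>Vd2_interior_bound\<close> the constant stays bounded, so it passes to the limit
  \<open>s = 1\<close>.\<close>

lemma Vd2_interior_bound_near_1:
  assumes s: "1 / 2 < s" "s < 1"
  shows "\<bar>Vd2_interior f h s\<bar> \<le> (1 + 4) * (bh * pi) * J"
proof -
  have s': "\<bar>s\<bar> < 1" "s \<noteq> 0" using s by auto
  let ?I = "\<lambda>a. LINT u|angle. (H1 (a + u) + H1 (a - u)) * poisson_kernel s (cos u)"
  have "\<bar>LINT a|angle. F a * sin a * ?I a\<bar> \<le> (LINT a|angle. \<bar>F a * sin a * ?I a\<bar>)" by (rule integral_abs_bound)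
  also have "\<dots> \<le> (LINT a|angle. \<bar>F a\<bar> * (2 * bh * pi))"
  proof (rule integral_mono')
    show "integrable angle (\<lambda>a. \<bar>F a\<bar> * (2 * bh * pi))" using F_integrable by auto
    show "0 \<le> \<bar>F a\<bar> * (2 * bh * pi)" for a using bounds_nonneg by simp
    fix a
    have "\<bar>F a\<bar> * \<bar>sin a\<bar> * \<bar>?I a\<bar> \<le> \<bar>F a\<bar> * 1 * (2 * bh * pi)"
      by (intro mult_mono poisson_integral_bound s') auto
    then show "\<bar>F a * sin a * ?I a\<bar> \<le> \<bar>F a\<bar> * (2 * bh * pi)" by (simp add: abs_mult)
  qed
  also have "\<dots> = 2 * (bh * pi) * J" by (simp add: J_def)
  finally have 1: "\<bar>LINT a|angle. F a * sin a * ?I a\<bar> \<le> 2 * (bh * pi) * J" .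
  have "1 * (1 / 2) \<le> pi\<^sup>2 * s" using pi_ge_two s by (intro mult_mono one_le_power) auto
  then have "\<bar>1 / (pi\<^sup>2 * s)\<bar> \<le> 2" using s by (simp add: field_simps)
  then have "\<bar>1 / (pi\<^sup>2 * s) * (LINT a|angle. F a * sin a * ?I a)\<bar> \<le> 2 * (2 * (bh * pi) * J)"
    unfolding abs_mult using 1 by (intro mult_mono) auto
  then have "\<bar>1 / (pi\<^sup>2 * s) * (LINT a|angle. F a * sin a * ?I a) - sc_mean f * sc_mean h\<bar> \<le> 2 * (2 * (bh * pi) * J) + J * (bh * pi)"
    using sc_mean_product_bound by linarith
  also have "\<dots> = (1 + 4) * (bh * pi) * J" by (simp add: algebra_simps)
  finally show ?thesis unfolding Vd2_interior_poisson[OF s'] .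
qed

lemma Vd2_bound_1: "\<bar>Vd2 f h 1\<bar> \<le> 5 * (bh * pi) * J"
proof -
  obtain L where L: "(Vd2_interior f h \<longlongrightarrow> L) (at_left 1)" using Vd2_interior_convergent by blast
  then have "Vd2 f h 1 = L"
    by (simp add: Vd2_def extend_to_endpoints_def tendsto_Lim)
  moreover have "\<bar>L\<bar> \<le> 5 * (bh * pi) * J"
  proof (rule tendsto_upperbound[OF tendsto_rabs[OF L]])
    have "eventually (\<lambda>s. s \<in> {1/2<..<1::real}) (at_left 1)"
      by (rule eventually_at_leftI[of "1/2"]) auto
    then show "eventually (\<lambda>s. \<bar>Vd2_interior f h s\<bar> \<le> 5 * (bh * pi) * J) (at_left 1)"
      by eventually_elim (use Vd2_interior_bound_near_1 in auto)
  qed simp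
  ultimately show ?thesis by simp
qed

end

text \<open>For \<open>\<bar>s\<bar> = 1\<close> the quotient by zero is \<open>0\<close> and the
  constant becomes the \<open>5\<close> of \<open>Vd2_bound_1\<close>; in this way one formula
  covers the interior and both endpoints.\<close>

lemma Vd2_bound:
  assumes lip: "\<And>x y. \<bar>h0 x - h0 y\<bar> \<le> \<Lambda> * \<bar>x - y\<bar>" and s: "- 1 \<le> s" "s \<le> 1"
  shows "\<bar>Vd2 f h s\<bar> \<le> (16 / (1 - \<bar>s\<bar>) ^ 4 + 5) * (bh * pi) * J"
proof -
  have nn: "0 \<le> bh * pi * J" using bounds_nonneg J_nonneg by simp
  consider "s = 1" | "s = - 1" | "\<bar>s\<bar> < 1" using s by linarith
  then show ?thesis
  proof cases
    case 1
    then show ?thesis using Vd2_bound_1[OF lip] by simp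
  next
    case 2
    interpret R: test_functions f "\<lambda>y. h (- y)" f0 "\<lambda>y. h0 (- y)" bf bh by (rule reflected)
    have lipR: "\<bar>h0 (- x) - h0 (- y)\<bar> \<le> \<Lambda> * \<bar>x - y\<bar>" for x y
      using lip[of "- x" "- y"] by (simp add: abs_minus_commute)
    obtain L where L: "(Vd2_interior f (\<lambda>y. h (- y)) \<longlongrightarrow> L) (at_left 1)"
      using R.Vd2_interior_convergent[OF lipR] by blast
    have "Vd2 f h s = Vd2 f (\<lambda>y. h (- y)) 1"
      unfolding Vd2_def 2 by (rule extend_to_endpoints_reflect[OF L]) (rule Vd2_interior_reflect, auto)
    then show ?thesis using R.Vd2_bound_1[OF lipR] 2 by simp
  next
    case 3
    then have "Vd2 f h s = Vd2_interior f h s" by (auto simp: Vd2_def extend_to_endpoints_def)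
    moreover have "(16 / (1 - \<bar>s\<bar>) ^ 4 + 1) * (bh * pi * J) \<le> (16 / (1 - \<bar>s\<bar>) ^ 4 + 5) * (bh * pi * J)"
      using nn by (intro mult_right_mono) auto
    ultimately show ?thesis using Vd2_interior_bound[OF 3] by (simp add: mult.assoc)
  qed
qed

end

section \<open>Test functions on scale \<open>1 / n\<close>\<close>

text \<open>Up to \<open>c\<close>, the weight is the derivative of
  \<open>2 * arctan (sqrt (n * u))\<close>, whose total increase is at most \<open>pi\<close> for
  every \<open>n\<close>. It is singular at \<open>0\<close>, hence the fundamental theorem for
  nonnegative functions on an open interval. The indicator removes negative arguments, where the
  formula may change sign.\<close>

lemma integrable_angle_weight:
  fixes n c :: real
  assumes n: "0 < n" and c: "0 \<le> c"
  defines "w \<equiv> \<lambda>u. indicator {0<..} u * (c * n / (sqrt (n * u) * (1 + n * u)))"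
  shows "integrable angle w" "(LINT u|angle. w u) \<le> c * pi" "\<And>u. 0 \<le> w u"
proof -
  define v where "v u = n / (sqrt (n * u) * (1 + n * u))" for u
  define V where "V u = 2 * arctan (sqrt (n * u))" for u
  have d: "(V has_real_derivative v u) (at u)" if "0 < u" for u
  proof -
    have nu: "0 < n * u" using that n by simp
    have B: "((\<lambda>u. sqrt (n * u)) has_real_derivative inverse (sqrt (n * u)) / 2 * (n * 1)) (at u)"
      by (rule DERIV_chain2[where f=sqrt and g="\<lambda>u. n * u", OF DERIV_real_sqrt[OF nu]]) (intro DERIV_cmult DERIV_ident)
    have "((\<lambda>u. arctan (sqrt (n * u))) has_real_derivative
        inverse (1 + (sqrt (n * u))\<^sup>2) * (inverse (sqrt (n * u)) / 2 * (n * 1))) (at u)"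
      by (rule DERIV_chain2[where f=arctan and g="\<lambda>u. sqrt (n * u)", OF DERIV_arctan B])
    from DERIV_cmult[OF this, of 2]
    have "(V has_real_derivative 2 * (inverse (1 + (sqrt (n * u))\<^sup>2) * (inverse (sqrt (n * u)) / 2 * (n * 1)))) (at u)"
      unfolding V_def[abs_def] .
    moreover have "2 * (inverse (1 + (sqrt (n * u))\<^sup>2) * (inverse (sqrt (n * u)) / 2 * (n * 1))) = v u"
    proof -
      have "(sqrt (n * u))\<^sup>2 = n * u" using nu by simp
      moreover have "2 * (inverse p * (inverse q / 2 * (n * 1))) = n / (q * p)" for p q :: real
        by (simp add: inverse_eq_divide)
      ultimately show ?thesis unfolding v_def by (simp only:)
    qed
    ultimately show ?thesis by (simp only:)
  qed
  have a1: "isCont v x" if "ereal 0 < ereal x" "ereal x < ereal pi" for x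
  proof -
    have "0 < n * x" using that n by simp
    then have "sqrt (n * x) * (1 + n * x) \<noteq> 0" by auto
    then show ?thesis unfolding v_def by (intro continuous_intros)
  qed
  have v0: "0 \<le> v x" if "0 < x" for x
    unfolding v_def using n that by (intro divide_nonneg_nonneg mult_nonneg_nonneg add_nonneg_nonneg) auto
  have a2: "AE x in lborel. ereal 0 < ereal x \<longrightarrow> ereal x < ereal pi \<longrightarrow> 0 \<le> v x"
    by (intro AE_I2) (simp add: v0)
  have cV: "(V \<longlongrightarrow> V x) (at x)" for x
    unfolding V_def by (intro tendsto_intros)
  have a3: "((V \<circ> real_of_ereal) \<longlongrightarrow> V 0) (at_right (ereal 0))"
    unfolding ereal_tendsto_simps using cV[of 0] by (simp add: filterlim_at_split)
  have a4: "((V \<circ> real_of_ereal) \<longlongrightarrow> V pi) (at_left (ereal pi))"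
    unfolding ereal_tendsto_simps using cV[of pi] by (simp add: filterlim_at_split)
  have a5: "DERIV V x :> v x" if "ereal 0 < ereal x" "ereal x < ereal pi" for x
    using d[of x] that by simp
  have a6: "ereal 0 < ereal pi" by simp
  note FTC = interval_integral_FTC_nonneg[of "ereal 0" "ereal pi" V v "V 0" "V pi", OF a6 a5 a1 a2 a3 a4]
  have [measurable]: "v \<in> borel_measurable borel" "w \<in> borel_measurable borel"
    unfolding v_def w_def by measurable
  have ev: "einterval (ereal 0) (ereal pi) = {0<..<pi}" by (auto simp: einterval_def)
  have ae: "AE u in lborel. indicator {0<..<pi} u * (c * v u) = indicator {0..pi} u * w u"
  proof -
    have "AE u in lborel. u \<noteq> (pi::real)" by (rule AE_lborel_singleton)
    then show ?thesis by eventually_elim (auto simp: w_def v_def split: split_indicator)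
  qed
  have iv: "integrable lborel (\<lambda>u. indicator {0<..<pi} u * v u)"
    using FTC(1) unfolding ev set_integrable_def by simp
  then have "integrable lborel (\<lambda>u. c * (indicator {0<..<pi} u * v u))" by simp
  then have "integrable lborel (\<lambda>u. indicator {0<..<pi} u * (c * v u))" by (simp add: mult.left_commute)
  then have "integrable lborel (\<lambda>u. indicator {0..pi} u * w u)"
    by (rule integrable_cong_AE_imp[OF _ _ ae]) measurable
  then show "integrable angle w" by (subst integrable_angle_iff) auto
  have "(LINT u|angle. w u) = (LINT u|lborel. indicator {0..pi} u * w u)" by (rule integral_angle) simp
  also have "\<dots> = (LINT u|lborel. indicator {0<..<pi} u * (c * v u))"
    by (rule integral_cong_AE[OF _ _ ae, symmetric]) measurable
  also have "\<dots> = c * (LINT u|lborel. indicator {0<..<pi} u * v u)"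
    by (simp add: mult.left_commute)
  also have "(LINT u|lborel. indicator {0<..<pi} u * v u) = V pi - V 0"
    using FTC(2) by (simp add: interval_lebesgue_integral_def ev set_lebesgue_integral_def)
  also have "V pi - V 0 \<le> pi"
    using arctan_ubound[of "sqrt (n * pi)"] by (simp add: V_def)
  finally show "(LINT u|angle. w u) \<le> c * pi" using c by (simp add: mult_left_mono)
  show "0 \<le> w u" for u
    unfolding w_def using n c by (auto split: split_indicator intro!: divide_nonneg_nonneg mult_nonneg_nonneg add_nonneg_nonneg)
qed

text \<open>The exponent \<open>3 / 2\<close> at small \<open>n * u\<close> is what makes the bound integrable against \<open>1 / u\<^sup>2\<close>
  and avoids a logarithmic loss in \<^term>\<open>n\<close>.\<close>

lemma second_diff_le_of_holder_derivative:
  fixes h0 h' :: "real \<Rightarrow> real" and n B L K :: real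
  assumes n: "1 \<le> n" and d: "\<And>x. (h0 has_real_derivative h' x) (at x)"
    and B: "\<And>x. \<bar>h0 x\<bar> \<le> B" and L: "\<And>x. \<bar>h' x\<bar> \<le> L * n"
    and K: "\<And>x y. \<bar>h' x - h' y\<bar> \<le> K * n * sqrt (n * \<bar>x - y\<bar>)" and K0: "0 \<le> K"
    and u: "0 < u" "u \<le> pi"
  shows "\<bar>second_diff (\<lambda>t. h0 (cs t)) s u\<bar> \<le> (8 * (B + K + L)) * (n * u * sqrt (n * u) / (1 + n * u))"
proof -
  define \<tau> where "\<tau> = n * u"
  have \<tau>: "0 < \<tau>" "u \<le> \<tau>" using n u by (auto simp: \<tau>_def)
  have B0: "0 \<le> B" using B[of 0] by linarith
  have L0: "0 \<le> L"
  proof -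
    have "0 \<le> L * n" using L[of 0] by linarith
    then show ?thesis using n by (simp add: zero_le_mult_iff)
  qed
  let ?H = "\<lambda>t. h0 (cs t)" and ?H' = "\<lambda>t. 2 * sin t * h' (cs t)"
  have dH: "(?H has_real_derivative ?H' t) (at t)" for t
  proof -
    have "(cs has_real_derivative 2 * sin t) (at t)" unfolding cs_def by (auto intro!: derivative_eq_intros)
    from DERIV_chain2[OF d this] show ?thesis by (simp add: mult.commute)
  qed
  \<comment> \<open>A mean value on either side of \<open>s\<close> turns the second difference into
    \<open>u\<close> times a difference of derivatives at points at most \<open>2 * u\<close>
    apart.\<close>
  have mvt1: "\<exists>p. s < p \<and> p < s + u \<and> ?H (s + u) - ?H s = (s + u - s) * ?H' p"
    by (rule MVT2) (use u dH in auto)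
  have mvt2: "\<exists>q. s - u < q \<and> q < s \<and> ?H s - ?H (s - u) = (s - (s - u)) * ?H' q"
    by (rule MVT2) (use u dH in auto)
  obtain p q where p: "s < p" "p < s + u" "?H (s + u) - ?H s = u * ?H' p"
    and q: "s - u < q" "q < s" "?H s - ?H (s - u) = u * ?H' q"
    using mvt1 mvt2 by auto
  have eq: "second_diff ?H s u = u * (?H' p - ?H' q)"
    using p(3) q(3) by (simp add: second_diff_def right_diff_distrib)
  have pq: "\<bar>p - q\<bar> \<le> 2 * u" using p q by linarith
  have "\<bar>second_diff ?H s u\<bar> \<le> (8 * (B + K + L)) * (\<tau> * sqrt \<tau> / (1 + \<tau>))"
  \<comment> \<open>Above the scale \<open>1 / n\<close> the trivial bound \<open>4 * B\<close> is
    weakened to order \<open>sqrt \<tau>\<close>. This is still integrable against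
    \<open>1 / u ^ 2\<close> for large \<open>\<tau>\<close>, and it lets one formula serve both
    regimes.\<close>
  proof (cases "\<tau> \<le> 1")
    case True
    have 1: "\<bar>h' (cs p) - h' (cs q)\<bar> \<le> K * n * (2 * sqrt \<tau>)"
    proof -
      have "\<bar>cs p - cs q\<bar> \<le> 2 * \<bar>p - q\<bar>" using abs_cos_diff_le[of p q] by (simp add: abs_cs_diff)
      also have "\<dots> \<le> 2 * (2 * u)" using pq by (rule mult_left_mono) simp
      finally have "\<bar>cs p - cs q\<bar> \<le> 4 * u" by simp
      then have "n * \<bar>cs p - cs q\<bar> \<le> 4 * \<tau>" unfolding \<tau>_def using n by (simp add: mult.left_commute)
      then have "sqrt (n * \<bar>cs p - cs q\<bar>) \<le> sqrt (4 * \<tau>)" by simp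
      also have "\<dots> = 2 * sqrt \<tau>" by (simp add: real_sqrt_mult)
      finally have "K * n * sqrt (n * \<bar>cs p - cs q\<bar>) \<le> K * n * (2 * sqrt \<tau>)"
        using K0 n by (intro mult_left_mono) auto
      then show ?thesis using K[of "cs p" "cs q"] by linarith
    qed
    have "?H' p - ?H' q = 2 * sin p * (h' (cs p) - h' (cs q)) + 2 * (sin p - sin q) * h' (cs q)"
      by (simp add: algebra_simps)
    also have "\<bar>\<dots>\<bar> \<le> 2 * \<bar>sin p\<bar> * \<bar>h' (cs p) - h' (cs q)\<bar> + 2 * \<bar>sin p - sin q\<bar> * \<bar>h' (cs q)\<bar>"
      by (rule order.trans[OF abs_triangle_ineq]) (simp only: abs_mult abs_numeral order_refl)
    also have "\<dots> \<le> 2 * 1 * (K * n * (2 * sqrt \<tau>)) + 2 * (2 * u) * (L * n)"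
      using 1 L K0 L0 n u \<tau> order.trans[OF abs_sin_diff_le pq] by (intro add_mono mult_mono) auto
    also have "\<dots> = 4 * K * n * sqrt \<tau> + 4 * L * n * u" by simp
    finally have "u * \<bar>?H' p - ?H' q\<bar> \<le> u * (4 * K * n * sqrt \<tau> + 4 * L * n * u)"
      by (rule mult_left_mono) (use u in simp)
    then have "\<bar>second_diff ?H s u\<bar> \<le> u * (4 * K * n * sqrt \<tau> + 4 * L * n * u)"
      unfolding eq abs_mult using u by simp
    also have "\<dots> = 4 * K * (\<tau> * sqrt \<tau>) + 4 * L * (\<tau> * u)" by (simp add: \<tau>_def algebra_simps)
    \<comment> \<open>The term in \<open>L\<close> comes from differentiating \<open>sin\<close>.
      Since \<open>u \<le> \<tau> \<le> sqrt \<tau>\<close> in this regime, it is no larger than the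
      Hoelder term.\<close>
    also have "\<dots> \<le> 4 * K * (\<tau> * sqrt \<tau>) + 4 * L * (\<tau> * sqrt \<tau>)"
    proof -
      have "\<tau> \<le> sqrt \<tau>" using True \<tau> by (simp add: real_le_rsqrt power2_eq_square mult_left_le)
      then show ?thesis using \<tau> L0 by (intro add_left_mono mult_left_mono) auto
    qed
    also have "\<dots> \<le> 4 * (B + K + L) * (\<tau> * sqrt \<tau>)"
      using B0 \<tau> by (simp add: algebra_simps)
    also have "\<dots> \<le> 8 * (B + K + L) * (\<tau> * sqrt \<tau> / (1 + \<tau>))"
    proof -
      have "\<tau> * sqrt \<tau> / 2 \<le> \<tau> * sqrt \<tau> / (1 + \<tau>)" using True \<tau> by (intro divide_left_mono) auto
      then have "8 * (B + K + L) * (\<tau> * sqrt \<tau> / 2) \<le> 8 * (B + K + L) * (\<tau> * sqrt \<tau> / (1 + \<tau>))"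
        using B0 K0 L0 by (intro mult_left_mono) auto
      moreover have "4 * X * y = 8 * X * (y / 2)" for X y :: real by simp
      ultimately show ?thesis by (simp only:)
    qed
    finally show ?thesis .
  next
    case False
    have "\<bar>second_diff ?H s u\<bar> \<le> 4 * B"
      using B[of "cs (s + u)"] B[of "cs (s - u)"] B[of "cs s"] unfolding second_diff_def by linarith
    also have "\<dots> \<le> 4 * (B + K + L)" using K0 L0 by simp
    also have "\<dots> = 8 * (B + K + L) * (1 / 2)" by simp
    also have "\<dots> \<le> 8 * (B + K + L) * (\<tau> * sqrt \<tau> / (1 + \<tau>))"
    proof -
      have "1 \<le> sqrt \<tau>" using False by simp
      then have "\<tau> \<le> \<tau> * sqrt \<tau>" using \<tau> by simp
      then have "1 + \<tau> \<le> 2 * (\<tau> * sqrt \<tau>)" using False by linarith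
      then have "1 / 2 \<le> \<tau> * sqrt \<tau> / (1 + \<tau>)" using \<tau> by (simp add: field_simps)
      then show ?thesis using B0 K0 L0 by (intro mult_left_mono) auto
    qed
    finally show ?thesis .
  qed
  then show ?thesis by (simp add: \<tau>_def)
qed

text \<open>Dividing the second difference bound by \<open>1 - cos u \<ge> u ^ 2 / 18\<close> leaves
  the integrable weight; \<open>144\<close> is \<open>8 * 18\<close>. Of the two powers of
  \<open>n\<close> in \<open>(n * u) ^ 2\<close>, one is used up by the scaling of the weight and
  the other remains in its mass.\<close>

lemma second_diff_weight:
  fixes h0 h' :: "real \<Rightarrow> real" and n B L K :: real
  assumes n: "1 \<le> n" and d: "\<And>x. (h0 has_real_derivative h' x) (at x)"
    and B: "\<And>x. \<bar>h0 x\<bar> \<le> B" and L: "\<And>x. \<bar>h' x\<bar> \<le> L * n"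
    and K: "\<And>x y. \<bar>h' x - h' y\<bar> \<le> K * n * sqrt (n * \<bar>x - y\<bar>)" and K0: "0 \<le> K"
  obtains w where "integrable angle w" "\<And>u. 0 \<le> w u"
    "\<And>s u. u \<in> {0..pi} \<Longrightarrow> \<bar>second_diff (\<lambda>t. h0 (cs t)) s u\<bar> \<le> w u * (1 - cos u)"
    "(LINT u|angle. w u) \<le> 144 * pi * (B + K + L) * n"
proof -
  define c where "c = 144 * (B + K + L) * n"
  have B0: "0 \<le> B" using B[of 0] by linarith
  have L0: "0 \<le> L"
  proof -
    have "0 \<le> L * n" using L[of 0] by linarith
    then show ?thesis using n by (simp add: zero_le_mult_iff)
  qed
  have c0: "0 \<le> c" using B0 L0 K0 n by (simp add: c_def)
  have n0: "0 < n" using n by simp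
  define w where "w = (\<lambda>u. indicator {0<..} u * (c * n / (sqrt (n * u) * (1 + n * u))))"
  have wp: "integrable angle w" "(LINT u|angle. w u) \<le> c * pi" "\<And>u. 0 \<le> w u"
    unfolding w_def by (rule integrable_angle_weight[OF n0 c0])+
  have sd: "\<bar>second_diff (\<lambda>t. h0 (cs t)) s u\<bar> \<le> w u * (1 - cos u)" if u: "u \<in> {0..pi}" for s u
  proof (cases "u = 0")
    case True
    then show ?thesis by (simp add: second_diff_def)
  next
    case False
    define \<tau> where "\<tau> = n * u"
    have u': "0 < u" "u \<le> pi" and \<tau>: "0 < \<tau>" using u False n0 by (auto simp: \<tau>_def)
    have "\<tau> * sqrt \<tau> = \<tau>\<^sup>2 / sqrt \<tau>"
    proof -
      have "\<tau>\<^sup>2 / sqrt \<tau> = \<tau> * (\<tau> / sqrt \<tau>)" by (simp add: power2_eq_square)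
      then show ?thesis using \<tau> by (simp add: real_div_sqrt)
    qed
    then have "8 * (B + K + L) * (\<tau> * sqrt \<tau> / (1 + \<tau>)) = 8 * (B + K + L) * (\<tau>\<^sup>2 / sqrt \<tau> / (1 + \<tau>))"
      by simp
    also have "\<dots> = c * n / (sqrt \<tau> * (1 + \<tau>)) * (u\<^sup>2 / 18)"
    proof -
      have num: "c * n * (u\<^sup>2 / 18) = 8 * (B + K + L) * \<tau>\<^sup>2"
      proof -
        have "144 * X * n * n * (v / 18) = 8 * X * (n * n * v)" for X v :: real by simp
        then show ?thesis by (simp only: c_def \<tau>_def power_mult_distrib power2_eq_square[of n])
      qed
      have "8 * (B + K + L) * (\<tau>\<^sup>2 / sqrt \<tau> / (1 + \<tau>)) = 8 * (B + K + L) * \<tau>\<^sup>2 / (sqrt \<tau> * (1 + \<tau>))"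
        by simp
      also have "\<dots> = c * n * (u\<^sup>2 / 18) / (sqrt \<tau> * (1 + \<tau>))" by (simp only: num)
      finally show ?thesis by simp
    qed
    also have "\<dots> \<le> c * n / (sqrt \<tau> * (1 + \<tau>)) * (1 - cos u)"
      using c0 n0 \<tau> one_minus_cos_ge[of u] u' by (intro mult_left_mono) auto
    also have "\<dots> = w u * (1 - cos u)" using u' by (simp add: w_def \<tau>_def)
    finally show ?thesis
      using second_diff_le_of_holder_derivative[OF n d B L K K0 u', of s] by (simp add: \<tau>_def)
  qed
  have "c * pi = 144 * pi * (B + K + L) * n" by (simp add: c_def)
  with wp(2) show thesis by (intro that[OF wp(1,3) sd]) simp_all
qed

section \<open>The finer function and the normalisation in the bulk\<close>

lemma bulk_distance:
  fixes x \<epsilon> :: real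
  assumes "0 < \<epsilon>" "\<epsilon> \<le> 2" "\<bar>x\<bar> \<le> 2 - \<epsilon> / 2"
  shows "\<epsilon> \<le> 4 - x\<^sup>2"
proof -
  have "\<bar>x\<bar>\<^sup>2 \<le> (2 - \<epsilon> / 2)\<^sup>2" using assms by (intro power_mono) auto
  then have "x\<^sup>2 \<le> (2 - \<epsilon> / 2)\<^sup>2" by simp
  moreover have "(2 - \<epsilon> / 2)\<^sup>2 = 4 - 2 * \<epsilon> + \<epsilon> * \<epsilon> / 4" by (simp add: power2_eq_square algebra_simps)
  moreover have "\<epsilon> * \<epsilon> \<le> 2 * \<epsilon>" using assms by (intro mult_right_mono) auto
  ultimately show ?thesis using assms by linarith
qed

text \<open>If the support, of radius \<open>R / n\<close>, stays within
  \<open>\<epsilon> / 2\<close> of \<open>E\<close>, the arcsine density on it is at most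
  \<open>1 / sqrt \<epsilon>\<close>. Otherwise \<open>n < 2 * R / \<epsilon>\<close>, and the
  trivial bound costs only a constant. The two constants are added.\<close>

lemma integral_angle_rescaled:
  fixes G :: "real \<Rightarrow> real"
  assumes G: "continuous_on UNIV G" "\<And>x. \<bar>G x\<bar> \<le> B" "\<And>x. R \<le> \<bar>x\<bar> \<Longrightarrow> G x = 0" and R: "0 < R"
    and \<epsilon>: "0 < \<epsilon>" and E: "E \<in> {-2 + \<epsilon>..2 - \<epsilon>}" and n: "1 \<le> n"
  shows "(LINT t|angle. \<bar>G (n * (cs t - E))\<bar>) \<le> (2 * R * B / sqrt \<epsilon> + 2 * pi * R * B / \<epsilon>) / n"
proof -
  have B0: "0 \<le> B" using G(2)[of 0] by linarith
  have n0: "0 < n" using n by simp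
  have [measurable]: "G \<in> borel_measurable borel" using G(1) by (rule borel_measurable_continuous_onI)
  show ?thesis
  proof (cases "n * \<epsilon> < 2 * R")
    case True
    have "(LINT t|angle. \<bar>G (n * (cs t - E))\<bar>) \<le> (LINT t|angle. B)"
      using G(2) B0 by (intro integral_mono') auto
    also have "\<dots> = pi * B * 1" by simp
    also have "\<dots> \<le> pi * B * (2 * R / (n * \<epsilon>))"
      using True \<epsilon> n0 B0 by (intro mult_left_mono) auto
    also have "\<dots> = (0 + 2 * pi * R * B / \<epsilon>) / n" by (simp add: mult_ac)
    also have "\<dots> \<le> (2 * R * B / sqrt \<epsilon> + 2 * pi * R * B / \<epsilon>) / n"
      using R B0 \<epsilon> n0 by (intro divide_right_mono add_right_mono) auto
    finally show ?thesis .
  next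
    case False
    then have Rn: "R / n \<le> \<epsilon> / 2" using n0 \<epsilon> by (simp add: field_simps)
    have \<epsilon>2: "\<epsilon> \<le> 2" using E by auto
    let ?A = "{E - R / n..E + R / n}"
    have "(LINT t|angle. \<bar>G (n * (cs t - E))\<bar>) = (LINT x:{-2..2}|lborel. \<bar>G (n * (x - E))\<bar> / sqrt (4 - x\<^sup>2))"
      by (rule integral_arc[symmetric]) measurable
    also have "\<dots> \<le> (LINT x|lborel. B / sqrt \<epsilon> * indicator ?A x)"
      unfolding set_lebesgue_integral_def
    proof (rule integral_mono')
      show "integrable lborel (\<lambda>x. B / sqrt \<epsilon> * indicator ?A x)"
        by (intro integrable_mult_right integrable_real_indicator) (auto simp: emeasure_lborel_Icc_eq)
      show "0 \<le> B / sqrt \<epsilon> * indicator ?A x" for x using B0 \<epsilon> by (auto split: split_indicator)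
      fix x
      show "indicator {-2..2} x *\<^sub>R (\<bar>G (n * (x - E))\<bar> / sqrt (4 - x\<^sup>2)) \<le> B / sqrt \<epsilon> * indicator ?A x"
      proof (cases "x \<in> ?A")
        case True
        then have "\<bar>x\<bar> \<le> 2 - \<epsilon> / 2" using Rn E unfolding abs_le_iff atLeastAtMost_iff by linarith
        then have "\<epsilon> \<le> 4 - x\<^sup>2" by (rule bulk_distance[OF \<epsilon> \<epsilon>2])
        then have "\<bar>G (n * (x - E))\<bar> / sqrt (4 - x\<^sup>2) \<le> B / sqrt \<epsilon>"
          using \<epsilon> G(2) B0 by (intro frac_le) auto
        then show ?thesis using True B0 \<epsilon> by (auto split: split_indicator)
      next
        case False
        then have "R / n \<le> \<bar>x - E\<bar>" by (auto simp: abs_if)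
        then have "R \<le> n * \<bar>x - E\<bar>" using n0 by (simp add: field_simps)
        also have "\<dots> = \<bar>n * (x - E)\<bar>" using n0 by (simp only: abs_mult abs_of_pos)
        finally have "R \<le> \<bar>n * (x - E)\<bar>" .
        then show ?thesis using G(3) False by simp
      qed
    qed
    also have "\<dots> = B / sqrt \<epsilon> * (2 * R / n)" using R n0 by simp
    also have "\<dots> = (2 * R * B / sqrt \<epsilon> + 0) / n" by (simp add: mult_ac)
    also have "\<dots> \<le> (2 * R * B / sqrt \<epsilon> + 2 * pi * R * B / \<epsilon>) / n"
      using R B0 \<epsilon> n0 by (intro divide_right_mono add_left_mono) auto
    finally show ?thesis .
  qed
qed

lemma rho_sc_ge:
  assumes \<epsilon>: "0 < \<epsilon>" and E: "E \<in> {-2 + \<epsilon>..2 - \<epsilon>}" and \<eta>: "0 < \<eta>" "\<eta> \<le> 1"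
  shows "\<epsilon> * sqrt \<epsilon> / (4 * pi\<^sup>2) \<le> rho_sc (Complex E \<eta>)"
proof -
  let ?z = "Complex E \<eta>"
  let ?f = "\<lambda>x. complex_of_real (sqrt (4 - x\<^sup>2)) / (2 * complex_of_real pi * (complex_of_real x - ?z))"
  have \<epsilon>2: "\<epsilon> \<le> 2" using E by auto
  have ne: "complex_of_real x - ?z \<noteq> 0" for x using \<eta> by (auto simp: complex_eq_iff)
  have "set_integrable lborel {-2..2} ?f"
    unfolding set_integrable_def using ne
    by (intro borel_integrable_compact continuous_intros) auto
  then have int: "integrable lborel (\<lambda>x. indicator {-2..2} x *\<^sub>R ?f x)" by (simp add: set_integrable_def)
  have Imf: "Im (?f x) = sqrt (4 - x\<^sup>2) / (2 * pi) * (\<eta> / ((x - E)\<^sup>2 + \<eta>\<^sup>2))" for x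
  proof -
    let ?w = "complex_of_real x - ?z"
    have "?f x = complex_of_real (sqrt (4 - x\<^sup>2) / (2 * pi)) * inverse ?w"
      by (simp add: inverse_eq_divide)
    moreover have "Im (complex_of_real r * y) = r * Im y" for r y by simp
    moreover have "Im (inverse ?w) = \<eta> / ((x - E)\<^sup>2 + \<eta>\<^sup>2)" by simp
    ultimately show ?thesis by (simp only:)
  qed
  \<comment> \<open>Half-width of a window around \<open>E\<close> that is below
    \<open>\<epsilon> / 2\<close>, so that it stays in the bulk, and below \<open>\<eta>\<close>, so
    that \<open>\<eta> / ((x - E) ^ 2 + \<eta> ^ 2)\<close> is at least
    \<open>1 / (2 * \<eta>)\<close> on it. The rest of the integral is dropped by
    positivity.\<close>
  define \<kappa> where "\<kappa> = \<epsilon> / 2 * \<eta>"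
  let ?A = "{E - \<kappa>..E + \<kappa>}"
  have "\<epsilon> * \<eta> \<le> \<epsilon>" "\<epsilon> * \<eta> \<le> 2 * \<eta>" using \<eta> \<epsilon> \<epsilon>2 by (auto intro: mult_left_le mult_right_mono)
  then have \<kappa>: "0 < \<kappa>" "\<kappa> \<le> \<epsilon> / 2" "\<kappa> \<le> \<eta>" using \<epsilon> \<eta> by (auto simp: \<kappa>_def)
  have "\<epsilon> * sqrt \<epsilon> / (4 * pi) = sqrt \<epsilon> / (2 * pi) * (1 / (2 * \<eta>)) * (2 * \<kappa>)"
    using \<eta> by (simp add: \<kappa>_def field_simps)
  also have "\<dots> = (LINT x|lborel. sqrt \<epsilon> / (2 * pi) * (1 / (2 * \<eta>)) * indicator ?A x)"
    using \<kappa> by simp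
  also have "\<dots> \<le> (LINT x|lborel. Im (indicator {-2..2} x *\<^sub>R ?f x))"
  proof (rule integral_mono)
    show "integrable lborel (\<lambda>x. sqrt \<epsilon> / (2 * pi) * (1 / (2 * \<eta>)) * indicator ?A x)"
      by (intro integrable_mult_right integrable_real_indicator) (auto simp: emeasure_lborel_Icc_eq)
    show "integrable lborel (\<lambda>x. Im (indicator {-2..2} x *\<^sub>R ?f x))" using int by (rule integrable_Im)
    fix x :: real
    have nn: "0 \<le> Im (indicator {-2..2} x *\<^sub>R ?f x)"
    proof (cases "x \<in> {-2..2}")
      case True
      then have "0 \<le> sqrt (4 - x\<^sup>2)" using sq_le_4[of x] by auto
      then have "0 \<le> Im (?f x)" unfolding Imf using \<eta>
        by (intro mult_nonneg_nonneg divide_nonneg_nonneg) auto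
      then show ?thesis using True by simp
    qed simp
    show "sqrt \<epsilon> / (2 * pi) * (1 / (2 * \<eta>)) * indicator ?A x \<le> Im (indicator {-2..2} x *\<^sub>R ?f x)"
    proof (cases "x \<in> ?A")
      case True
      have x: "x \<in> {-2..2}" using True \<kappa> E \<epsilon> by auto
      have "\<bar>x\<bar> \<le> 2 - \<epsilon> / 2" using True \<kappa> E unfolding abs_le_iff atLeastAtMost_iff by linarith
      then have s: "\<epsilon> \<le> 4 - x\<^sup>2" by (rule bulk_distance[OF \<epsilon> \<epsilon>2])
      have "\<bar>x - E\<bar> \<le> \<eta>" using True \<kappa> by (auto simp: abs_le_iff)
      then have "\<bar>x - E\<bar>\<^sup>2 \<le> \<eta>\<^sup>2" by (intro power_mono) auto
      then have den: "(x - E)\<^sup>2 + \<eta>\<^sup>2 \<le> 2 * \<eta>\<^sup>2" by simp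
      have pos: "0 < (x - E)\<^sup>2 + \<eta>\<^sup>2" using \<eta> by (intro add_nonneg_pos) auto
      have "1 / (2 * \<eta>) = \<eta> / (2 * \<eta>\<^sup>2)" using \<eta> by (simp add: power2_eq_square)
      also have "\<dots> \<le> \<eta> / ((x - E)\<^sup>2 + \<eta>\<^sup>2)" using den pos \<eta> by (intro divide_left_mono) auto
      finally have "sqrt \<epsilon> / (2 * pi) * (1 / (2 * \<eta>)) \<le> sqrt (4 - x\<^sup>2) / (2 * pi) * (\<eta> / ((x - E)\<^sup>2 + \<eta>\<^sup>2))"
        using s \<epsilon> \<eta> by (intro mult_mono divide_right_mono) auto
      then show ?thesis using True x Imf[of x] by simp
    next
      case False
      then show ?thesis using nn by simp
    qed
  qed
  also have "\<dots> = Im (m_sc ?z)"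
    unfolding m_sc_def set_lebesgue_integral_def by (rule integral_Im[OF int])
  finally have "\<epsilon> * sqrt \<epsilon> / (4 * pi) / pi \<le> \<bar>Im (m_sc ?z)\<bar> / pi" by (intro divide_right_mono) auto
  then show ?thesis unfolding rho_sc_def by (simp add: power2_eq_square)
qed

text \<open>The summand \<open>1\<close> in the constant is for \<open>a = 0\<close>, where
  \<open>C_scale\<close> is \<open>1\<close> by convention.\<close>

lemma C_scale_bound:
  assumes \<epsilon>: "0 < \<epsilon>" and E: "E \<in> {-2 + \<epsilon>..2 - \<epsilon>}" and N: "1 \<le> N" and a: "0 \<le> a"
  shows "0 \<le> C_scale N a E" and "C_scale N a E \<le> (4 * pi\<^sup>2 / (\<epsilon> * sqrt \<epsilon>) + 1) * real N powr a"
proof -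
  have N1: "1 \<le> real N" using N by simp
  have c0: "0 \<le> 4 * pi\<^sup>2 / (\<epsilon> * sqrt \<epsilon>)" using \<epsilon> by simp
  have \<eta>: "0 < real N powr (- a)" "real N powr (- a) \<le> 1"
    using N1 a powr_mono[of "- a" 0 "real N"] by auto
  define r where "r = rho_sc (Complex E (real N powr (- a)))"
  have r: "\<epsilon> * sqrt \<epsilon> / (4 * pi\<^sup>2) \<le> r" unfolding r_def by (rule rho_sc_ge[OF \<epsilon> E \<eta>])
  have l0: "0 < \<epsilon> * sqrt \<epsilon> / (4 * pi\<^sup>2)" using \<epsilon> by simp
  then have r0: "0 < r" using r by linarith
  show "0 \<le> C_scale N a E" unfolding C_scale_def r_def[symmetric] using r0 by simp
  show "C_scale N a E \<le> (4 * pi\<^sup>2 / (\<epsilon> * sqrt \<epsilon>) + 1) * real N powr a"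
  proof (cases "a = 0")
    case True
    then show ?thesis using c0 N by (simp add: C_scale_def)
  next
    case False
    have "real N powr a / r \<le> real N powr a / (\<epsilon> * sqrt \<epsilon> / (4 * pi\<^sup>2))"
      using r r0 l0 by (intro divide_left_mono mult_pos_pos) auto
    also have "\<dots> = 4 * pi\<^sup>2 / (\<epsilon> * sqrt \<epsilon>) * real N powr a" by simp
    also have "\<dots> \<le> (4 * pi\<^sup>2 / (\<epsilon> * sqrt \<epsilon>) + 1) * real N powr a" by (intro mult_right_mono) auto
    finally show ?thesis using False by (simp add: C_scale_def r_def)
  qed
qed

section \<open>Matrices and rescaled functions\<close>

lemma bounded_affine_image:
  fixes S :: "real set"
  assumes "bounded S"
  shows "bounded ((\<lambda>x. t + n * x) ` S)"
proof -
  obtain M where M: "\<And>x. x \<in> S \<Longrightarrow> \<bar>x\<bar> \<le> M" using assms by (auto simp: bounded_real)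
  have "\<bar>t + n * x\<bar> \<le> \<bar>t\<bar> + \<bar>n\<bar> * M" if "x \<in> S" for x
  proof -
    have "\<bar>t + n * x\<bar> \<le> \<bar>t\<bar> + \<bar>n\<bar> * \<bar>x\<bar>" by (metis abs_mult abs_triangle_ineq)
    also have "\<dots> \<le> \<bar>t\<bar> + \<bar>n\<bar> * M" using M[OF that] by (intro add_left_mono mult_left_mono) auto
    finally show ?thesis .
  qed
  then show ?thesis unfolding bounded_real by blast
qed

lemma L2_fun_affine:
  assumes "L2_fun f" "n \<noteq> 0"
  shows "L2_fun (\<lambda>x. k * f (t + n * x))"
proof -
  have [measurable]: "f \<in> borel_measurable borel" and i: "integrable lborel (\<lambda>x. (f x)\<^sup>2)"
    using assms by (auto simp: L2_fun_def)
  have "integrable lborel (\<lambda>x. k\<^sup>2 * (f (t + n * x))\<^sup>2)"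
    using lborel_integrable_real_affine[OF i assms(2), of t] by simp
  then show ?thesis unfolding L2_fun_def by (simp add: power_mult_distrib)
qed

text \<open>By substitution, testing the rescaled function against \<open>\<phi>\<close> amounts to
  testing \<open>f\<close> against \<open>\<phi>\<close> composed with the inverse affine map, which
  is again an admissible test function.\<close>

lemma has_weak_derivative_affine:
  assumes weak: "has_weak_derivative f f'" and n: "0 < n"
  shows "has_weak_derivative (\<lambda>x. k * f (t + n * x)) (\<lambda>x. k * n * f' (t + n * x))"
  unfolding has_weak_derivative_def
proof (intro allI impI)
  fix \<phi> :: "real \<Rightarrow> real"
  assume C1: "\<phi> C1_differentiable_on UNIV" and cpt: "compactly_supported \<phi>"
  obtain D where D: "\<And>x. (\<phi> has_real_derivative D x) (at x)" "continuous_on UNIV D"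
    using C1 unfolding C1_differentiable_on_def has_real_derivative_iff_has_vector_derivative by auto
  define \<psi> where "\<psi> y = \<phi> ((y - t) / n)" for y
  have d\<psi>: "(\<psi> has_real_derivative D ((y - t) / n) / n) (at y)" for y
  proof -
    have "((\<lambda>y. (y - t) / n) has_real_derivative 1 / n) (at y)"
      using n by (auto intro!: derivative_eq_intros)
    from DERIV_chain2[where f=\<phi> and g="\<lambda>y. (y - t) / n", OF D(1) this] show ?thesis
      unfolding \<psi>_def[abs_def] by simp
  qed
  have "\<psi> C1_differentiable_on UNIV"
    unfolding C1_differentiable_on_def has_real_derivative_iff_has_vector_derivative[symmetric]
  proof (intro exI conjI ballI)
    show "(\<psi> has_real_derivative D ((y - t) / n) / n) (at y)" for y by (rule d\<psi>)
    show "continuous_on UNIV (\<lambda>y. D ((y - t) / n) / n)"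
      using n by (intro continuous_intros continuous_on_compose2[OF D(2)]) auto
  qed
  moreover have "compactly_supported \<psi>"
    unfolding compactly_supported_def compact_closure
  proof (rule bounded_subset)
    have "bounded {x. \<phi> x \<noteq> 0}" using cpt by (simp add: compactly_supported_def)
    then show "bounded ((\<lambda>x. t + n * x) ` {x. \<phi> x \<noteq> 0})" by (rule bounded_affine_image)
    show "{y. \<psi> y \<noteq> 0} \<subseteq> (\<lambda>x. t + n * x) ` {x. \<phi> x \<noteq> 0}"
    proof
      fix y assume "y \<in> {y. \<psi> y \<noteq> 0}"
      then show "y \<in> (\<lambda>x. t + n * x) ` {x. \<phi> x \<noteq> 0}"
        using n by (intro image_eqI[where x="(y - t) / n"]) (auto simp: \<psi>_def)
    qed
  qed
  ultimately have w: "(LINT y|lborel. f y * deriv \<psi> y) = - (LINT y|lborel. f' y * \<psi> y)"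
    using weak unfolding has_weak_derivative_def by blast
  have d: "deriv \<phi> x = D x" "deriv \<psi> y = D ((y - t) / n) / n" for x y
    using D(1) d\<psi> by (auto intro: DERIV_imp_deriv)
  have 1: "(LINT y|lborel. f y * deriv \<psi> y) = (LINT x|lborel. f (t + n * x) * D x)"
    by (subst lborel_integral_real_affine[of n _ t]) (use n in \<open>simp_all add: d\<close>)
  have 2: "(LINT y|lborel. f' y * \<psi> y) = n * (LINT x|lborel. f' (t + n * x) * \<phi> x)"
    by (subst lborel_integral_real_affine[of n _ t]) (use n in \<open>simp_all add: \<psi>_def\<close>)
  have "(LINT x|lborel. k * f (t + n * x) * deriv \<phi> x) = k * (LINT x|lborel. f (t + n * x) * D x)"
    by (simp add: d mult.assoc)
  also have "\<dots> = k * (- (n * (LINT x|lborel. f' (t + n * x) * \<phi> x)))" using w 1 2 by simp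
  also have "\<dots> = - (LINT x|lborel. k * n * f' (t + n * x) * \<phi> x)"
    by (simp add: mult.assoc)
  finally show "(LINT x|lborel. k * f (t + n * x) * deriv \<phi> x) = - (LINT x|lborel. k * n * f' (t + n * x) * \<phi> x)" .
qed

text \<open>Makes the rescaled functions admissible indices: \<open>limit_process\<close> prescribes
  covariances for \<open>H2c_fun\<close> only.\<close>

lemma H2c_fun_rescaled:
  assumes g: "H2c_fun g" and N: "1 \<le> N"
  shows "H2c_fun (rescaled N a E g)"
proof -
  define n where "n = real N powr a"
  have n: "0 < n" using N by (simp add: n_def)
  then have n0: "n \<noteq> 0" by simp
  obtain g' g'' where L2: "L2_fun g" "L2_fun g'" "L2_fun g''"
    and weak: "has_weak_derivative g g'" "has_weak_derivative g' g''"
    using g by (auto simp: H2c_fun_def H2_fun_def)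
  have eq: "rescaled N a E g = (\<lambda>x. 1 * g (- (n * E) + n * x))"
    by (simp add: rescaled_def n_def algebra_simps)
  have "H2_fun (rescaled N a E g)"
    unfolding H2_fun_def eq
    using L2_fun_affine[OF L2(1) n0, of 1] L2_fun_affine[OF L2(2) n0, of "1 * n"] L2_fun_affine[OF L2(3) n0, of "1 * n * n"]
      has_weak_derivative_affine[OF weak(1) n, of 1] has_weak_derivative_affine[OF weak(2) n, of "1 * n"]
    by blast
  moreover have "compactly_supported (rescaled N a E g)"
    unfolding compactly_supported_def compact_closure
  proof (rule bounded_subset)
    have "bounded {x. g x \<noteq> 0}" using g by (simp add: H2c_fun_def compactly_supported_def)
    then show "bounded ((\<lambda>y. E + (1 / n) * y) ` {x. g x \<noteq> 0})" by (rule bounded_affine_image)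
    show "{x. rescaled N a E g x \<noteq> 0} \<subseteq> (\<lambda>y. E + (1 / n) * y) ` {x. g x \<noteq> 0}"
    proof
      fix x assume "x \<in> {x. rescaled N a E g x \<noteq> 0}"
      then show "x \<in> (\<lambda>y. E + (1 / n) * y) ` {x. g x \<noteq> 0}"
        using n by (intro image_eqI[where x="n * (x - E)"]) (auto simp: rescaled_def n_def)
    qed
  qed
  ultimately show ?thesis by (simp add: H2c_fun_def)
qed

section \<open>Squared Frobenius norms and normalised traces\<close>

definition frob :: "complex mat \<Rightarrow> real" where
  "frob A = (\<Sum>i<dim_row A. \<Sum>j<dim_col A. (cmod (A $$ (i, j)))\<^sup>2)"

lemma column_norm_le:
  assumes A: "A \<in> carrier_mat N N" "op_norm_le A K" and j: "j < N"
  shows "(\<Sum>i<N. (cmod (A $$ (i, j)))\<^sup>2) \<le> K\<^sup>2"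
proof -
  have dims: "dim_row A = N" "dim_col A = N" using A by auto
  let ?v = "unit_vec N j :: complex vec"
  have K0: "0 \<le> K" using A(2) by (simp add: op_norm_le_def)
  have "?v \<in> carrier_vec (dim_col A)" using dims by simp
  then have le: "sqrt (\<Sum>i<N. (cmod (vec_index (A *\<^sub>v ?v) i))\<^sup>2) \<le> K * sqrt (\<Sum>i<N. (cmod (vec_index ?v i))\<^sup>2)"
    using A(2) unfolding op_norm_le_def dims by blast
  have "vec_index (A *\<^sub>v ?v) i = A $$ (i, j)" if "i < N" for i
    using that j dims by simp
  then have 1: "(\<Sum>i<N. (cmod (vec_index (A *\<^sub>v ?v) i))\<^sup>2) = (\<Sum>i<N. (cmod (A $$ (i, j)))\<^sup>2)"
    by (intro sum.cong) auto
  have "(\<Sum>i<N. (cmod (vec_index ?v i))\<^sup>2) = (\<Sum>i<N. if i = j then 1 else 0)"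
    using j by (intro sum.cong) auto
  also have "\<dots> = 1" using j by simp
  finally have "sqrt (\<Sum>i<N. (cmod (A $$ (i, j)))\<^sup>2) \<le> K" using le unfolding 1 by simp
  also have "K = sqrt (K\<^sup>2)" using K0 by simp
  finally show ?thesis by (simp only: real_sqrt_le_iff)
qed

text \<open>Each column is the image of a unit vector and contributes at most \<open>K ^ 2\<close>.
  The factor \<open>N\<close> is the one that the normalised trace divides out.\<close>

lemma frob_le:
  assumes "A \<in> carrier_mat N N" "op_norm_le A K"
  shows "frob A \<le> real N * K\<^sup>2"
proof -
  have "frob A = (\<Sum>j<N. \<Sum>i<N. (cmod (A $$ (i, j)))\<^sup>2)"
    using assms(1) unfolding frob_def by (subst sum.swap) auto
  also have "\<dots> \<le> (\<Sum>j<N. K\<^sup>2)" by (intro sum_mono column_norm_le[OF assms]) auto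
  finally show ?thesis by simp
qed

lemma entry_le:
  assumes A: "A \<in> carrier_mat N N" "op_norm_le A K" and ij: "i < N" "j < N"
  shows "cmod (A $$ (i, j)) \<le> K"
proof -
  have "(cmod (A $$ (i, j)))\<^sup>2 \<le> (\<Sum>i<N. (cmod (A $$ (i, j)))\<^sup>2)"
    by (rule member_le_sum[of i "{..<N}" "\<lambda>i. (cmod (A $$ (i, j)))\<^sup>2"]) (use ij in auto)
  also have "\<dots> \<le> K\<^sup>2" by (rule column_norm_le[OF A ij(2)])
  finally have le: "(cmod (A $$ (i, j)))\<^sup>2 \<le> K\<^sup>2" .
  have "0 \<le> K" using A(2) by (simp add: op_norm_le_def)
  then show ?thesis by (rule power2_le_imp_le[OF le])
qed

text \<open>The arithmetic-geometric mean inequality, entry by entry, in place of Cauchy-Schwarz; it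
  loses nothing of importance since both norms will have the same bound.\<close>

lemma ntr_mult_le:
  assumes B: "B \<in> carrier_mat N N" and C: "C \<in> carrier_mat N N"
  shows "cmod (ntr (B * C)) \<le> (frob B + frob C) / (2 * real N)"
proof -
  have dims: "dim_row B = N" "dim_col B = N" "dim_row C = N" "dim_col C = N" using B C by auto
  have "mat_trace (B * C) = (\<Sum>i<N. \<Sum>k<N. B $$ (i, k) * C $$ (k, i))"
    unfolding mat_trace_def using dims by (auto simp: scalar_prod_def atLeast0LessThan intro!: sum.cong)
  also have "cmod \<dots> \<le> (\<Sum>i<N. \<Sum>k<N. cmod (B $$ (i, k)) * cmod (C $$ (k, i)))"
    by (intro sum_norm_le) (auto intro!: sum_norm_le simp: norm_mult)
  also have "\<dots> \<le> (\<Sum>i<N. \<Sum>k<N. ((cmod (B $$ (i, k)))\<^sup>2 + (cmod (C $$ (k, i)))\<^sup>2) / 2)"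
  proof (intro sum_mono)
    fix i k
    show "cmod (B $$ (i, k)) * cmod (C $$ (k, i)) \<le> ((cmod (B $$ (i, k)))\<^sup>2 + (cmod (C $$ (k, i)))\<^sup>2) / 2"
      using sum_squares_bound[of "cmod (B $$ (i, k))" "cmod (C $$ (k, i))"] by simp
  qed
  also have "\<dots> = (frob B + (\<Sum>i<N. \<Sum>k<N. (cmod (C $$ (k, i)))\<^sup>2)) / 2"
    by (simp add: frob_def dims sum.distrib flip: sum_divide_distrib)
  also have "(\<Sum>i<N. \<Sum>k<N. (cmod (C $$ (k, i)))\<^sup>2) = frob C"
    unfolding frob_def dims by (rule sum.swap)
  finally have "cmod (mat_trace (B * C)) / real N \<le> (frob B + frob C) / 2 / real N"
    by (intro divide_right_mono) auto
  then show ?thesis by (simp add: ntr_def norm_divide dims)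
qed

lemma mat_adjoint_index:
  fixes B :: "complex mat"
  assumes "B \<in> carrier_mat N N" "i < N" "j < N"
  shows "mat_adjoint B $$ (i, j) = cnj (B $$ (j, i))"
  using assms unfolding mat_adjoint_def by (simp add: mat_of_rows_def conjugate_complex_def)

lemma frob_adjoint:
  assumes B: "B \<in> carrier_mat N N"
  shows "mat_adjoint B \<in> carrier_mat N N" "frob (mat_adjoint B) = frob B"
proof -
  show c: "mat_adjoint B \<in> carrier_mat N N" using B by (auto simp: mat_adjoint_def)
  have "frob (mat_adjoint B) = (\<Sum>i<N. \<Sum>j<N. (cmod (B $$ (j, i)))\<^sup>2)"
    using c mat_adjoint_index[OF B] unfolding frob_def by (auto intro!: sum.cong)
  also have "\<dots> = frob B" using B unfolding frob_def by (subst sum.swap) auto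
  finally show "frob (mat_adjoint B) = frob B" .
qed

lemma frob_cnj:
  assumes B: "B \<in> carrier_mat N N"
  shows "map_mat cnj B \<in> carrier_mat N N" "frob (map_mat cnj B) = frob B"
  using B unfolding frob_def by (auto intro!: sum.cong)

lemma offdiag_part_props:
  assumes A: "A \<in> carrier_mat N N" "op_norm_le A K"
  shows "offdiag_part A \<in> carrier_mat N N" "\<And>i. i < N \<Longrightarrow> offdiag_part A $$ (i, i) = 0"
    and "frob (offdiag_part A) \<le> 4 * real N * K\<^sup>2"
proof -
  have dims: "dim_row A = N" "dim_col A = N" using A by auto
  show c: "offdiag_part A \<in> carrier_mat N N"
    using dims by (auto simp: offdiag_part_def diag_part_def mat_diag_def)
  have e: "offdiag_part A $$ (i, j) = (if i = j then 0 else A $$ (i, j))" if "i < N" "j < N" for i j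
    using that dims by (simp add: offdiag_part_def diag_part_def mat_diag_def)
  then show "\<And>i. i < N \<Longrightarrow> offdiag_part A $$ (i, i) = 0" by simp
  have "frob (offdiag_part A) \<le> frob A"
    using c dims e unfolding frob_def by (auto intro!: sum_mono)
  also have "\<dots> \<le> real N * K\<^sup>2" by (rule frob_le[OF A])
  \<comment> \<open>Weakened by \<open>4\<close> so that the off-diagonal and the traceless diagonal
    parts share one bound.\<close>
  also have "\<dots> \<le> 4 * real N * K\<^sup>2" by simp
  finally show "frob (offdiag_part A) \<le> 4 * real N * K\<^sup>2" .
qed

lemma diag_traceless_props:
  assumes A: "A \<in> carrier_mat N N" "op_norm_le A K" and N: "1 \<le> N"
  defines "B \<equiv> diag_part (traceless_part A)"
  shows "B \<in> carrier_mat N N" "diagonal_mat B" "mat_trace B = 0" "frob B \<le> 4 * real N * K\<^sup>2"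
proof -
  have dims: "dim_row A = N" "dim_col A = N" using A by auto
  have K0: "0 \<le> K" using A(2) by (simp add: op_norm_le_def)
  show c: "B \<in> carrier_mat N N"
    using dims by (auto simp: B_def traceless_part_def diag_part_def mat_diag_def)
  have e: "B $$ (i, j) = (if i = j then A $$ (i, i) - ntr A else 0)" if "i < N" "j < N" for i j
    using that dims by (simp add: B_def traceless_part_def diag_part_def mat_diag_def)
  show "diagonal_mat B" using c e by (auto simp: diagonal_mat_def)
  have "mat_trace B = (\<Sum>i<N. A $$ (i, i) - ntr A)"
    using c e unfolding mat_trace_def by (auto intro!: sum.cong)
  also have "\<dots> = mat_trace A - of_nat N * ntr A" by (simp add: sum_subtractf mat_trace_def dims)
  also have "\<dots> = 0" using N by (simp add: ntr_def dims)
  finally show "mat_trace B = 0" .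
  have "cmod (mat_trace A) \<le> (\<Sum>i<N. K)"
    unfolding mat_trace_def dims by (intro sum_norm_le entry_le[OF A]) auto
  then have "cmod (ntr A) \<le> K" using N by (simp add: ntr_def dims norm_divide field_simps)
  then have d: "cmod (A $$ (i, i) - ntr A) \<le> 2 * K" if "i < N" for i
    using norm_triangle_ineq4[of "A $$ (i, i)" "ntr A"] entry_le[OF A that that] by linarith
  have "frob B = (\<Sum>i<N. \<Sum>j<N. if i = j then (cmod (A $$ (i, i) - ntr A))\<^sup>2 else 0)"
  proof -
    have dB: "dim_row B = N" "dim_col B = N" using c by auto
    show ?thesis unfolding frob_def dB by (intro sum.cong refl) (simp add: e)
  qed
  also have "\<dots> = (\<Sum>i<N. (cmod (A $$ (i, i) - ntr A))\<^sup>2)" by simp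
  also have "\<dots> \<le> (\<Sum>i<N. (2 * K)\<^sup>2)" using d by (intro sum_mono power_mono) auto
  finally show "frob B \<le> 4 * real N * K\<^sup>2" by (simp add: power_mult_distrib)
qed

lemma ntr_products_le:
  assumes B: "B1 \<in> carrier_mat N N" "B2 \<in> carrier_mat N N" "frob B1 \<le> 4 * real N * K\<^sup>2" "frob B2 \<le> 4 * real N * K\<^sup>2"
    and N: "1 \<le> N"
  shows "cmod (ntr (B1 * mat_adjoint B2)) \<le> 4 * K\<^sup>2" "cmod (ntr (B1 * map_mat cnj B2)) \<le> 4 * K\<^sup>2"
proof -
  have *: "(frob B1 + frob B2) / (2 * real N) \<le> 4 * K\<^sup>2"
  proof -
    have "frob B1 + frob B2 \<le> 4 * K\<^sup>2 * (2 * real N)" using B(3,4) by (simp add: mult_ac)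
    then show ?thesis using N by (simp add: pos_divide_le_eq)
  qed
  show "cmod (ntr (B1 * mat_adjoint B2)) \<le> 4 * K\<^sup>2"
    using ntr_mult_le[OF B(1) frob_adjoint(1)[OF B(2)]] * unfolding frob_adjoint(2)[OF B(2)] by linarith
  show "cmod (ntr (B1 * map_mat cnj B2)) \<le> 4 * K\<^sup>2"
    using ntr_mult_le[OF B(1) frob_cnj(1)[OF B(2)]] * unfolding frob_cnj(2)[OF B(2)] by linarith
qed

section \<open>Covariance bounds\<close>

context test_functions
begin

lemma cov_tr_bound:
  assumes w: "integrable angle w" "\<And>u. 0 \<le> w u"
    and sd: "\<And>s u. u \<in> {0..pi} \<Longrightarrow> \<bar>second_diff H s u\<bar> \<le> w u * (1 - cos u)"
    and edge: "f 2 = 0" "f (-2) = 0" and s: "- 1 \<le> s" "s \<le> 1"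
  shows "\<bar>cov_tr s k v f h\<bar> \<le> J * (2 * (LINT u|angle. w u) + (2 * \<bar>k\<bar> + \<bar>v\<bar>) * (bh * pi))"
proof -
  let ?W = "LINT u|angle. w u"
  have W0: "0 \<le> ?W" using w by (intro Bochner_Integration.integral_nonneg) auto
  have nn: "0 \<le> bh * pi" using bounds_nonneg by simp
  have "1 \<le> pi\<^sup>2" using pi_ge_two by (intro one_le_power) auto
  then have "J * ?W / (4 * pi\<^sup>2) \<le> J * ?W / 1"
    using J_nonneg W0 by (intro divide_left_mono) auto
  then have V: "\<bar>Vtr1 f h\<bar> \<le> J * ?W" "\<bar>Vtr2 f h s\<bar> \<le> J * ?W"
    using Vtr1_bound[OF w sd] Vtr2_bound[OF w sd edge s] by simp_all
  have r2: "\<bar>2 - x\<^sup>2\<bar> \<le> 2" if "x \<in> {-2..2}" for x :: real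
  proof -
    have "x\<^sup>2 \<le> 4" using that sq_le_4[of x] by auto
    then show ?thesis using zero_le_power2[of x] unfolding abs_le_iff by linarith
  qed
  have r1: "\<bar>x\<bar> \<le> 2" if "x \<in> {-2..2}" for x :: real using that by auto
  note b2 = f_mean_bounds(2,4)[of "\<lambda>x. 2 - x\<^sup>2" 2, OF _ r2, simplified]
  note b1 = f_mean_bounds(2,4)[of "\<lambda>x. x" 2, OF _ r1, simplified]
  have t1: "\<bar>k / 2 * inv_sc_mean (\<lambda>x. (2 - x\<^sup>2) * f x) * inv_sc_mean (\<lambda>x. (2 - x\<^sup>2) * h x)\<bar> \<le> \<bar>k\<bar> / 2 * (2 * J) * (2 * (bh * pi))"
    unfolding abs_mult using b2 J_nonneg nn by (intro mult_mono) auto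
  have t2: "\<bar>v / 4 * inv_sc_mean (\<lambda>x. x * f x) * inv_sc_mean (\<lambda>x. x * h x)\<bar> \<le> \<bar>v\<bar> / 4 * (2 * J) * (2 * (bh * pi))"
    unfolding abs_mult using b1 J_nonneg nn by (intro mult_mono) auto
  have "\<bar>cov_tr s k v f h\<bar> \<le> J * ?W + J * ?W + \<bar>k\<bar> / 2 * (2 * J) * (2 * (bh * pi)) + \<bar>v\<bar> / 4 * (2 * J) * (2 * (bh * pi))"
    unfolding cov_tr_def using V t1 t2 by linarith
  also have "\<dots> = J * (2 * ?W + (2 * \<bar>k\<bar> + \<bar>v\<bar>) * (bh * pi))" by (simp add: algebra_simps)
  finally show ?thesis .
qed

text \<open>The coarser function enters only through its supremum \<open>bh\<close>, so the coarser
  scale costs nothing here; the whole loss lies in the normalisation that multiplies these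
  functionals.\<close>

lemma cov_d_od_bound:
  assumes lip: "\<And>x y. \<bar>h0 x - h0 y\<bar> \<le> \<Lambda> * \<bar>x - y\<bar>" and s: "- 1 \<le> s" "s \<le> 1"
    and n: "cmod (ntr (B1 * mat_adjoint B2)) \<le> c" "cmod (ntr (D1 * mat_adjoint D2)) \<le> c" "cmod (ntr (D1 * map_mat cnj D2)) \<le> c"
  shows "cmod (cov_d s k v f B1 h B2) + cmod (cov_od s f D1 h D2) \<le>
    c * ((2 * ((1 + pi) * bh + (16 / (1 - \<bar>s\<bar>) ^ 4 + 5) * (bh * pi)) + (4 * \<bar>v\<bar> + 9 * \<bar>k\<bar>) * (bh * pi)) * J)"
proof -
  define X where "X = (1 + pi) * bh * J"
  define Y where "Y = (16 / (1 - \<bar>s\<bar>) ^ 4 + 5) * (bh * pi) * J"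
  have c0: "0 \<le> c" using n(1) norm_ge_zero order_trans by blast
  have nn: "0 \<le> bh * pi" using bounds_nonneg by simp
  have X: "\<bar>Vd1 f h\<bar> \<le> X" unfolding X_def by (rule Vd1_bound)
  have Y: "\<bar>Vd2 f h s\<bar> \<le> Y" unfolding Y_def by (rule Vd2_bound[OF lip s])
  have r3: "\<bar>x\<^sup>2 - 1\<bar> \<le> 3" if "x \<in> {-2..2}" for x :: real
  proof -
    have "x\<^sup>2 \<le> 4" using that sq_le_4[of x] by auto
    then show ?thesis using zero_le_power2[of x] unfolding abs_le_iff by linarith
  qed
  have r1: "\<bar>x\<bar> \<le> 2" if "x \<in> {-2..2}" for x :: real using that by auto
  note b3 = f_mean_bounds(1,3)[of "\<lambda>x. x\<^sup>2 - 1" 3, OF _ r3, simplified]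
  note b1 = f_mean_bounds(1,3)[of "\<lambda>x. x" 2, OF _ r1, simplified]
  have t1: "\<bar>v * sc_mean (\<lambda>x. x * f x) * sc_mean (\<lambda>x. x * h x)\<bar> \<le> \<bar>v\<bar> * (2 * J) * (2 * (bh * pi))"
    unfolding abs_mult using b1 J_nonneg nn by (intro mult_mono) auto
  have t2: "\<bar>k * sc_mean (\<lambda>x. (x\<^sup>2 - 1) * f x) * sc_mean (\<lambda>x. (x\<^sup>2 - 1) * h x)\<bar> \<le> \<bar>k\<bar> * (3 * J) * (3 * (bh * pi))"
    unfolding abs_mult using b3 J_nonneg nn by (intro mult_mono) auto
  let ?S = "Vd1 f h + Vd2 f h s + v * sc_mean (\<lambda>x. x * f x) * sc_mean (\<lambda>x. x * h x)
       + k * sc_mean (\<lambda>x. (x\<^sup>2 - 1) * f x) * sc_mean (\<lambda>x. (x\<^sup>2 - 1) * h x)"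
  have S: "\<bar>?S\<bar> \<le> X + Y + \<bar>v\<bar> * (2 * J) * (2 * (bh * pi)) + \<bar>k\<bar> * (3 * J) * (3 * (bh * pi))"
    using X Y t1 t2 by linarith
  have 1: "cmod (cov_d s k v f B1 h B2) \<le> c * (X + Y + \<bar>v\<bar> * (2 * J) * (2 * (bh * pi)) + \<bar>k\<bar> * (3 * J) * (3 * (bh * pi)))"
    unfolding cov_d_def norm_mult norm_of_real using n(1) S c0 by (intro mult_mono) auto
  have "cmod (cov_od s f D1 h D2) \<le> cmod (ntr (D1 * mat_adjoint D2)) * \<bar>Vd1 f h\<bar> + cmod (ntr (D1 * map_mat cnj D2)) * \<bar>Vd2 f h s\<bar>"
    unfolding cov_od_def by (rule order.trans[OF norm_triangle_ineq]) (simp add: norm_mult)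
  also have "\<dots> \<le> c * X + c * Y" using n(2,3) X Y c0 by (intro add_mono mult_mono) auto
  finally have "cmod (cov_d s k v f B1 h B2) + cmod (cov_od s f D1 h D2) \<le>
      c * (X + Y + \<bar>v\<bar> * (2 * J) * (2 * (bh * pi)) + \<bar>k\<bar> * (3 * J) * (3 * (bh * pi))) + (c * X + c * Y)"
    using 1 by linarith
  also have "\<dots> = c * ((2 * ((1 + pi) * bh + (16 / (1 - \<bar>s\<bar>) ^ 4 + 5) * (bh * pi)) + (4 * \<bar>v\<bar> + 9 * \<bar>k\<bar>) * (bh * pi)) * J)"
  proof -
    define z where "z = 16 / (1 - \<bar>s\<bar>) ^ 4 + 5"
    show ?thesis unfolding X_def Y_def z_def[symmetric] by (simp add: algebra_simps)
  qed
  finally show ?thesis .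
qed

end

lemma abs_diff_le_of_deriv_bound:
  fixes h h' :: "real \<Rightarrow> real"
  assumes "\<And>x. (h has_real_derivative h' x) (at x)" "\<And>x. \<bar>h' x\<bar> \<le> \<Lambda>"
  shows "\<bar>h x - h y\<bar> \<le> \<Lambda> * \<bar>x - y\<bar>"
  using field_differentiable_bound[of UNIV h h' \<Lambda> x y] assms by auto

lemma AE_affine:
  assumes "AE x in lborel. g x = G x" "n \<noteq> 0"
  shows "AE x in lborel. g (n * (x - E)) = G (n * (x - E :: real))"
proof -
  obtain A where A: "A \<in> null_sets lborel" "{x. g x \<noteq> G x} \<subseteq> A"
    using assms(1) by (auto simp: eventually_ae_filter)
  have "AE y in distr lborel borel (\<lambda>x. - (n * E) + n * x). y \<notin> A"
  proof -
    have [measurable]: "A \<in> sets borel" using A(1) by auto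
    have "emeasure lborel A = \<bar>n\<bar> * (\<integral>\<^sup>+x. indicator A (- (n * E) + n * x) \<partial>lborel)"
      using nn_integral_real_affine[of "indicator A" n "- (n * E)"] assms(2) by simp
    moreover have "emeasure lborel A = 0" using A(1) by auto
    ultimately have "(\<integral>\<^sup>+x. indicator A (- (n * E) + n * x) \<partial>lborel) = 0" using assms(2) by auto
    then have "AE x in lborel. (indicator A (- (n * E) + n * x) :: ennreal) = 0"
      by (subst (asm) nn_integral_0_iff_AE) auto
    then have "AE x in lborel. - (n * E) + n * x \<notin> A" by eventually_elim (auto split: split_indicator_asm)
    then show ?thesis by (subst AE_distr_iff) auto
  qed
  then have "AE x in lborel. - (n * E) + n * x \<notin> A" by (rule AE_distrD[rotated]) simp
  then show ?thesis
  proof eventually_elim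
    case (elim x)
    then have "g (- (n * E) + n * x) = G (- (n * E) + n * x)" using A(2) by auto
    moreover have "- (n * E) + n * x = n * (x - E)" by (simp add: algebra_simps)
    ultimately show ?case by simp
  qed
qed

text \<open>The finitely many exceptional \<open>N\<close> are absorbed into the constant. The trace
  bound needs this, being available only once the finer function vanishes at the edges.\<close>

lemma eventual_bound_imp_bound:
  fixes x r :: "nat \<Rightarrow> real"
  assumes "\<And>N. N0 \<le> N \<Longrightarrow> x N \<le> C * r N" "\<And>N. 1 \<le> N \<Longrightarrow> 0 < r N" "\<And>N. 0 \<le> x N"
  shows "\<exists>C. \<forall>N\<ge>1. x N \<le> C * r N"
proof -
  define D where "D = \<bar>C\<bar> + (\<Sum>N<N0. \<bar>x N / r N\<bar>)"
  have "x N \<le> D * r N" if N: "1 \<le> N" for N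
  proof (cases "N0 \<le> N")
    case True
    have "C \<le> D" unfolding D_def by (rule order.trans[OF abs_ge_self]) (simp add: sum_nonneg)
    then have "C * r N \<le> D * r N" using assms(2)[OF N] by (intro mult_right_mono) auto
    then show ?thesis using assms(1)[OF True] by linarith
  next
    case False
    have "\<bar>x N / r N\<bar> \<le> (\<Sum>N<N0. \<bar>x N / r N\<bar>)"
      by (rule member_le_sum[of N "{..<N0}" "\<lambda>N. \<bar>x N / r N\<bar>"]) (use False in auto)
    then have "x N / r N \<le> D" unfolding D_def by linarith
    then show ?thesis using assms(2)[OF N] by (simp add: pos_divide_le_eq)
  qed
  then show ?thesis by blast
qed

section \<open>Covariances of the limit processes\<close>

lemma Cov_commute: "cmod (Cov M Y X) = cmod (Cov M X Y)"
proof -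
  have "Cov M Y X = (LINT w|M. cnj (X w * cnj (Y w)))" unfolding Cov_def by (simp add: mult.commute)
  also have "\<dots> = cnj (Cov M X Y)" unfolding Cov_def by (rule Bochner_Integration.integral_cnj)
  finally show ?thesis by simp
qed

lemma entry_sigma_range:
  assumes "wigner_entries P \<chi>od \<chi>d"
  shows "- 1 \<le> entry_sigma P \<chi>od" "entry_sigma P \<chi>od \<le> 1"
  using assms by (auto simp: wigner_entries_def entry_sigma_def)

lemma limit_process_Cov_tr:
  assumes "limit_process N s k v M \<xi>" "H2c_fun f" "H2c_fun h"
  shows "Cov M (\<xi> (Xi_tr f)) (\<xi> (Xi_tr h)) = of_real (cov_tr s k v f h)"
  using assms unfolding limit_process_def by blast

lemma limit_process_Cov_d:
  assumes p: "limit_process N s k v M \<xi>" and "(a1, E1, f, B1) \<in> d_args N" "(a2, E2, h, B2) \<in> d_args N"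
  shows "Cov M (\<xi> (Xi_d a1 E1 f B1)) (\<xi> (Xi_d a2 E2 h B2)) =
    of_real (sqrt (C_scale N a1 E1 * C_scale N a2 E2)) * cov_d s k v f B1 h B2"
proof -
  have "\<forall>(a1, E1, f, B1) \<in> d_args N. \<forall>(a2, E2, h, B2) \<in> d_args N.
        Cov M (\<xi> (Xi_d a1 E1 f B1)) (\<xi> (Xi_d a2 E2 h B2)) =
          of_real (sqrt (C_scale N a1 E1 * C_scale N a2 E2)) * cov_d s k v f B1 h B2"
    using p unfolding limit_process_def by (elim conjE)
  from bspec[OF this assms(2)] show ?thesis using assms(3) by auto
qed

lemma limit_process_Cov_od:
  assumes p: "limit_process N s k v M \<xi>" and "(a1, E1, f, B1) \<in> od_args N" "(a2, E2, h, B2) \<in> od_args N"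
  shows "Cov M (\<xi> (Xi_od a1 E1 f B1)) (\<xi> (Xi_od a2 E2 h B2)) =
    of_real (sqrt (C_scale N a1 E1 * C_scale N a2 E2)) * cov_od s f B1 h B2"
proof -
  have "\<forall>(a1, E1, f, B1) \<in> od_args N. \<forall>(a2, E2, h, B2) \<in> od_args N.
        Cov M (\<xi> (Xi_od a1 E1 f B1)) (\<xi> (Xi_od a2 E2 h B2)) =
          of_real (sqrt (C_scale N a1 E1 * C_scale N a2 E2)) * cov_od s f B1 h B2"
    using p unfolding limit_process_def by (elim conjE)
  from bspec[OF this assms(2)] show ?thesis using assms(3) by auto
qed

text \<open>The order \<open>a2 < a1\<close> fixes the roles in \<open>test_functions\<close>: the
  first function is the finer one. In the second claim the constant precedes the matrices, so it is
  uniform over all of norm at most \<open>K\<close>.\<close>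

lemma covariances_bound_ordered:
  fixes P :: "'p measure" and \<chi>od :: "'p \<Rightarrow> complex" and \<chi>d :: "'p \<Rightarrow> real"
    and M :: "nat \<Rightarrow> 'w measure" and \<xi> :: "nat \<Rightarrow> xi_index \<Rightarrow> 'w \<Rightarrow> complex"
    and \<epsilon> E1 E2 a1 a2 K :: real and g1 g2 :: "real \<Rightarrow> real"
  assumes entries: "wigner_entries P \<chi>od \<chi>d"
    and process: "\<And>N. 1 \<le> N \<Longrightarrow>
      limit_process N (entry_sigma P \<chi>od) (entry_kappa4 P \<chi>od) (entry_w2_tilde P \<chi>od \<chi>d)
        (M N) (\<xi> N)"
    and eps: "0 < \<epsilon>"
    and E1: "E1 \<in> {-2 + \<epsilon>..2 - \<epsilon>}" and E2: "E2 \<in> {-2 + \<epsilon>..2 - \<epsilon>}"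
    and a1: "a1 < 1" and a2: "0 \<le> a2" and a_less: "a2 < a1"
    and g1: "H2c_fun g1" and g2: "H2c_fun g2"
  shows
    "\<exists>C. \<forall>N\<ge>1.
        cmod (Cov (M N) (\<xi> N (Xi_tr (rescaled N a1 E1 g1))) (\<xi> N (Xi_tr (rescaled N a2 E2 g2))))
          \<le> C * real N powr (- (a1 - a2))"
    and "\<exists>C. \<forall>N\<ge>1. \<forall>A1 \<in> carrier_mat N N. \<forall>A2 \<in> carrier_mat N N.
        op_norm_le A1 K \<longrightarrow> op_norm_le A2 K \<longrightarrow>
        cmod (Cov (M N)
          (\<xi> N (Xi_d a1 E1 (rescaled N a1 E1 g1) (diag_part (traceless_part A1))))
          (\<xi> N (Xi_d a2 E2 (rescaled N a2 E2 g2) (diag_part (traceless_part A2)))))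
        + cmod (Cov (M N)
          (\<xi> N (Xi_od a1 E1 (rescaled N a1 E1 g1) (offdiag_part A1)))
          (\<xi> N (Xi_od a2 E2 (rescaled N a2 E2 g2) (offdiag_part A2))))
          \<le> C * real N powr (- (a1 - a2) / 2)"
proof -
  define s where "s = entry_sigma P \<chi>od"
  define k where "k = entry_kappa4 P \<chi>od"
  define v where "v = entry_w2_tilde P \<chi>od \<chi>d"
  have s: "- 1 \<le> s" "s \<le> 1" using entry_sigma_range[OF entries] by (simp_all add: s_def)
  have proc: "limit_process N s k v (M N) (\<xi> N)" if "1 \<le> N" for N
    using process[OF that] by (simp only: s_def k_def v_def)
  obtain G1 G1' b1 L1 K1 R1 where G1: "AE x in lborel. g1 x = G1 x" "\<And>x. (G1 has_real_derivative G1' x) (at x)"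
    "\<And>x. \<bar>G1 x\<bar> \<le> b1" "\<And>x. R1 \<le> \<bar>x\<bar> \<Longrightarrow> G1 x = 0" "\<And>x. R1 \<le> \<bar>x\<bar> \<Longrightarrow> g1 x = 0" "0 < R1"
    by (rule H2c_fun_C1_representative[OF g1]) (rule that)
  obtain G2 G2' b2 L2 K2 R2 where G2: "AE x in lborel. g2 x = G2 x" "\<And>x. (G2 has_real_derivative G2' x) (at x)"
    "\<And>x. \<bar>G2 x\<bar> \<le> b2" "\<And>x. \<bar>G2' x\<bar> \<le> L2" "\<And>x y. \<bar>G2' x - G2' y\<bar> \<le> K2 * sqrt \<bar>x - y\<bar>" "0 \<le> K2"
    by (rule H2c_fun_C1_representative[OF g2]) (rule that)
  have cont: "continuous_on UNIV G1" "continuous_on UNIV G2"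
    using G1(2) G2(2) by (meson DERIV_isCont continuous_at_imp_continuous_on)+
  have borel: "g1 \<in> borel_measurable borel" "g2 \<in> borel_measurable borel"
    using g1 g2 by (auto simp: H2c_fun_def H2_fun_def L2_fun_def)
  define cJ where "cJ = 2 * R1 * b1 / sqrt \<epsilon> + 2 * pi * R1 * b1 / \<epsilon>"
  define cw where "cw = 144 * pi * (b2 + K2 + L2)"
  define n1 where "n1 N = real N powr a1" for N :: nat
  define n2 where "n2 N = real N powr a2" for N :: nat
  have n_ge: "1 \<le> n1 N" "1 \<le> n2 N" if "1 \<le> N" for N
    using that a2 a_less by (auto simp: n1_def n2_def ge_one_powr_ge_zero)
  let ?f = "\<lambda>N. rescaled N a1 E1 g1" and ?h = "\<lambda>N. rescaled N a2 E2 g2"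
  let ?F = "\<lambda>N x. G1 (n1 N * (x - E1))" and ?H = "\<lambda>N x. G2 (n2 N * (x - E2))"
  let ?h' = "\<lambda>N x. n2 N * G2' (n2 N * (x - E2))"
  have tf: "test_functions (?f N) (?h N) (?F N) (?H N) b1 b2" if N: "1 \<le> N" for N
  proof
    note n = n_ge[OF N]
    show "?f N \<in> borel_measurable borel" "?h N \<in> borel_measurable borel"
      using borel unfolding rescaled_def by measurable
    show "AE x in lborel. ?f N x = ?F N x"
      unfolding rescaled_def n1_def[symmetric] by (rule AE_affine[OF G1(1)]) (use n in auto)
    show "AE x in lborel. ?h N x = ?H N x"
      unfolding rescaled_def n2_def[symmetric] by (rule AE_affine[OF G2(1)]) (use n in auto)
    show "continuous_on UNIV (?F N)" "continuous_on UNIV (?H N)"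
      by (intro continuous_on_compose2[OF cont(1)] continuous_on_compose2[OF cont(2)] continuous_intros; simp)+
  qed (use G1(3) G2(3) in auto)
  have J: "test_functions.J (?F N) \<le> cJ / n1 N" if N: "1 \<le> N" for N
  proof -
    interpret test_functions "?f N" "?h N" "?F N" "?H N" b1 b2 by (rule tf[OF N])
    show ?thesis unfolding J_def F_def cJ_def
      by (rule integral_angle_rescaled[OF cont(1) G1(3,4,6) eps E1 n_ge(1)[OF N]])
  qed
  have dh: "(?H N has_real_derivative ?h' N x) (at x)" for N x
  proof -
    have "((\<lambda>x. n2 N * (x - E2)) has_real_derivative n2 N) (at x)"
      by (auto intro!: derivative_eq_intros)
    from DERIV_chain2[where f=G2 and g="\<lambda>x. n2 N * (x - E2)", OF G2(2) this]
    show ?thesis by (simp only: mult.commute)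
  qed
  have Lh: "\<bar>?h' N x\<bar> \<le> L2 * n2 N" if "1 \<le> N" for N x
    using mult_left_mono[OF G2(4)[of "n2 N * (x - E2)"], of "n2 N"] n_ge(2)[OF that]
    by (simp add: abs_mult mult.commute)
  have Kh: "\<bar>?h' N x - ?h' N y\<bar> \<le> K2 * n2 N * sqrt (n2 N * \<bar>x - y\<bar>)" if N: "1 \<le> N" for N x y
  proof -
    have n0: "0 \<le> n2 N" using n_ge(2)[OF N] by linarith
    have "\<bar>?h' N x - ?h' N y\<bar> = n2 N * \<bar>G2' (n2 N * (x - E2)) - G2' (n2 N * (y - E2))\<bar>"
      unfolding right_diff_distrib[symmetric] abs_mult using n0 by simp
    also have "\<dots> \<le> n2 N * (K2 * sqrt \<bar>n2 N * (x - E2) - n2 N * (y - E2)\<bar>)"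
      using G2(5) n0 by (intro mult_left_mono) auto
    also have "n2 N * (x - E2) - n2 N * (y - E2) = n2 N * (x - y)" by (simp add: algebra_simps)
    also have "\<bar>n2 N * (x - y)\<bar> = n2 N * \<bar>x - y\<bar>" using n0 by (simp add: abs_mult)
    finally show ?thesis by (simp only: mult_ac)
  qed
  have pi0: "0 \<le> b2 * pi" using G2(3)[of 0] by (intro mult_nonneg_nonneg) auto
  let ?x = "\<lambda>N. cmod (Cov (M N) (\<xi> N (Xi_tr (?f N))) (\<xi> N (Xi_tr (?h N))))"
  \<comment> \<open>For smaller \<open>N\<close> the first test function need not vanish at the edges \<open>\<plusminus>2\<close>.\<close>
  define X where "X = max 1 (R1 / \<epsilon>)"
  define N1 where "N1 = nat \<lceil>X powr (1 / a1)\<rceil>"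
  have N1: "R1 / \<epsilon> \<le> n1 N" if "N1 \<le> N" for N
  proof -
    have a1pos: "0 < a1" using a2 a_less by linarith
    have "X powr (1 / a1) \<le> real N" using that unfolding N1_def by linarith
    then have "(X powr (1 / a1)) powr a1 \<le> real N powr a1" using a1pos by (intro powr_mono2) auto
    moreover have "(X powr (1 / a1)) powr a1 = X" using a1pos by (simp add: powr_powr X_def)
    ultimately show ?thesis by (simp add: n1_def X_def)
  qed
  show "\<exists>C. \<forall>N\<ge>1. ?x N \<le> C * real N powr (- (a1 - a2))"
  proof (rule eventual_bound_imp_bound)
    fix N assume "max 1 N1 \<le> N"
    then have N: "1 \<le> N" "R1 / \<epsilon> \<le> n1 N" using N1 by auto
    interpret test_functions "?f N" "?h N" "?F N" "?H N" b1 b2 by (rule tf[OF N(1)])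
    note n = n_ge[OF N(1)]
    have edge: "?f N x = 0" if "x \<in> {-2, 2}" for x
    proof -
      have "\<epsilon> \<le> \<bar>x - E1\<bar>" using that E1 by auto
      then have "n1 N * \<epsilon> \<le> n1 N * \<bar>x - E1\<bar>" using n by (intro mult_left_mono) auto
      moreover have "R1 \<le> n1 N * \<epsilon>" using N(2) eps by (simp add: pos_divide_le_eq)
      ultimately have "R1 \<le> n1 N * \<bar>x - E1\<bar>" by linarith
      also have "\<dots> = \<bar>n1 N * (x - E1)\<bar>" using n by (simp add: abs_mult)
      finally have "R1 \<le> \<bar>n1 N * (x - E1)\<bar>" .
      then show ?thesis using G1(5) by (simp add: rescaled_def n1_def)
    qed
    obtain w where w: "integrable angle w" "\<And>u. 0 \<le> w u"
      "\<And>s u. u \<in> {0..pi} \<Longrightarrow> \<bar>second_diff (\<lambda>t. ?H N (cs t)) s u\<bar> \<le> w u * (1 - cos u)"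
      "(LINT u|angle. w u) \<le> 144 * pi * (b2 + K2 + L2) * n2 N"
      by (rule second_diff_weight[OF n(2) dh h0_bound Lh[OF N(1)] Kh[OF N(1)] G2(6)]) (rule that)
    have sd: "\<bar>second_diff H t u\<bar> \<le> w u * (1 - cos u)" if "u \<in> {0..pi}" for t u
      using w(3)[OF that, of t] by (simp add: second_diff_def H_def)
    have "?x N = \<bar>cov_tr s k v (?f N) (?h N)\<bar>"
      using limit_process_Cov_tr[OF proc[OF N(1)] H2c_fun_rescaled[OF g1 N(1)] H2c_fun_rescaled[OF g2 N(1)]]
      by (simp only: norm_of_real)
    also have "\<dots> \<le> J * (2 * (LINT u|angle. w u) + (2 * \<bar>k\<bar> + \<bar>v\<bar>) * (b2 * pi))"
      by (rule cov_tr_bound[OF w(1,2) sd edge edge s]) auto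
    \<comment> \<open>The terms without \<open>w\<close> would even be of order
      \<open>1 / n1 N\<close>; they are enlarged by \<open>n2 N \<ge> 1\<close> to fit the common
      rate.\<close>
    also have "\<dots> \<le> cJ / n1 N * (2 * (cw * n2 N) + (2 * \<bar>k\<bar> + \<bar>v\<bar>) * (b2 * pi) * n2 N)"
    proof (rule mult_mono)
      show "J \<le> cJ / n1 N" by (rule J[OF N(1)])
      then show "0 \<le> cJ / n1 N" using J_nonneg by linarith
      have "(2 * \<bar>k\<bar> + \<bar>v\<bar>) * (b2 * pi) * 1 \<le> (2 * \<bar>k\<bar> + \<bar>v\<bar>) * (b2 * pi) * n2 N"
        using n pi0 by (intro mult_left_mono mult_nonneg_nonneg[OF _ pi0]) auto
      then show "2 * (LINT u|angle. w u) + (2 * \<bar>k\<bar> + \<bar>v\<bar>) * (b2 * pi) \<le> 2 * (cw * n2 N) + (2 * \<bar>k\<bar> + \<bar>v\<bar>) * (b2 * pi) * n2 N"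
        using w(4) unfolding cw_def[symmetric] by linarith
      have "0 \<le> (LINT u|angle. w u)" using w(2) by (intro Bochner_Integration.integral_nonneg)
      then show "0 \<le> 2 * (LINT u|angle. w u) + (2 * \<bar>k\<bar> + \<bar>v\<bar>) * (b2 * pi)"
        using pi0 by (intro add_nonneg_nonneg mult_nonneg_nonneg[OF _ pi0]) auto
    qed
    also have "\<dots> = cJ * (2 * cw + (2 * \<bar>k\<bar> + \<bar>v\<bar>) * (b2 * pi)) * (n2 N / n1 N)"
      by (simp add: algebra_simps add_divide_distrib)
    also have "n2 N / n1 N = real N powr (- (a1 - a2))"
      unfolding n1_def n2_def by (simp add: powr_diff)
    finally show "?x N \<le> cJ * (2 * cw + (2 * \<bar>k\<bar> + \<bar>v\<bar>) * (b2 * pi)) * real N powr (- (a1 - a2))" .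
  qed auto
  define c\<rho> where "c\<rho> = 4 * pi\<^sup>2 / (\<epsilon> * sqrt \<epsilon>) + 1"
  have c\<rho>0: "0 \<le> c\<rho>" using eps by (simp add: c\<rho>_def)
  define cd where "cd = 2 * ((1 + pi) * b2 + (16 / (1 - \<bar>s\<bar>) ^ 4 + 5) * (b2 * pi)) + (4 * \<bar>v\<bar> + 9 * \<bar>k\<bar>) * (b2 * pi)"
  have cd0: "0 \<le> cd"
  proof -
    have "0 \<le> b2" using G2(3)[of 0] by linarith
    then have "0 \<le> (1 + pi) * b2" by simp
    moreover have "0 \<le> (16 / (1 - \<bar>s\<bar>) ^ 4 + 5) * (b2 * pi)" by (rule mult_nonneg_nonneg[OF _ pi0]) auto
    moreover have "0 \<le> (4 * \<bar>v\<bar> + 9 * \<bar>k\<bar>) * (b2 * pi)" by (rule mult_nonneg_nonneg[OF _ pi0]) auto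
    ultimately show ?thesis unfolding cd_def by (intro add_nonneg_nonneg mult_nonneg_nonneg[of 2]) simp_all
  qed
  have C2: "cmod (Cov (M N)
          (\<xi> N (Xi_d a1 E1 (?f N) (diag_part (traceless_part A1))))
          (\<xi> N (Xi_d a2 E2 (?h N) (diag_part (traceless_part A2)))))
        + cmod (Cov (M N)
          (\<xi> N (Xi_od a1 E1 (?f N) (offdiag_part A1)))
          (\<xi> N (Xi_od a2 E2 (?h N) (offdiag_part A2))))
          \<le> c\<rho> * (4 * K\<^sup>2 * (cd * cJ)) * real N powr (- (a1 - a2) / 2)"
    if N: "1 \<le> N" and A1: "A1 \<in> carrier_mat N N" "op_norm_le A1 K" and A2: "A2 \<in> carrier_mat N N" "op_norm_le A2 K" for N A1 A2
  proof -
    interpret test_functions "?f N" "?h N" "?F N" "?H N" b1 b2 by (rule tf[OF N])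
    note n = n_ge[OF N]
    let ?B1 = "diag_part (traceless_part A1)" and ?B2 = "diag_part (traceless_part A2)"
    let ?D1 = "offdiag_part A1" and ?D2 = "offdiag_part A2"
    note dp1 = diag_traceless_props[OF A1 N] and dp2 = diag_traceless_props[OF A2 N]
    note op1 = offdiag_part_props[OF A1] and op2 = offdiag_part_props[OF A2]
    have rng: "0 \<le> a1" "a2 < 1" "- 2 < E1" "E1 < 2" "- 2 < E2" "E2 < 2"
      using a1 a2 a_less E1 E2 eps by auto
    have fH: "H2c_fun (?f N)" "H2c_fun (?h N)" using H2c_fun_rescaled[OF _ N] g1 g2 by blast+
    have da: "(a1, E1, ?f N, ?B1) \<in> d_args N" "(a2, E2, ?h N, ?B2) \<in> d_args N"
      unfolding d_args_def using rng a1 a2 fH dp1(1-3) dp2(1-3) by simp_all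
    have oda: "(a1, E1, ?f N, ?D1) \<in> od_args N" "(a2, E2, ?h N, ?D2) \<in> od_args N"
      unfolding od_args_def using rng a1 a2 fH op1(1,2) op2(1,2) by simp_all
    let ?q = "sqrt (C_scale N a1 E1 * C_scale N a2 E2)"
    note c1 = C_scale_bound[OF eps E1 N rng(1), folded c\<rho>_def n1_def]
      and c2 = C_scale_bound[OF eps E2 N a2, folded c\<rho>_def n2_def]
    have q0: "0 \<le> ?q" using c1(1) c2(1) by simp
    have "?q \<le> sqrt ((c\<rho> * n1 N) * (c\<rho> * n2 N))"
      using c1 c2 c\<rho>0 n by (intro real_sqrt_le_mono mult_mono) auto
    also have "\<dots> = sqrt (c\<rho>\<^sup>2 * (n1 N * n2 N))" by (simp add: power2_eq_square mult_ac)
    also have "\<dots> = c\<rho> * sqrt (n1 N * n2 N)" using c\<rho>0 by (simp add: real_sqrt_mult)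
    finally have q: "?q \<le> c\<rho> * sqrt (n1 N * n2 N)" .
    have lip: "\<bar>?H N x - ?H N y\<bar> \<le> (L2 * n2 N) * \<bar>x - y\<bar>" for x y
      by (rule abs_diff_le_of_deriv_bound[OF dh Lh[OF N]])
    have ntrs: "cmod (ntr (?B1 * mat_adjoint ?B2)) \<le> 4 * K\<^sup>2" "cmod (ntr (?D1 * mat_adjoint ?D2)) \<le> 4 * K\<^sup>2"
      "cmod (ntr (?D1 * map_mat cnj ?D2)) \<le> 4 * K\<^sup>2"
      by (rule ntr_products_le[OF dp1(1) dp2(1) dp1(4) dp2(4) N] ntr_products_le[OF op1(1) op2(1) op1(3) op2(3) N])+
    have "cmod (cov_d s k v (?f N) ?B1 (?h N) ?B2) + cmod (cov_od s (?f N) ?D1 (?h N) ?D2) \<le> 4 * K\<^sup>2 * (cd * J)"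
      unfolding cd_def by (rule cov_d_od_bound[OF lip s ntrs])
    also have "\<dots> \<le> 4 * K\<^sup>2 * (cd * (cJ / n1 N))"
      using J[OF N] cd0 by (intro mult_left_mono) auto
    finally have cov: "cmod (cov_d s k v (?f N) ?B1 (?h N) ?B2) + cmod (cov_od s (?f N) ?D1 (?h N) ?D2) \<le> 4 * K\<^sup>2 * (cd * (cJ / n1 N))" .
    have "cmod (Cov (M N) (\<xi> N (Xi_d a1 E1 (?f N) ?B1)) (\<xi> N (Xi_d a2 E2 (?h N) ?B2)))
        + cmod (Cov (M N) (\<xi> N (Xi_od a1 E1 (?f N) ?D1)) (\<xi> N (Xi_od a2 E2 (?h N) ?D2)))
      = ?q * (cmod (cov_d s k v (?f N) ?B1 (?h N) ?B2) + cmod (cov_od s (?f N) ?D1 (?h N) ?D2))"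
      unfolding limit_process_Cov_d[OF proc[OF N] da] limit_process_Cov_od[OF proc[OF N] oda] norm_mult norm_of_real
      using q0 by (simp only: abs_of_nonneg distrib_left)
    also have "\<dots> \<le> c\<rho> * sqrt (n1 N * n2 N) * (4 * K\<^sup>2 * (cd * (cJ / n1 N)))"
      by (rule mult_mono[OF q cov order.trans[OF q0 q]]) simp
    also have "\<dots> = c\<rho> * (4 * K\<^sup>2 * (cd * cJ)) * (sqrt (n1 N * n2 N) / n1 N)" by simp
    also have "sqrt (n1 N * n2 N) / n1 N = real N powr (- (a1 - a2) / 2)"
    proof -
      have "sqrt (n1 N * n2 N) = real N powr ((a1 + a2) / 2)"
        unfolding n1_def n2_def by (simp add: powr_add[symmetric] powr_half_sqrt[symmetric] powr_powr)
      moreover have "(a1 + a2) / 2 - a1 = - (a1 - a2) / 2" by (simp add: field_simps)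
      ultimately show ?thesis unfolding n1_def by (simp only: powr_diff[symmetric])
    qed
    finally show ?thesis .
  qed
  show "\<exists>C. \<forall>N\<ge>1. \<forall>A1 \<in> carrier_mat N N. \<forall>A2 \<in> carrier_mat N N.
        op_norm_le A1 K \<longrightarrow> op_norm_le A2 K \<longrightarrow>
        cmod (Cov (M N)
          (\<xi> N (Xi_d a1 E1 (rescaled N a1 E1 g1) (diag_part (traceless_part A1))))
          (\<xi> N (Xi_d a2 E2 (rescaled N a2 E2 g2) (diag_part (traceless_part A2)))))
        + cmod (Cov (M N)
          (\<xi> N (Xi_od a1 E1 (rescaled N a1 E1 g1) (offdiag_part A1)))
          (\<xi> N (Xi_od a2 E2 (rescaled N a2 E2 g2) (offdiag_part A2))))
          \<le> C * real N powr (- (a1 - a2) / 2)"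
    by (intro exI[of _ "c\<rho> * (4 * K\<^sup>2 * (cd * cJ))"] allI impI ballI C2)
qed

text \<open>Exchanging the arguments conjugates a covariance and keeps its modulus, so the ordered
  case settles both. Boundedness of the matrices is the common operator norm bound \<open>K\<close>,
  and the constant depends neither on \<open>N\<close> nor on the matrices.\<close>

theorem theorem2p13:
  fixes P :: "'p measure" and \<chi>od :: "'p \<Rightarrow> complex" and \<chi>d :: "'p \<Rightarrow> real"
    and M :: "nat \<Rightarrow> 'w measure" and \<xi> :: "nat \<Rightarrow> xi_index \<Rightarrow> 'w \<Rightarrow> complex"
    and \<epsilon> E1 E2 a1 a2 K :: real and g1 g2 :: "real \<Rightarrow> real"
  assumes entries: "wigner_entries P \<chi>od \<chi>d"
    and process: "\<And>N. 1 \<le> N \<Longrightarrow>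
      limit_process N (entry_sigma P \<chi>od) (entry_kappa4 P \<chi>od) (entry_w2_tilde P \<chi>od \<chi>d)
        (M N) (\<xi> N)"
    and eps: "0 < \<epsilon>"
    and E1: "E1 \<in> {-2 + \<epsilon>..2 - \<epsilon>}" and E2: "E2 \<in> {-2 + \<epsilon>..2 - \<epsilon>}"
    and a1: "0 \<le> a1" "a1 < 1" and a2: "0 \<le> a2" "a2 < 1" and a_neq: "a1 \<noteq> a2"
    and g1: "H2c_fun g1" and g2: "H2c_fun g2"
  shows
    "(\<exists>C. \<forall>N\<ge>1.
        cmod (Cov (M N) (\<xi> N (Xi_tr (rescaled N a1 E1 g1))) (\<xi> N (Xi_tr (rescaled N a2 E2 g2))))
          \<le> C * real N powr (- \<bar>a1 - a2\<bar>))
     \<and> (\<exists>C. \<forall>N\<ge>1. \<forall>A1 \<in> carrier_mat N N. \<forall>A2 \<in> carrier_mat N N.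
        op_norm_le A1 K \<longrightarrow> op_norm_le A2 K \<longrightarrow>
        cmod (Cov (M N)
          (\<xi> N (Xi_d a1 E1 (rescaled N a1 E1 g1) (diag_part (traceless_part A1))))
          (\<xi> N (Xi_d a2 E2 (rescaled N a2 E2 g2) (diag_part (traceless_part A2)))))
        + cmod (Cov (M N)
          (\<xi> N (Xi_od a1 E1 (rescaled N a1 E1 g1) (offdiag_part A1)))
          (\<xi> N (Xi_od a2 E2 (rescaled N a2 E2 g2) (offdiag_part A2))))
          \<le> C * real N powr (- \<bar>a1 - a2\<bar> / 2))"
proof (cases "a2 < a1")
  case True
  then have abs: "\<bar>a1 - a2\<bar> = a1 - a2" by simp
  show ?thesis
    unfolding abs
    by (intro conjI covariances_bound_ordered[OF entries process eps E1 E2 a1(2) a2(1) True g1 g2])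
next
  case False
  then have less: "a1 < a2" using a_neq by simp
  then have abs: "\<bar>a1 - a2\<bar> = a2 - a1" by simp
  note swapped = covariances_bound_ordered(1)[OF entries process eps E2 E1 a2(2) a1(1) less g2 g1]
    covariances_bound_ordered(2)[where K=K, OF entries process eps E2 E1 a2(2) a1(1) less g2 g1]
  from swapped(1) obtain C where C: "\<forall>N\<ge>1.
      cmod (Cov (M N) (\<xi> N (Xi_tr (rescaled N a2 E2 g2))) (\<xi> N (Xi_tr (rescaled N a1 E1 g1))))
        \<le> C * real N powr (- (a2 - a1))" ..
  from swapped(2) obtain D where D: "\<forall>N\<ge>1. \<forall>A2 \<in> carrier_mat N N. \<forall>A1 \<in> carrier_mat N N.
        op_norm_le A2 K \<longrightarrow> op_norm_le A1 K \<longrightarrow>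
        cmod (Cov (M N)
          (\<xi> N (Xi_d a2 E2 (rescaled N a2 E2 g2) (diag_part (traceless_part A2))))
          (\<xi> N (Xi_d a1 E1 (rescaled N a1 E1 g1) (diag_part (traceless_part A1)))))
        + cmod (Cov (M N)
          (\<xi> N (Xi_od a2 E2 (rescaled N a2 E2 g2) (offdiag_part A2)))
          (\<xi> N (Xi_od a1 E1 (rescaled N a1 E1 g1) (offdiag_part A1))))
          \<le> D * real N powr (- (a2 - a1) / 2)" ..
  show ?thesis
    unfolding abs
  proof (intro conjI exI allI impI ballI)
    fix N :: nat assume N: "1 \<le> N"
    show "cmod (Cov (M N) (\<xi> N (Xi_tr (rescaled N a1 E1 g1))) (\<xi> N (Xi_tr (rescaled N a2 E2 g2)))) \<le> C * real N powr (- (a2 - a1))"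
      using C N by (subst Cov_commute) simp
    fix A1 A2 :: "complex mat"
    assume A: "A1 \<in> carrier_mat N N" "A2 \<in> carrier_mat N N" "op_norm_le A1 K" "op_norm_le A2 K"
    show "cmod (Cov (M N)
          (\<xi> N (Xi_d a1 E1 (rescaled N a1 E1 g1) (diag_part (traceless_part A1))))
          (\<xi> N (Xi_d a2 E2 (rescaled N a2 E2 g2) (diag_part (traceless_part A2)))))
        + cmod (Cov (M N)
          (\<xi> N (Xi_od a1 E1 (rescaled N a1 E1 g1) (offdiag_part A1)))
          (\<xi> N (Xi_od a2 E2 (rescaled N a2 E2 g2) (offdiag_part A2))))
          \<le> D * real N powr (- (a2 - a1) / 2)"
      by (rule ord_eq_le_trans[OF arg_cong2[where f="(+)", OF Cov_commute Cov_commute]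
            D[rule_format, OF N A(2) A(1) A(4) A(3)]])
  qed
qed

end
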